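(* Let $F^{2n}=(M,M',F^{\ast})$ be a $2n$-dimensional pseudo-Finsler manifold with associated pseudo-Riemannian metric $g$ on the vertical bundle $VM'$. Let $HM'$ be a non-linear connection on $M'$, and let $S$ and $T$ be two arbitrary skew-symmetric Finsler tensor fields of type $(1,2)$ on $F^{2n}$. Let $\mathcal{U}'\subset M'$ be the domain of a chart with induced coordinates $(x^i,y^i)_{i=1}^{2n}$, let $J_1,J_2,J_3$ be the almost hypercomplex structure on $\mathcal{U}'$ determined by $HM'$ and the chart (defined in the context), and let $a\in\{1,3\}$. Then there exists a unique linear connection $\nabla^a$ on $V\mathcal{U}'$ satisfying the following conditions: (1) $\nabla^a$ is a metric connection, i.e. $X(g(U,W))=g(\nabla^a_XU,W)+g(U,\nabla^a_XW)$ for all $X\in\Gamma(T\mathcal{U}')$ and $U,W\in\Gamma(V\mathcal{U}')$; (2) the torsion tensor $T^{D^a}$ of the linear connection $D^a$ on $\mathcal{U}'$ defined by $D^a_XY=\nabla^a_XvY-J_a\nabla^a_XJ_ahY$ satisfies, for all $X,Y\in\Gamma(T\mathcal{U}')$, (i) $T^{D^a}(vX,vY)=S(vX,vY)$, (ii) $h\,T^{D^a}(hX,hY)=J_a\,T(J_ahY,J_ahX)$.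
   Context: Setting. $M$ is a smooth manifold of dimension $m=2n$ with tangent bundle projection $\pi:TM\to M$; $M'$ is a nonempty open submanifold of $TM$ with $\pi(M')=M$ and not meeting the zero section. Coordinates $(x^i,y^i)$, $i=1,\dots,2n$, on $\mathcal{U}'\subset M'$ are those induced on $TM$ by coordinates $(x^i)$ on $M$. A pseudo-Finsler manifold $(M,M',F^\ast)$ has a smooth function $F^\ast:M'\to\mathbb{R}$ that is positively homogeneous of degree two in $y$ ($F^\ast(x,ky)=k^2F^\ast(x,y)$ for $k>0$) and such that, at each point, the matrix $g_{ij}=\frac12\frac{\partial^2F^\ast}{\partial y^i\partial y^j}$ defines a quadratic form on $\mathbb{R}^m$ with $q$ negative and $m-q$ positive eigenvalues, $0<q<m$. The vertical bundle is $VM'=\ker(\pi_\ast:TM'\to TM)$. A non-linear connection is a distribution $HM'$ with $TM'=HM'\oplus VM'$; $h$ and $v$ denote the projections of $TM'$ onto $HM'$ and $VM'$. On $\mathcal{U}'$, $V\mathcal{U}'$ is spanned by $\partial_i=\frac{\partial}{\partial y^i}$ and $H\mathcal{U}'$ by $\delta_i=\frac{\partial}{\partial x^i}-N_i^j(x,y)\frac{\partial}{\partial y^j}$, where the functions $N_i^j$ are determined by $HM'$. The metric $g$ on $VM'$ is the nondegenerate symmetric bilinear form with $g(\partial_i,\partial_j)=g_{ij}$. A skew-symmetric Finsler tensor field of type $(1,2)$ is a $C^\infty(M')$-bilinear skew-symmetric map $\Gamma(VM')\times\Gamma(VM')\to\Gamma(VM')$. The almost hypercomplex structure on $\mathcal{U}'$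 consists of the bundle endomorphisms $J_1,J_2,J_3$ of $T\mathcal{U}'$ given, for $\alpha=1,\dots,n$, by $$J_1\delta_\alpha=\partial_\alpha,\quad J_1\delta_{n+\alpha}=-\partial_{n+\alpha},\quad J_1\partial_\alpha=-\delta_\alpha,\quad J_1\partial_{n+\alpha}=\delta_{n+\alpha},$$ $$J_2\delta_\alpha=\delta_{n+\alpha},\quad J_2\delta_{n+\alpha}=-\delta_\alpha,\quad J_2\partial_\alpha=\partial_{n+\alpha},\quad J_2\partial_{n+\alpha}=-\partial_\alpha,$$ $$J_3\delta_\alpha=-\partial_{n+\alpha},\quad J_3\delta_{n+\alpha}=-\partial_\alpha,\quad J_3\partial_\alpha=\delta_{n+\alpha},\quad J_3\partial_{n+\alpha}=\delta_\alpha.$$ For any linear connection $\nabla^a$ on $V\mathcal{U}'$ (with derivatives along arbitrary vector fields on $\mathcal{U}'$), the operator $D^a_XY=\nabla^a_XvY-J_a\nabla^a_XJ_ahY$ is a linear connection on $T\mathcal{U}'$, and its torsion is $T^{D^a}(X,Y)=D^a_XY-D^a_YX-[X,Y]$. *)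

theory Defs
  imports "HOL-Analysis.Analysis" "HOL-Library.Function_Algebras"
begin

instantiation "fun" :: (type, real_vector) real_vector
begin

definition scaleR_fun :: "real \<Rightarrow> ('a \<Rightarrow> 'b) \<Rightarrow> 'a \<Rightarrow> 'b"
  where "scaleR_fun r f = (\<lambda>x. r *\<^sub>R f x)"

instance
  by standard (auto simp: scaleR_fun_def fun_eq_iff scaleR_add_right scaleR_add_left)

end

text \<open>\<open>C\<^sup>k\<close> functions on an open subset of a finite-dimensional space, by iterated
  directional derivatives.\<close>

primrec Ck_on :: "nat \<Rightarrow> 'e::euclidean_space set \<Rightarrow> ('e \<Rightarrow> 'f::real_normed_vector) \<Rightarrow> bool" where
  "Ck_on 0 = (\<lambda>S f. continuous_on S f)"
| "Ck_on (Suc k) = (\<lambda>S f. (\<forall>x\<in>S. f differentiable (at x)) \<and>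
      (\<forall>v. Ck_on k S (\<lambda>x. frechet_derivative f (at x) v)))"

definition smooth_on :: "'e::euclidean_space set \<Rightarrow> ('e \<Rightarrow> 'f::real_normed_vector) \<Rightarrow> bool"
  where "smooth_on S f \<longleftrightarrow> (\<forall>k. Ck_on k S f)"

text \<open>A chart is a pair of a domain and a coordinate map; the values of the coordinate map
  outside the domain are irrelevant. A manifold is given by its atlas: its set of points is the
  union of the chart domains, and it carries the topology determined by the charts.\<close>

type_synonym ('a, 'e) chart = "'a set \<times> ('a \<Rightarrow> 'e)"

definition chart_inv :: "('a, 'e) chart \<Rightarrow> 'e \<Rightarrow> 'a"
  where "chart_inv c = inv_into (fst c) (snd c)"

definition points :: "('a, 'e) chart set \<Rightarrow> 'a set"
  where "points A = \<Union> (fst ` A)"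

definition manifold_topology :: "('a, 'e::euclidean_space) chart set \<Rightarrow> 'a topology"
  where "manifold_topology A =
    topology (\<lambda>W. W \<subseteq> points A \<and> (\<forall>c\<in>A. open (snd c ` (W \<inter> fst c))))"

definition is_chart :: "('a, 'e::euclidean_space) chart \<Rightarrow> bool"
  where "is_chart c \<longleftrightarrow> inj_on (snd c) (fst c) \<and> open (snd c ` fst c)"

definition smooth_transition ::
    "('a, 'e::euclidean_space) chart \<Rightarrow> ('a, 'e) chart \<Rightarrow> bool"
  where "smooth_transition c d \<longleftrightarrow> open (snd c ` (fst c \<inter> fst d)) \<and>
    smooth_on (snd c ` (fst c \<inter> fst d)) (snd d \<circ> chart_inv c)"

definition smooth_atlas :: "('a, 'e::euclidean_space) chart set \<Rightarrow> bool"
  where "smooth_atlas A \<longleftrightarrow> (\<forall>c\<in>A. is_chart c) \<and> (\<forall>c\<in>A. \<forall>d\<in>A. smooth_transition c d)"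

definition maximal_atlas :: "('a, 'e::euclidean_space) chart set \<Rightarrow> bool"
  where "maximal_atlas A \<longleftrightarrow> smooth_atlas A \<and>
    (\<forall>d. is_chart d \<and> fst d \<subseteq> points A \<and>
      (\<forall>c\<in>A. smooth_transition c d \<and> smooth_transition d c) \<longrightarrow> d \<in> A)"

definition smooth_manifold :: "('a, 'e::euclidean_space) chart set \<Rightarrow> bool"
  where "smooth_manifold A \<longleftrightarrow> maximal_atlas A \<and>
    Hausdorff_space (manifold_topology A) \<and> second_countable (manifold_topology A)"

definition smooth_function ::
    "('a, 'e::euclidean_space) chart set \<Rightarrow> 'a set \<Rightarrow> ('a \<Rightarrow> real) \<Rightarrow> bool"
  where "smooth_function A W f \<longleftrightarrow> (\<forall>c\<in>A. smooth_on (snd c ` (W \<inter> fst c)) (f \<circ> chart_inv c))"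

text \<open>A tangent vector at \<open>p\<close> is the family of its components in all charts around \<open>p\<close>, subject
  to the usual transformation law (and \<open>0\<close> at every other index).\<close>

type_synonym ('a, 'e) tvec = "('a, 'e) chart \<Rightarrow> 'e"

definition transition_deriv ::
    "('a, 'e::euclidean_space) chart \<Rightarrow> ('a, 'e) chart \<Rightarrow> 'a \<Rightarrow> 'e \<Rightarrow> 'e"
  where "transition_deriv c d p = frechet_derivative (snd d \<circ> chart_inv c) (at (snd c p))"

definition tangent_space ::
    "('a, 'e::euclidean_space) chart set \<Rightarrow> 'a \<Rightarrow> ('a, 'e) tvec set"
  where "tangent_space A p = {w.
    (\<forall>c. \<not> (c \<in> A \<and> p \<in> fst c) \<longrightarrow> w c = 0) \<and>
    (\<forall>c\<in>A. \<forall>d\<in>A. p \<in> fst c \<and> p \<in> fst d \<longrightarrow> w d = transition_deriv c d p (w c))}"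

text \<open>The tangent vector at \<open>p\<close> with components \<open>e\<close> in the chart \<open>c\<close>.\<close>

definition coord_vector ::
    "('a, 'e::euclidean_space) chart set \<Rightarrow> ('a, 'e) chart \<Rightarrow> 'e \<Rightarrow> 'a \<Rightarrow> ('a, 'e) tvec"
  where "coord_vector A c e p =
    (\<lambda>d. if d \<in> A \<and> p \<in> fst d then transition_deriv c d p e else 0)"

text \<open>The derivative of a function along a tangent vector \<open>w\<close> at \<open>p\<close>; the choice of the chart
  around \<open>p\<close> is immaterial.\<close>

definition tderiv ::
    "('a, 'e::euclidean_space) chart set \<Rightarrow> 'a \<Rightarrow> ('a, 'e) tvec \<Rightarrow> ('a \<Rightarrow> 'f::real_normed_vector) \<Rightarrow> 'f"
  where "tderiv A p w f = (let c = (SOME c. c \<in> A \<and> p \<in> fst c) in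
    frechet_derivative (f \<circ> chart_inv c) (at (snd c p)) (w c))"

definition differential ::
    "('a, 'e::euclidean_space) chart set \<Rightarrow> ('b, 'f::euclidean_space) chart set \<Rightarrow> ('a \<Rightarrow> 'b) \<Rightarrow>
      'a \<Rightarrow> ('a, 'e) tvec \<Rightarrow> ('b, 'f) tvec"
  where "differential A B f p w =
    (\<lambda>c. if c \<in> B \<and> f p \<in> fst c then tderiv A p w (snd c \<circ> f) else 0)"

text \<open>A bundle is a family \<open>V\<close> of subspaces of the tangent spaces. Its smooth sections over \<open>W\<close>
  are taken to be \<^const>\<open>undefined\<close> outside \<open>W\<close>, so that equality of sections is equality on \<open>W\<close>.\<close>

definition sections ::
    "('a, 'e::euclidean_space) chart set \<Rightarrow> 'a set \<Rightarrow> ('a \<Rightarrow> ('a, 'e) tvec set) \<Rightarrow>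
      ('a \<Rightarrow> ('a, 'e) tvec) set"
  where "sections A W V = {X \<in> extensional W. (\<forall>p\<in>W. X p \<in> V p) \<and>
    (\<forall>c\<in>A. smooth_on (snd c ` (W \<inter> fst c)) (\<lambda>x. X (chart_inv c x) c))}"

abbreviation vector_fields ::
    "('a, 'e::euclidean_space) chart set \<Rightarrow> 'a set \<Rightarrow> ('a \<Rightarrow> ('a, 'e) tvec) set"
  where "vector_fields A W \<equiv> sections A W (tangent_space A)"

definition sec_add :: "'a set \<Rightarrow> ('a \<Rightarrow> ('a, 'e::euclidean_space) tvec) \<Rightarrow> ('a \<Rightarrow> ('a, 'e) tvec) \<Rightarrow>
    'a \<Rightarrow> ('a, 'e) tvec"
  where "sec_add W X Y = (\<lambda>p\<in>W. X p + Y p)"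

definition sec_scale :: "'a set \<Rightarrow> ('a \<Rightarrow> real) \<Rightarrow> ('a \<Rightarrow> ('a, 'e::euclidean_space) tvec) \<Rightarrow>
    'a \<Rightarrow> ('a, 'e) tvec"
  where "sec_scale W f X = (\<lambda>p\<in>W. f p *\<^sub>R X p)"

text \<open>The value at \<open>p\<close> of the Lie bracket, with components \<open>X(Y\<^sup>k) - Y(X\<^sup>k)\<close>.\<close>

definition lie_bracket ::
    "('a, 'e::euclidean_space) chart set \<Rightarrow> ('a \<Rightarrow> ('a, 'e) tvec) \<Rightarrow> ('a \<Rightarrow> ('a, 'e) tvec) \<Rightarrow>
      'a \<Rightarrow> ('a, 'e) tvec"
  where "lie_bracket A X Y p = (\<lambda>c. if c \<in> A \<and> p \<in> fst c
    then tderiv A p (X p) (\<lambda>q. Y q c) - tderiv A p (Y p) (\<lambda>q. X q c) else 0)"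

definition linear_connection ::
    "('a, 'e::euclidean_space) chart set \<Rightarrow> 'a set \<Rightarrow> ('a \<Rightarrow> ('a, 'e) tvec set) \<Rightarrow>
      (('a \<Rightarrow> ('a, 'e) tvec) \<Rightarrow> ('a \<Rightarrow> ('a, 'e) tvec) \<Rightarrow> 'a \<Rightarrow> ('a, 'e) tvec) \<Rightarrow> bool"
  where "linear_connection A W V nabla \<longleftrightarrow>
    nabla \<in> vector_fields A W \<rightarrow>\<^sub>E sections A W V \<rightarrow>\<^sub>E sections A W V \<and>
    (\<forall>X\<in>vector_fields A W. \<forall>X'\<in>vector_fields A W. \<forall>Y\<in>sections A W V.
      nabla (sec_add W X X') Y = sec_add W (nabla X Y) (nabla X' Y)) \<and>
    (\<forall>f. \<forall>X\<in>vector_fields A W. \<forall>Y\<in>sections A W V. smooth_function A W f \<longrightarrow>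
      nabla (sec_scale W f X) Y = sec_scale W f (nabla X Y)) \<and>
    (\<forall>X\<in>vector_fields A W. \<forall>Y\<in>sections A W V. \<forall>Y'\<in>sections A W V.
      nabla X (sec_add W Y Y') = sec_add W (nabla X Y) (nabla X Y')) \<and>
    (\<forall>f. \<forall>X\<in>vector_fields A W. \<forall>Y\<in>sections A W V. smooth_function A W f \<longrightarrow>
      nabla X (sec_scale W f Y) =
        sec_add W (sec_scale W f (nabla X Y)) (sec_scale W (\<lambda>p. tderiv A p (X p) f) Y))"

definition torsion ::
    "('a, 'e::euclidean_space) chart set \<Rightarrow>
      (('a \<Rightarrow> ('a, 'e) tvec) \<Rightarrow> ('a \<Rightarrow> ('a, 'e) tvec) \<Rightarrow> 'a \<Rightarrow> ('a, 'e) tvec) \<Rightarrow>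
      ('a \<Rightarrow> ('a, 'e) tvec) \<Rightarrow> ('a \<Rightarrow> ('a, 'e) tvec) \<Rightarrow> 'a \<Rightarrow> ('a, 'e) tvec"
  where "torsion A D X Y p = D X Y p - D Y X p - lie_bracket A X Y p"

text \<open>A smooth distribution on \<open>W\<close>: locally, a finite set of vector fields is a frame of it.\<close>

definition distribution ::
    "('a, 'e::euclidean_space) chart set \<Rightarrow> 'a set \<Rightarrow> ('a \<Rightarrow> ('a, 'e) tvec set) \<Rightarrow> bool"
  where "distribution A W H \<longleftrightarrow> (\<forall>p\<in>W. \<exists>W' B. p \<in> W' \<and> W' \<subseteq> W \<and>
    openin (manifold_topology A) W' \<and> finite B \<and> B \<subseteq> vector_fields A W' \<and>
    (\<forall>q\<in>W'. inj_on (\<lambda>X. X q) B \<and> independent ((\<lambda>X. X q) ` B) \<and> H q = span ((\<lambda>X. X q) ` B)))"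

type_synonym ('a, 'e) tpoint = "'a \<times> ('a, 'e) tvec"

type_synonym ('a, 'e) ttvec = "(('a, 'e) tpoint, 'e \<times> 'e) tvec"

definition tangent_chart ::
    "('a, 'e::euclidean_space) chart set \<Rightarrow> ('a, 'e) chart \<Rightarrow> (('a, 'e) tpoint, 'e \<times> 'e) chart"
  where "tangent_chart A c =
    ({(p, y). p \<in> fst c \<and> y \<in> tangent_space A p}, \<lambda>(p, y). (snd c p, y c))"

definition tangent_atlas ::
    "('a, 'e::euclidean_space) chart set \<Rightarrow> (('a, 'e) tpoint, 'e \<times> 'e) chart set"
  where "tangent_atlas A = tangent_chart A ` A"

text \<open>For an open submanifold \<open>M'\<close> of \<open>TM\<close>, the tangent space of \<open>M'\<close> at \<open>p\<close> is identified with
  that of \<open>TM\<close> at \<open>p\<close>.\<close>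

definition vertical ::
    "('a, 'e::euclidean_space) chart set \<Rightarrow> ('a, 'e) tpoint \<Rightarrow> ('a, 'e) ttvec set"
  where "vertical A p =
    {w \<in> tangent_space (tangent_atlas A) p. differential (tangent_atlas A) A fst p w = 0}"

text \<open>The coordinate fields \<open>\<partial>/\<partial>x\<^sup>i\<close> and \<open>\<partial>/\<partial>y\<^sup>i\<close> of the coordinates on \<open>TM\<close> induced by \<open>c\<close>.\<close>

definition dx ::
    "('a, real^'m) chart set \<Rightarrow> ('a, real^'m) chart \<Rightarrow> 'm \<Rightarrow>
      ('a, real^'m::finite) tpoint \<Rightarrow> ('a, real^'m) ttvec"
  where "dx A c i = coord_vector (tangent_atlas A) (tangent_chart A c) (axis i 1, 0)"

definition dy ::
    "('a, real^'m) chart set \<Rightarrow> ('a, real^'m) chart \<Rightarrow> 'm \<Rightarrow>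
      ('a, real^'m::finite) tpoint \<Rightarrow> ('a, real^'m) ttvec"
  where "dy A c i = coord_vector (tangent_atlas A) (tangent_chart A c) (0, axis i 1)"

text \<open>The matrix \<open>g\<^sub>i\<^sub>j = 1/2 \<partial>\<^sup>2F/\<partial>y\<^sup>i\<partial>y\<^sup>j\<close> at \<open>p\<close> in the coordinates induced by \<open>c\<close>.\<close>

definition finsler_matrix ::
    "('a, real^'m) chart set \<Rightarrow> (('a, real^'m) tpoint \<Rightarrow> real) \<Rightarrow> ('a, real^'m) chart \<Rightarrow>
      ('a, real^'m::finite) tpoint \<Rightarrow> real^'m^'m"
  where "finsler_matrix A F c p = (let C = tangent_chart A c in
    \<chi> i j. 1/2 * frechet_derivative
      (\<lambda>z. frechet_derivative (F \<circ> chart_inv C) (at z) (0, axis j 1)) (at (snd C p)) (0, axis i 1))"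

text \<open>The number of eigenvalues of a symmetric real matrix that lie in \<open>L\<close>, with multiplicity
  (for which geometric and algebraic multiplicities agree).\<close>

definition eigenvalue_count :: "real^'m^'m::finite \<Rightarrow> real set \<Rightarrow> nat"
  where "eigenvalue_count G L =
    (\<Sum>l\<in>{l\<in>L. \<exists>v. v \<noteq> 0 \<and> G *v v = l *\<^sub>R v}. dim {v. G *v v = l *\<^sub>R v})"

definition pseudo_finsler ::
    "('a, real^'m) chart set \<Rightarrow> ('a, real^'m::finite) tpoint set \<Rightarrow>
      (('a, real^'m) tpoint \<Rightarrow> real) \<Rightarrow> nat \<Rightarrow> bool"
  where "pseudo_finsler A M' F q \<longleftrightarrow>
    smooth_manifold A \<and>
    openin (manifold_topology (tangent_atlas A)) M' \<and> M' \<noteq> {} \<and> fst ` M' = points A \<and>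
    (\<forall>x. (x, 0) \<notin> M') \<and>
    smooth_function (tangent_atlas A) M' F \<and>
    (\<forall>x y k. k > 0 \<and> (x, y) \<in> M' \<and> (x, k *\<^sub>R y) \<in> M' \<longrightarrow> F (x, k *\<^sub>R y) = k\<^sup>2 * F (x, y)) \<and>
    0 < q \<and> q < CARD('m) \<and>
    (\<forall>c\<in>A. \<forall>p\<in>M'. fst p \<in> fst c \<longrightarrow>
      eigenvalue_count (finsler_matrix A F c p) {..<0} = q \<and>
      eigenvalue_count (finsler_matrix A F c p) {0<..} = CARD('m) - q)"

definition finsler_metric ::
    "('a, real^'m) chart set \<Rightarrow> ('a, real^'m::finite) tpoint set \<Rightarrow>
      (('a, real^'m) tpoint \<Rightarrow> real) \<Rightarrow>
      (('a, real^'m) tpoint \<Rightarrow> ('a, real^'m) ttvec \<Rightarrow>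
        ('a, real^'m) ttvec \<Rightarrow> real) \<Rightarrow> bool"
  where "finsler_metric A M' F g \<longleftrightarrow> (\<forall>p\<in>M'.
    (\<forall>u\<in>vertical A p. \<forall>u'\<in>vertical A p. \<forall>w\<in>vertical A p. \<forall>a b.
      g p (a *\<^sub>R u + b *\<^sub>R u') w = a * g p u w + b * g p u' w \<and>
      g p w (a *\<^sub>R u + b *\<^sub>R u') = a * g p w u + b * g p w u') \<and>
    (\<forall>c\<in>A. fst p \<in> fst c \<longrightarrow>
      (\<forall>i j. g p (dy A c i p) (dy A c j p) = finsler_matrix A F c p $ i $ j)))"

definition skew_finsler_tensor ::
    "('a, 'e::euclidean_space) chart set \<Rightarrow> ('a, 'e) tpoint set \<Rightarrow>
      ((('a, 'e) tpoint \<Rightarrow> ('a, 'e) ttvec) \<Rightarrow>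
       (('a, 'e) tpoint \<Rightarrow> ('a, 'e) ttvec) \<Rightarrow>
       ('a, 'e) tpoint \<Rightarrow> ('a, 'e) ttvec) \<Rightarrow> bool"
  where "skew_finsler_tensor A M' S \<longleftrightarrow>
    (let \<Gamma> = sections (tangent_atlas A) M' (vertical A) in
      S \<in> \<Gamma> \<rightarrow> \<Gamma> \<rightarrow> \<Gamma> \<and>
      (\<forall>X\<in>\<Gamma>. \<forall>X'\<in>\<Gamma>. \<forall>Y\<in>\<Gamma>.
        S (sec_add M' X X') Y = sec_add M' (S X Y) (S X' Y) \<and>
        S Y (sec_add M' X X') = sec_add M' (S Y X) (S Y X')) \<and>
      (\<forall>f. \<forall>X\<in>\<Gamma>. \<forall>Y\<in>\<Gamma>. smooth_function (tangent_atlas A) M' f \<longrightarrow>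
        S (sec_scale M' f X) Y = sec_scale M' f (S X Y) \<and>
        S X (sec_scale M' f Y) = sec_scale M' f (S X Y)) \<and>
      (\<forall>X\<in>\<Gamma>. \<forall>Y\<in>\<Gamma>. S X Y = sec_scale M' (\<lambda>p. -1) (S Y X)))"

text \<open>Being \<open>C\<^sup>\<infinity>(M')\<close>-bilinear, a tensor field on global sections has a value at each point, through
  which it acts on sections over smaller open sets.\<close>

definition tensor_at ::
    "('a, 'e::euclidean_space) chart set \<Rightarrow> ('a, 'e) tpoint set \<Rightarrow>
      ((('a, 'e) tpoint \<Rightarrow> ('a, 'e) ttvec) \<Rightarrow>
       (('a, 'e) tpoint \<Rightarrow> ('a, 'e) ttvec) \<Rightarrow>
       ('a, 'e) tpoint \<Rightarrow> ('a, 'e) ttvec) \<Rightarrow>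
      ('a, 'e) tpoint \<Rightarrow> ('a, 'e) ttvec \<Rightarrow> ('a, 'e) ttvec \<Rightarrow>
      ('a, 'e) ttvec"
  where "tensor_at A M' S p u w = (THE z.
    \<forall>X\<in>sections (tangent_atlas A) M' (vertical A). \<forall>Y\<in>sections (tangent_atlas A) M' (vertical A).
      X p = u \<and> Y p = w \<longrightarrow> S X Y p = z)"

definition nonlinear_connection ::
    "('a, 'e::euclidean_space) chart set \<Rightarrow> ('a, 'e) tpoint set \<Rightarrow>
      (('a, 'e) tpoint \<Rightarrow> ('a, 'e) ttvec set) \<Rightarrow> bool"
  where "nonlinear_connection A M' H \<longleftrightarrow> distribution (tangent_atlas A) M' H \<and>
    (\<forall>p\<in>M'. H p \<inter> vertical A p = {0} \<and>
      {u + w | u w. u \<in> H p \<and> w \<in> vertical A p} = tangent_space (tangent_atlas A) p)"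

definition hproj ::
    "('a, 'e::euclidean_space) chart set \<Rightarrow>
      (('a, 'e) tpoint \<Rightarrow> ('a, 'e) ttvec set) \<Rightarrow>
      ('a, 'e) tpoint \<Rightarrow> ('a, 'e) ttvec \<Rightarrow> ('a, 'e) ttvec"
  where "hproj A H p w = (THE u. u \<in> H p \<and> w - u \<in> vertical A p)"

definition vproj ::
    "('a, 'e::euclidean_space) chart set \<Rightarrow>
      (('a, 'e) tpoint \<Rightarrow> ('a, 'e) ttvec set) \<Rightarrow>
      ('a, 'e) tpoint \<Rightarrow> ('a, 'e) ttvec \<Rightarrow> ('a, 'e) ttvec"
  where "vproj A H p w = (THE u. u \<in> vertical A p \<and> w - u \<in> H p)"

text \<open>\<open>nlc_coeff A H c p i j\<close> is \<open>N\<^sub>i\<^sup>j\<close> at \<open>p\<close>.\<close>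

definition nlc_coeff ::
    "('a, real^'m) chart set \<Rightarrow>
      (('a, real^'m::finite) tpoint \<Rightarrow> ('a, real^'m) ttvec set) \<Rightarrow>
      ('a, real^'m) chart \<Rightarrow> ('a, real^'m) tpoint \<Rightarrow> 'm \<Rightarrow> 'm \<Rightarrow> real"
  where "nlc_coeff A H c p =
    (THE N. \<forall>i. dx A c i p - (\<Sum>j\<in>UNIV. N i j *\<^sub>R dy A c j p) \<in> H p)"

definition delta ::
    "('a, real^'m) chart set \<Rightarrow>
      (('a, real^'m::finite) tpoint \<Rightarrow> ('a, real^'m) ttvec set) \<Rightarrow>
      ('a, real^'m) chart \<Rightarrow> 'm \<Rightarrow>
      ('a, real^'m) tpoint \<Rightarrow> ('a, real^'m) ttvec"
  where "delta A H c i p = dx A c i p - (\<Sum>j\<in>UNIV. nlc_coeff A H c p i j *\<^sub>R dy A c j p)"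

text \<open>In dimension \<open>2n\<close> coordinates are indexed by a sum type \<open>'n + 'n\<close>: the index \<open>\<alpha>\<close> is \<open>Inl \<alpha>\<close>,
  and \<open>n + \<alpha>\<close> is \<open>Inr \<alpha>\<close>. Smoothness of the \<open>J k\<close> is implied by their values on the frame.\<close>

definition almost_hypercomplex ::
    "('a, real^('n + 'n)) chart set \<Rightarrow>
      (('a, real^('n::finite + 'n)) tpoint \<Rightarrow>
        ('a, real^('n + 'n)) ttvec set) \<Rightarrow>
      ('a, real^('n + 'n)) chart \<Rightarrow> ('a, real^('n + 'n)) tpoint set \<Rightarrow>
      (nat \<Rightarrow> ('a, real^('n + 'n)) tpoint \<Rightarrow>
        ('a, real^('n + 'n)) ttvec \<Rightarrow>
        ('a, real^('n + 'n)) ttvec) \<Rightarrow> bool"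
  where "almost_hypercomplex A H c W J \<longleftrightarrow> (\<forall>p\<in>W.
    (\<forall>k\<in>{1, 2, 3}.
      (\<forall>u\<in>tangent_space (tangent_atlas A) p. J k p u \<in> tangent_space (tangent_atlas A) p) \<and>
      (\<forall>u\<in>tangent_space (tangent_atlas A) p. \<forall>w\<in>tangent_space (tangent_atlas A) p. \<forall>a b.
        J k p (a *\<^sub>R u + b *\<^sub>R w) = a *\<^sub>R J k p u + b *\<^sub>R J k p w)) \<and>
    (\<forall>\<alpha>.
      J 1 p (delta A H c (Inl \<alpha>) p) = dy A c (Inl \<alpha>) p \<and>
      J 1 p (delta A H c (Inr \<alpha>) p) = - dy A c (Inr \<alpha>) p \<and>
      J 1 p (dy A c (Inl \<alpha>) p) = - delta A H c (Inl \<alpha>) p \<and>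
      J 1 p (dy A c (Inr \<alpha>) p) = delta A H c (Inr \<alpha>) p \<and>
      J 2 p (delta A H c (Inl \<alpha>) p) = delta A H c (Inr \<alpha>) p \<and>
      J 2 p (delta A H c (Inr \<alpha>) p) = - delta A H c (Inl \<alpha>) p \<and>
      J 2 p (dy A c (Inl \<alpha>) p) = dy A c (Inr \<alpha>) p \<and>
      J 2 p (dy A c (Inr \<alpha>) p) = - dy A c (Inl \<alpha>) p \<and>
      J 3 p (delta A H c (Inl \<alpha>) p) = - dy A c (Inr \<alpha>) p \<and>
      J 3 p (delta A H c (Inr \<alpha>) p) = - dy A c (Inl \<alpha>) p \<and>
      J 3 p (dy A c (Inl \<alpha>) p) = delta A H c (Inr \<alpha>) p \<and>
      J 3 p (dy A c (Inr \<alpha>) p) = delta A H c (Inl \<alpha>) p))"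

definition sec_map ::
    "'b set \<Rightarrow> ('b \<Rightarrow> ('b, 'e) tvec \<Rightarrow> ('b, 'e) tvec) \<Rightarrow> ('b \<Rightarrow> ('b, 'e) tvec) \<Rightarrow> 'b \<Rightarrow> ('b, 'e) tvec"
  where "sec_map W L X = (\<lambda>p\<in>W. L p (X p))"

text \<open>\<open>D\<^sub>X Y = \<nabla>\<^sub>X vY - J \<nabla>\<^sub>X J h Y\<close>, where \<open>J\<close> is one bundle endomorphism over \<open>W\<close>.\<close>

definition induced_connection ::
    "('a, 'e::euclidean_space) chart set \<Rightarrow>
      (('a, 'e) tpoint \<Rightarrow> ('a, 'e) ttvec set) \<Rightarrow> ('a, 'e) tpoint set \<Rightarrow>
      (('a, 'e) tpoint \<Rightarrow> ('a, 'e) ttvec \<Rightarrow> ('a, 'e) ttvec) \<Rightarrow>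
      ((('a, 'e) tpoint \<Rightarrow> ('a, 'e) ttvec) \<Rightarrow>
       (('a, 'e) tpoint \<Rightarrow> ('a, 'e) ttvec) \<Rightarrow>
       ('a, 'e) tpoint \<Rightarrow> ('a, 'e) ttvec) \<Rightarrow>
      (('a, 'e) tpoint \<Rightarrow> ('a, 'e) ttvec) \<Rightarrow>
      (('a, 'e) tpoint \<Rightarrow> ('a, 'e) ttvec) \<Rightarrow>
      ('a, 'e) tpoint \<Rightarrow> ('a, 'e) ttvec"
  where "induced_connection A H W J nabla X Y =
    (\<lambda>p\<in>W. nabla X (sec_map W (vproj A H) Y) p -
      J p (nabla X (sec_map W J (sec_map W (hproj A H) Y)) p))"

end

(* In the chart induced by c, the nonlinear connection is given by a smooth matrix N, and J interchanges
   (xi, -N xi) and (0, u) through a constant involution K. A linear connection on the vertical bundle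
   is the flat one of the chart plus a Christoffel term that is linear in the direction; split the direction
   into its vertical part and its horizontal part, the latter parametrised by a vertical vector through J.
   For each part, the torsion condition says that the skew part of the Christoffel term is S (resp. T),
   and compatibility with g prescribes its part symmetric with respect to g. So, twice, the Koszul formula gives
   existence, and the difference of two solutions is a form that is symmetric in the first two and
   skew in the last two arguments, hence zero. S and T act on sections over the chart through their values
   at points, which are smooth because local sections extend to M' after multiplication by a bump function
   (this uses that M is Hausdorff). *)

theory Submission
  imports Defs
begin

section \<open>Smooth functions\<close>

text \<open>The index is 1 or 3 because \<open>J 1\<close> and \<open>J 3\<close> exchange the
  horizontal and the vertical bundle, whereas \<open>J 2\<close> preserves both: \<open>J a\<close>
  turns hY into a vertical section, to which the connection applies, and turns the result back into
  a horizontal field. That K is constant in the chart makes (ii) algebraic: the derivatives of the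
  components of \<open>J a\<close> hY become, after the outer \<open>J a\<close>, those of the base
  components of hY and cancel against the base components of [hX, hY]. The projection h in (ii)
  discards the vertical part of that bracket, which carries the curvature of the distribution. The
  torsion of D on a mixed pair is left free, yet nothing stays undetermined: metric compatibility
  with (i) fixes the Christoffel term for vertical directions, and with (ii) for horizontal ones.
  Nondegeneracy of g comes from the eigenvalue counts: q negative and m - q positive eigenvalues
  leave no room for the eigenvalue 0. As a connection is a map on sections, comparing two of them
  needs enough sections: every vertical section is J of a horizontal field.\<close>

lemma Ck_on_cong:
  assumes "open S" "\<And>x. x \<in> S \<Longrightarrow> f x = g x" "Ck_on k S f"
  shows "Ck_on k S g"
  using assms(2,3)
proof (induction k arbitrary: f g)
  case 0
  then show ?case using continuous_on_cong[OF refl, of S f g] by simp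
next
  case (Suc k)
  have d: "(g has_derivative frechet_derivative f (at x)) (at x)" if "x \<in> S" for x
  proof -
    have "(f has_derivative frechet_derivative f (at x)) (at x)"
      using Suc.prems(2) that by (simp add: frechet_derivative_works)
    then show ?thesis
      by (rule has_derivative_transform_within_open[OF _ assms(1) that]) (use Suc.prems in auto)
  qed
  then have e: "frechet_derivative f (at x) = frechet_derivative g (at x)" if "x \<in> S" for x
    using frechet_derivative_at that by blast
  have "Ck_on k S (\<lambda>x. frechet_derivative g (at x) v)" for v
    by (rule Suc.IH[of "\<lambda>x. frechet_derivative f (at x) v"]) (use Suc.prems e in auto)
  then show ?case using d by (auto simp: differentiable_def)
qed

lemma Ck_on_subset: "Ck_on k S f \<Longrightarrow> T \<subseteq> S \<Longrightarrow> Ck_on k T f"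
  by (induction k arbitrary: f) (auto intro: continuous_on_subset)

lemma Ck_on_SucD:
  "Ck_on (Suc k) S f \<Longrightarrow> x \<in> S \<Longrightarrow> (f has_derivative frechet_derivative f (at x)) (at x)"
  by (simp add: frechet_derivative_works)

lemma Ck_on_Suc_imp: "Ck_on (Suc k) S f \<Longrightarrow> Ck_on k S f"
proof (induction k arbitrary: f)
  case 0
  then show ?case
    by (auto intro!: continuous_at_imp_continuous_on differentiable_imp_continuous_within)
qed simp

text \<open>The working form of the recursion step: by uniqueness, any explicit derivative may stand
  in for \<open>frechet_derivative\<close>. Openness of S lets the equality of the two on S pass to
  their own derivatives.\<close>

lemma Ck_on_SucI:
  assumes "open S" "\<And>x. x \<in> S \<Longrightarrow> (f has_derivative f' x) (at x)"
    and "\<And>v. Ck_on k S (\<lambda>x. f' x v)"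
  shows "Ck_on (Suc k) S f"
proof -
  have e: "f' x = frechet_derivative f (at x)" if "x \<in> S" for x
    using frechet_derivative_at assms(2) that by blast
  have "Ck_on k S (\<lambda>x. frechet_derivative f (at x) v)" for v
    by (rule Ck_on_cong[OF assms(1) _ assms(3)[of v]]) (simp add: e)
  then show ?thesis using assms(2) by (auto simp: differentiable_def)
qed

lemma Ck_on_local:
  assumes "\<And>x. x \<in> S \<Longrightarrow> \<exists>O'. open O' \<and> x \<in> O' \<and> Ck_on k O' f"
  shows "Ck_on k S f"
  using assms
proof (induction k arbitrary: f)
  case 0
  have "isCont f x" if "x \<in> S" for x
    using 0[OF that] by (auto simp: continuous_on_eq_continuous_at)
  then show ?case by (simp add: continuous_at_imp_continuous_on)
next
  case (Suc k)
  have "Ck_on k S (\<lambda>x. frechet_derivative f (at x) v)" for v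
    by (rule Suc.IH) (use Suc.prems in fastforce)
  moreover have "f differentiable at x" if "x \<in> S" for x using Suc.prems[OF that] by auto
  ultimately show ?case by simp
qed

lemma Ck_on_const: "open S \<Longrightarrow> Ck_on k S (\<lambda>x. c)"
proof (induction k arbitrary: c)
  case (Suc k)
  show ?case by (rule Ck_on_SucI[where f'="\<lambda>x v. 0"]) (use Suc in auto)
qed simp

lemma Ck_on_bounded_linear:
  assumes "open S" "bounded_linear h" "Ck_on k S f"
  shows "Ck_on k S (\<lambda>x. h (f x))"
  using assms(3)
proof (induction k arbitrary: f)
  case 0
  then show ?case using assms(2) by (simp add: bounded_linear.continuous_on)
next
  case (Suc k)
  show ?case
  proof (rule Ck_on_SucI[OF assms(1)])
    show "((\<lambda>x. h (f x)) has_derivative (\<lambda>v. h (frechet_derivative f (at x) v))) (at x)"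
      if "x \<in> S" for x
      using bounded_linear.has_derivative[OF assms(2) Ck_on_SucD[OF Suc.prems that]] .
    show "Ck_on k S (\<lambda>x. h (frechet_derivative f (at x) v))" for v
      by (rule Suc.IH) (use Suc.prems in simp)
  qed
qed

lemma Ck_on_add:
  assumes "open S" "Ck_on k S f" "Ck_on k S g"
  shows "Ck_on k S (\<lambda>x. f x + g x)"
  using assms(2,3)
proof (induction k arbitrary: f g)
  case 0
  then show ?case by (simp add: continuous_on_add)
next
  case (Suc k)
  show ?case
  proof (rule Ck_on_SucI[OF assms(1)])
    show "((\<lambda>x. f x + g x) has_derivative
        (\<lambda>v. frechet_derivative f (at x) v + frechet_derivative g (at x) v)) (at x)"
      if "x \<in> S" for x
      using has_derivative_add[OF Ck_on_SucD[OF Suc.prems(1) that] Ck_on_SucD[OF Suc.prems(2) that]] .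
    show "Ck_on k S (\<lambda>x. frechet_derivative f (at x) v + frechet_derivative g (at x) v)" for v
      by (rule Suc.IH) (use Suc.prems in simp_all)
  qed
qed

lemma Ck_on_bounded_bilinear:
  assumes "open S" "bounded_bilinear h" "Ck_on k S f" "Ck_on k S g"
  shows "Ck_on k S (\<lambda>x. h (f x) (g x))"
  using assms(3,4)
proof (induction k arbitrary: f g)
  case 0
  then show ?case using assms(2) by (simp add: bounded_bilinear.continuous_on)
next
  case (Suc k)
  show ?case
  proof (rule Ck_on_SucI[OF assms(1)])
    show "((\<lambda>x. h (f x) (g x)) has_derivative
        (\<lambda>v. h (f x) (frechet_derivative g (at x) v) + h (frechet_derivative f (at x) v) (g x))) (at x)"
      if "x \<in> S" for x
      using bounded_bilinear.FDERIV[OF assms(2) Ck_on_SucD[OF Suc.prems(1) that]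
          Ck_on_SucD[OF Suc.prems(2) that]] .
    show "Ck_on k S (\<lambda>x. h (f x) (frechet_derivative g (at x) v) +
        h (frechet_derivative f (at x) v) (g x))" for v
      by (intro Ck_on_add[OF assms(1)] Suc.IH Suc.prems[THEN Ck_on_Suc_imp]) (use Suc.prems in simp_all)
  qed
qed

lemma Ck_on_sum:
  assumes "open S" "\<And>i. i \<in> I \<Longrightarrow> Ck_on k S (f i)"
  shows "Ck_on k S (\<lambda>x. \<Sum>i\<in>I. f i x)"
  using assms(2)
  by (induction I rule: infinite_finite_induct) (auto intro: Ck_on_const Ck_on_add assms(1))

text \<open>\<open>Ck_on\<close> speaks only of derivatives in fixed directions. Expanding a moving
  direction over \<open>Basis\<close> turns the derivative along it into a finite sum of
  products.\<close>

lemma linear_expand_Basis: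
  fixes L :: "'e::euclidean_space \<Rightarrow> 'f::real_vector"
  assumes "linear L"
  shows "(\<Sum>b\<in>Basis. (w \<bullet> b) *\<^sub>R L b) = L w"
proof -
  have "(\<Sum>b\<in>Basis. (w \<bullet> b) *\<^sub>R L b) = L (\<Sum>b\<in>Basis. (w \<bullet> b) *\<^sub>R b)"
    by (simp add: linear_sum[OF assms] linear_scale[OF assms])
  then show ?thesis by (simp add: euclidean_representation)
qed

lemma Ck_on_compose:
  fixes f :: "'a::euclidean_space \<Rightarrow> 'b::euclidean_space"
  assumes "open S" "open T" "f ` S \<subseteq> T" "Ck_on k S f" "Ck_on k T g"
  shows "Ck_on k S (\<lambda>x. g (f x))"
  using assms(4,5)
proof (induction k arbitrary: g)
  case 0
  then show ?case using assms(3) by (auto intro: continuous_on_compose2)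
next
  case (Suc k)
  have "linear (frechet_derivative g (at (f x)))" if "x \<in> S" for x
    using Suc.prems(2) that assms(3) by (intro linear_frechet_derivative) auto
  then have e: "(\<Sum>b\<in>Basis. (frechet_derivative f (at x) v \<bullet> b) *\<^sub>R frechet_derivative g (at (f x)) b) =
      frechet_derivative g (at (f x)) (frechet_derivative f (at x) v)" if "x \<in> S" for x v
    using that by (intro linear_expand_Basis) simp
  show ?case
  proof (rule Ck_on_SucI[OF assms(1)])
    show "((\<lambda>x. g (f x)) has_derivative
        (\<lambda>v. frechet_derivative g (at (f x)) (frechet_derivative f (at x) v))) (at x)"
      if "x \<in> S" for x
    proof -
      have "(g has_derivative frechet_derivative g (at (f x))) (at (f x))"
        using Suc.prems(2) assms(3) that by (intro Ck_on_SucD) auto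
      from has_derivative_compose[OF Ck_on_SucD[OF Suc.prems(1) that] this]
      show ?thesis .
    qed
    \<comment> \<open>The induction hypothesis applies to the directional derivatives of
      \<open>g\<close>, hence \<open>arbitrary: g\<close>; \<open>f\<close> itself only loses one
      order.\<close>
    have "Ck_on k S (\<lambda>x. (\<Sum>b\<in>Basis. (frechet_derivative f (at x) v \<bullet> b) *\<^sub>R
        frechet_derivative g (at (f x)) b))" for v
    proof (intro Ck_on_sum[OF assms(1)]
        Ck_on_bounded_bilinear[OF assms(1) bounded_bilinear_scaleR])
      show "Ck_on k S (\<lambda>x. frechet_derivative f (at x) v \<bullet> b)" for b
        by (rule Ck_on_bounded_linear[OF assms(1) bounded_linear_inner_left]) (use Suc.prems in simp)
      show "Ck_on k S (\<lambda>x. frechet_derivative g (at (f x)) b)" for b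
        by (rule Suc.IH) (use Suc.prems Ck_on_Suc_imp in auto)
    qed
    then show "Ck_on k S (\<lambda>x. frechet_derivative g (at (f x)) (frechet_derivative f (at x) v))" for v
      by (rule Ck_on_cong[OF assms(1), rotated]) (rule e)
  qed
qed

text \<open>The derivative of 1/f is a product of the derivative of f with 1/f, twice, so the
  induction closes on the same f.\<close>

lemma Ck_on_inverse:
  fixes f :: "'a::euclidean_space \<Rightarrow> real"
  assumes "open S" "\<And>x. x \<in> S \<Longrightarrow> f x \<noteq> 0" "Ck_on k S f"
  shows "Ck_on k S (\<lambda>x. inverse (f x))"
  using assms(3)
proof (induction k)
  case 0
  then show ?case using assms(2) by (auto intro: continuous_on_inverse)
next
  case (Suc k)
  show ?case
  proof (rule Ck_on_SucI[OF assms(1)])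
    show "((\<lambda>x. inverse (f x)) has_derivative
        (\<lambda>v. - (inverse (f x) * frechet_derivative f (at x) v * inverse (f x)))) (at x)"
      if "x \<in> S" for x
      by (rule Deriv.has_derivative_inverse[OF assms(2)[OF that] Ck_on_SucD[OF Suc.prems that]])
    show "Ck_on k S (\<lambda>x. - (inverse (f x) * frechet_derivative f (at x) v * inverse (f x)))" for v
      by (intro Ck_on_bounded_linear[OF assms(1) bounded_linear_minus[OF bounded_linear_ident]]
          Ck_on_bounded_bilinear[OF assms(1) bounded_bilinear_mult] Suc.IH Ck_on_Suc_imp[OF Suc.prems])
        (use Suc.prems in simp)
  qed
qed

section \<open>Closure properties of smooth functions\<close>

named_theorems smooth_intros

lemma smooth_on_cong: "open S \<Longrightarrow> (\<And>x. x \<in> S \<Longrightarrow> f x = g x) \<Longrightarrow> smooth_on S f \<Longrightarrow> smooth_on S g"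
  unfolding smooth_on_def using Ck_on_cong by blast

lemma smooth_on_subset: "smooth_on S f \<Longrightarrow> T \<subseteq> S \<Longrightarrow> smooth_on T f"
  unfolding smooth_on_def using Ck_on_subset by blast

lemma smooth_on_local:
  "(\<And>x. x \<in> S \<Longrightarrow> \<exists>O'. open O' \<and> x \<in> O' \<and> smooth_on O' f) \<Longrightarrow> smooth_on S f"
  unfolding smooth_on_def using Ck_on_local by metis

lemma smooth_on_imp_differentiable: "smooth_on S f \<Longrightarrow> x \<in> S \<Longrightarrow> f differentiable at x"
  unfolding smooth_on_def by (metis Ck_on.simps(2))

lemma smooth_on_has_derivative:
  "smooth_on S f \<Longrightarrow> x \<in> S \<Longrightarrow> (f has_derivative frechet_derivative f (at x)) (at x)"
  using smooth_on_imp_differentiable frechet_derivative_works by blast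

lemma smooth_on_linear_frechet:
  "smooth_on S f \<Longrightarrow> x \<in> S \<Longrightarrow> linear (frechet_derivative f (at x))"
  using smooth_on_imp_differentiable linear_frechet_derivative by blast

lemma smooth_on_frechet: "smooth_on S f \<Longrightarrow> smooth_on S (\<lambda>x. frechet_derivative f (at x) v)"
  unfolding smooth_on_def by (metis Ck_on.simps(2))

lemma smooth_on_imp_continuous_on: "smooth_on S f \<Longrightarrow> continuous_on S f"
  unfolding smooth_on_def by (metis Ck_on.simps(1))

lemma smooth_on_const [smooth_intros]: "open S \<Longrightarrow> smooth_on S (\<lambda>x. c)"
  by (simp add: smooth_on_def Ck_on_const)

lemma smooth_on_bounded_linear:
  "open S \<Longrightarrow> bounded_linear h \<Longrightarrow> smooth_on S f \<Longrightarrow> smooth_on S (\<lambda>x. h (f x))"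
  unfolding smooth_on_def using Ck_on_bounded_linear by blast

lemma smooth_on_bounded_bilinear:
  "open S \<Longrightarrow> bounded_bilinear h \<Longrightarrow> smooth_on S f \<Longrightarrow> smooth_on S g \<Longrightarrow>
    smooth_on S (\<lambda>x. h (f x) (g x))"
  unfolding smooth_on_def using Ck_on_bounded_bilinear by blast

lemma smooth_on_compose:
  fixes f :: "'a::euclidean_space \<Rightarrow> 'b::euclidean_space"
  shows "open S \<Longrightarrow> open T \<Longrightarrow> f ` S \<subseteq> T \<Longrightarrow> smooth_on S f \<Longrightarrow> smooth_on T g \<Longrightarrow>
    smooth_on S (\<lambda>x. g (f x))"
  unfolding smooth_on_def using Ck_on_compose by blast

lemma smooth_on_id [smooth_intros]:
  assumes "open S" shows "smooth_on S (\<lambda>x. x)"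
  unfolding smooth_on_def
proof
  show "Ck_on k S (\<lambda>x. x)" for k
  proof (cases k)
    case (Suc l)
    show ?thesis unfolding Suc
      by (rule Ck_on_SucI[where f'="\<lambda>x v. v"]) (auto intro: assms Ck_on_const)
  qed simp
qed

lemma smooth_on_add [smooth_intros]:
  "open S \<Longrightarrow> smooth_on S f \<Longrightarrow> smooth_on S g \<Longrightarrow> smooth_on S (\<lambda>x. f x + g x)"
  unfolding smooth_on_def using Ck_on_add by blast

lemma smooth_on_minus [smooth_intros]:
  "open S \<Longrightarrow> smooth_on S f \<Longrightarrow> smooth_on S (\<lambda>x. - f x)"
  by (rule smooth_on_bounded_linear[OF _ bounded_linear_minus[OF bounded_linear_ident]])

lemma smooth_on_diff [smooth_intros]:
  "open S \<Longrightarrow> smooth_on S f \<Longrightarrow> smooth_on S g \<Longrightarrow> smooth_on S (\<lambda>x. f x - g x)"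
  using smooth_on_add[of S f "\<lambda>x. - g x"] smooth_on_minus[of S g] by simp

lemma smooth_on_scaleR [smooth_intros]:
  "open S \<Longrightarrow> smooth_on S f \<Longrightarrow> smooth_on S g \<Longrightarrow> smooth_on S (\<lambda>x. f x *\<^sub>R g x)"
  by (rule smooth_on_bounded_bilinear[OF _ bounded_bilinear_scaleR])

lemma smooth_on_mult [smooth_intros]:
  fixes f g :: "_ \<Rightarrow> real"
  shows "open S \<Longrightarrow> smooth_on S f \<Longrightarrow> smooth_on S g \<Longrightarrow> smooth_on S (\<lambda>x. f x * g x)"
  by (rule smooth_on_bounded_bilinear[OF _ bounded_bilinear_mult])

lemma smooth_on_inner [smooth_intros]:
  "open S \<Longrightarrow> smooth_on S f \<Longrightarrow> smooth_on S g \<Longrightarrow> smooth_on S (\<lambda>x. f x \<bullet> g x)"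
  by (rule smooth_on_bounded_bilinear[OF _ bounded_bilinear_inner])

lemma smooth_on_vec_nth [smooth_intros]:
  "open S \<Longrightarrow> smooth_on S f \<Longrightarrow> smooth_on S (\<lambda>x. f x $ i)"
  by (rule smooth_on_bounded_linear[OF _ bounded_linear_vec_nth])

lemma smooth_on_fst [smooth_intros]:
  "open S \<Longrightarrow> smooth_on S f \<Longrightarrow> smooth_on S (\<lambda>x. fst (f x))"
  by (rule smooth_on_bounded_linear[OF _ bounded_linear_fst])

lemma smooth_on_snd [smooth_intros]:
  "open S \<Longrightarrow> smooth_on S f \<Longrightarrow> smooth_on S (\<lambda>x. snd (f x))"
  by (rule smooth_on_bounded_linear[OF _ bounded_linear_snd])

lemma smooth_on_sum [smooth_intros]:
  "open S \<Longrightarrow> (\<And>i. i \<in> I \<Longrightarrow> smooth_on S (f i)) \<Longrightarrow> smooth_on S (\<lambda>x. \<Sum>i\<in>I. f i x)"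
  unfolding smooth_on_def by (intro allI Ck_on_sum) simp_all

lemma smooth_on_Pair [smooth_intros]:
  fixes f :: "'e::euclidean_space \<Rightarrow> 'f::real_normed_vector" and g :: "'e \<Rightarrow> 'g::real_normed_vector"
  assumes "open S" "smooth_on S f" "smooth_on S g"
  shows "smooth_on S (\<lambda>x. (f x, g x))"
proof -
  have "bounded_linear (\<lambda>u::'f. (u, 0::'g))" "bounded_linear (\<lambda>u::'g. (0::'f, u))"
    by (intro bounded_linear_Pair bounded_linear_ident bounded_linear_zero)+
  then have "smooth_on S (\<lambda>x. (f x, 0::'g))" "smooth_on S (\<lambda>x. (0::'f, g x))"
    using smooth_on_bounded_linear[OF assms(1)] assms(2,3) by blast+
  from smooth_on_add[OF assms(1) this] show ?thesis by simp
qed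

lemma smooth_on_prod [smooth_intros]:
  fixes f :: "_ \<Rightarrow> _ \<Rightarrow> real"
  assumes "open S"
  shows "(\<And>i. i \<in> I \<Longrightarrow> smooth_on S (f i)) \<Longrightarrow> smooth_on S (\<lambda>x. \<Prod>i\<in>I. f i x)"
proof (induction I rule: infinite_finite_induct)
  case (insert i I)
  then have "smooth_on S (\<lambda>x. f i x * (\<Prod>i\<in>I. f i x))"
    by (intro smooth_on_mult assms) simp_all
  then show ?case using insert by simp
qed (simp_all add: smooth_on_const assms)

lemma smooth_on_divide [smooth_intros]:
  fixes f g :: "_ \<Rightarrow> real"
  assumes "open S" "smooth_on S f" "smooth_on S g" "\<And>x. x \<in> S \<Longrightarrow> g x \<noteq> 0"
  shows "smooth_on S (\<lambda>x. f x / g x)"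
proof -
  have "smooth_on S (\<lambda>x. inverse (g x))"
    using assms Ck_on_inverse unfolding smooth_on_def by blast
  from smooth_on_mult[OF assms(1,2) this] show ?thesis by (simp add: field_simps)
qed

lemma smooth_on_vec_lambda [smooth_intros]:
  fixes f :: "'e::euclidean_space \<Rightarrow> 'm::finite \<Rightarrow> 'f::real_normed_vector"
  assumes "open S" "\<And>i. smooth_on S (\<lambda>x. f x i)"
  shows "smooth_on S (\<lambda>x. \<chi> i. f x i)"
proof -
  have b: "bounded_linear (\<lambda>u::'f. \<chi> j. if j = i then u else 0)" for i :: 'm
  proof (rule bounded_linear_intro[where K=1])
    fix x y :: 'f and r :: real
    show "(\<chi> j. if j = i then x + y else 0) =
        (\<chi> j. if j = i then x else 0) + (\<chi> j. if j = i then y else (0::'f))"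
      by (simp add: vec_eq_iff)
    show "(\<chi> j. if j = i then r *\<^sub>R x else 0) = r *\<^sub>R (\<chi> j. if j = i then x else (0::'f))"
      by (simp add: vec_eq_iff)
    show "norm (\<chi> j. if j = i then x else (0::'f)) \<le> norm x * 1"
      by (simp add: norm_vec_def L2_set_def if_distrib[of norm] if_distrib[of "\<lambda>x. x\<^sup>2"] cong: if_cong)
  qed
  have "smooth_on S (\<lambda>x. \<Sum>i\<in>UNIV. \<chi> j. if j = i then f x i else 0)"
    by (intro smooth_on_sum[OF assms(1)] smooth_on_bounded_linear[OF assms(1) b] assms(2))
  then show ?thesis
    by (rule smooth_on_cong[OF assms(1), rotated]) (simp add: vec_eq_iff sum_component)
qed

lemma smooth_on_frechet_along:
  assumes "open S" "smooth_on S f" "smooth_on S w"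
  shows "smooth_on S (\<lambda>x. frechet_derivative f (at x) (w x))"
proof -
  have "smooth_on S (\<lambda>x. \<Sum>b\<in>Basis. (w x \<bullet> b) *\<^sub>R frechet_derivative f (at x) b)"
    by (intro smooth_intros assms smooth_on_frechet)
  then show ?thesis
    by (rule smooth_on_cong[OF assms(1), rotated])
      (rule linear_expand_Basis, rule smooth_on_linear_frechet[OF assms(2)])
qed

lemma smooth_on_matrix_vector_mult [smooth_intros]:
  fixes M :: "'e::euclidean_space \<Rightarrow> real^'m^'k" and w :: "'e \<Rightarrow> real^'m"
  assumes "open S" "smooth_on S M" "smooth_on S w"
  shows "smooth_on S (\<lambda>x. M x *v w x)"
  unfolding matrix_vector_mult_def by (intro smooth_intros assms)

lemma smooth_on_det:
  fixes M :: "'e::euclidean_space \<Rightarrow> real^'m^'m"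
  assumes "open S" "\<And>i j. smooth_on S (\<lambda>x. M x $ i $ j)"
  shows "smooth_on S (\<lambda>x. det (M x))"
  unfolding det_def by (intro smooth_intros assms)

text \<open>By Cramer's rule each entry is a quotient of two determinants, and determinants are
  polynomials in the entries.\<close>

lemma smooth_on_matrix_inv:
  fixes M :: "'e::euclidean_space \<Rightarrow> real^'m^'m"
  assumes "open S" "smooth_on S M" "\<And>x. x \<in> S \<Longrightarrow> invertible (M x)"
  shows "smooth_on S (\<lambda>x. matrix_inv (M x))"
proof -
  have M: "smooth_on S (\<lambda>x. M x $ i $ j)" for i j by (intro smooth_intros assms)
  have "smooth_on S (\<lambda>x. matrix_inv (M x) $ i $ j)" for i j
  proof (rule smooth_on_cong[OF assms(1)])
    show "smooth_on S (\<lambda>x. det (\<chi> k l. if l = i then axis j 1 $ k else M x $ k $ l) / det (M x))"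
    proof (rule smooth_on_divide[OF assms(1)])
      have "smooth_on S (\<lambda>x. if l = i then axis j 1 $ k else M x $ k $ l)" for k l
        by (cases "l = i") (simp_all add: M smooth_on_const[OF assms(1)])
      then show "smooth_on S (\<lambda>x. det (\<chi> k l. if l = i then axis j 1 $ k else M x $ k $ l))"
        by (intro smooth_on_det assms(1)) simp
      show "smooth_on S (\<lambda>x. det (M x))"
        by (intro smooth_on_det assms(1) M)
      show "det (M x) \<noteq> 0" if "x \<in> S" for x
        using assms(3)[OF that] invertible_det_nz by blast
    qed
    show "det (\<chi> k l. if l = i then axis j 1 $ k else M x $ k $ l) / det (M x) =
        matrix_inv (M x) $ i $ j" if "x \<in> S" for x
    proof -
      have "M x ** matrix_inv (M x) = mat 1"
        using assms(3)[OF that] unfolding invertible_def matrix_inv_def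
        by (rule someI2_ex) blast
      then have "M x *v (matrix_inv (M x) *v axis j 1) = axis j 1"
        by (simp add: matrix_vector_mul_assoc)
      then have "matrix_inv (M x) *v axis j 1 =
          (\<chi> k. det (\<chi> i l. if l = k then axis j 1 $ i else M x $ i $ l) / det (M x))"
        using cramer[of "M x"] assms(3)[OF that] invertible_det_nz by blast
      then have "(matrix_inv (M x) *v axis j 1) $ i =
          det (\<chi> k l. if l = i then axis j 1 $ k else M x $ k $ l) / det (M x)"
        by simp
      then show ?thesis
        by (simp add: matrix_vector_mult_basis column_def)
    qed
  qed
  then have "smooth_on S (\<lambda>x. \<chi> i j. matrix_inv (M x) $ i $ j)"
    by (intro smooth_on_vec_lambda assms(1)) simp
  then show ?thesis by simp
qed

text \<open>The mean value theorem, applied twice in either order, expresses the second difference quotient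
  through each of the two mixed derivatives.\<close>

lemma smooth_on_second_derivative_symmetric_real:
  fixes f :: "'e::euclidean_space \<Rightarrow> real"
  assumes "open S" "smooth_on S f" "x \<in> S"
  shows "frechet_derivative (\<lambda>y. frechet_derivative f (at y) u) (at x) v =
    frechet_derivative (\<lambda>y. frechet_derivative f (at y) v) (at x) u"
proof -
  let ?D = "\<lambda>u y. frechet_derivative f (at y) u"
  let ?DD = "\<lambda>u v y. frechet_derivative (?D u) (at y) v"
  have line: "((\<lambda>t. F (y + t *\<^sub>R w)) has_real_derivative frechet_derivative F (at (y + t *\<^sub>R w)) w) (at t)"
    if "smooth_on S F" "y + t *\<^sub>R w \<in> S" for F :: "'e \<Rightarrow> real" and y w t
  proof -
    have "((\<lambda>t. y + t *\<^sub>R w) has_derivative (\<lambda>s. s *\<^sub>R w)) (at t)"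
      by (auto intro!: derivative_eq_intros)
    from has_derivative_compose[OF this smooth_on_has_derivative[OF that]]
    have "((\<lambda>t. F (y + t *\<^sub>R w)) has_derivative
        (\<lambda>s. frechet_derivative F (at (y + t *\<^sub>R w)) (s *\<^sub>R w))) (at t)" .
    moreover have "(\<lambda>s. frechet_derivative F (at (y + t *\<^sub>R w)) (s *\<^sub>R w)) =
        (\<lambda>s. s * frechet_derivative F (at (y + t *\<^sub>R w)) w)"
      using linear_scale[OF smooth_on_linear_frechet[OF that]] by auto
    ultimately show ?thesis by (simp add: has_field_derivative_def mult_commute_abs)
  qed
  have quot: "\<exists>s t. 0 < s \<and> s < h \<and> 0 < t \<and> t < h \<and>
      f (x + h *\<^sub>R u + h *\<^sub>R v) - f (x + h *\<^sub>R u) - f (x + h *\<^sub>R v) + f x =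
      h * h * ?DD u v (x + s *\<^sub>R u + t *\<^sub>R v)"
    if h: "0 < h" and S: "\<And>s t. 0 \<le> s \<Longrightarrow> s \<le> h \<Longrightarrow> 0 \<le> t \<Longrightarrow> t \<le> h \<Longrightarrow> x + s *\<^sub>R u + t *\<^sub>R v \<in> S"
    for h u v
  proof -
    let ?g = "\<lambda>s. f ((x + h *\<^sub>R v) + s *\<^sub>R u) - f (x + s *\<^sub>R u)"
    have "\<exists>s>0. s < h \<and> ?g h - ?g 0 =
        (h - 0) * (?D u ((x + h *\<^sub>R v) + s *\<^sub>R u) - ?D u (x + s *\<^sub>R u))"
    proof (rule MVT2[OF h])
      fix s assume s: "0 \<le> s" "s \<le> h"
      show "(?g has_real_derivative (?D u ((x + h *\<^sub>R v) + s *\<^sub>R u) - ?D u (x + s *\<^sub>R u))) (at s)"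
        by (intro DERIV_diff line assms(2)) (use S[of s h] S[of s 0] s h in \<open>auto simp: algebra_simps\<close>)
    qed
    then obtain s where s: "0 < s" "s < h" "?g h - ?g 0 =
        h * (?D u ((x + h *\<^sub>R v) + s *\<^sub>R u) - ?D u (x + s *\<^sub>R u))" by auto
    let ?k = "\<lambda>t. ?D u ((x + s *\<^sub>R u) + t *\<^sub>R v)"
    have "\<exists>t>0. t < h \<and> ?k h - ?k 0 = (h - 0) * ?DD u v ((x + s *\<^sub>R u) + t *\<^sub>R v)"
    proof (rule MVT2[OF h])
      fix t assume t: "0 \<le> t" "t \<le> h"
      show "(?k has_real_derivative ?DD u v ((x + s *\<^sub>R u) + t *\<^sub>R v)) (at t)"
        by (intro line smooth_on_frechet assms(2)) (use S[of s t] s t in auto)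
    qed
    then obtain t where t: "0 < t" "t < h" "?k h - ?k 0 = h * ?DD u v ((x + s *\<^sub>R u) + t *\<^sub>R v)"
      by auto
    have "?D u ((x + h *\<^sub>R v) + s *\<^sub>R u) - ?D u (x + s *\<^sub>R u) = ?k h - ?k 0"
      by (simp add: algebra_simps)
    with s t have "?g h - ?g 0 = h * h * ?DD u v (x + s *\<^sub>R u + t *\<^sub>R v)" by simp
    moreover have "?g h - ?g 0 = f (x + h *\<^sub>R u + h *\<^sub>R v) - f (x + h *\<^sub>R u) - f (x + h *\<^sub>R v) + f x"
      by (simp add: algebra_simps)
    ultimately show ?thesis using s t by metis
  qed
  have cont: "isCont (?DD u v) x" for u v
    using smooth_on_imp_continuous_on[OF smooth_on_frechet[OF smooth_on_frechet[OF assms(2)]]] assms(1,3)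
    by (simp add: continuous_on_eq_continuous_at)
  have "\<bar>?DD u v x - ?DD v u x\<bar> < e" if e: "e > 0" for e
  proof -
    obtain d1 where d1: "d1 > 0" "\<And>y. dist y x < d1 \<Longrightarrow> dist (?DD u v y) (?DD u v x) < e / 2"
      using cont[of u v] half_gt_zero[OF e] unfolding continuous_at_eps_delta by blast
    obtain d2 where d2: "d2 > 0" "\<And>y. dist y x < d2 \<Longrightarrow> dist (?DD v u y) (?DD v u x) < e / 2"
      using cont[of v u] half_gt_zero[OF e] unfolding continuous_at_eps_delta by blast
    obtain d3 where d3: "d3 > 0" "ball x d3 \<subseteq> S"
      using assms(1,3) open_contains_ball by blast
    define d where "d = min d1 (min d2 d3)"
    \<comment> \<open>The 2 makes the estimate that follows strict, and the summand 1 keeps the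
      denominator positive even for u = v = 0.\<close>
    define h where "h = d / (2 * (norm u + norm v + 1))"
    have "d > 0" using d1 d2 d3 by (simp add: d_def)
    have n: "norm u + norm v + 1 > 0" by (simp add: add_nonneg_pos)
    then have h: "h > 0" using \<open>d > 0\<close> by (simp add: h_def)
    have hd: "h * (norm u + norm v + 1) < d"
    proof -
      have "d / (2 * k) * k = d / 2" if "k > 0" for k using that by simp
      from this[OF n] have "h * (norm u + norm v + 1) = d / 2" unfolding h_def .
      then show ?thesis using \<open>d > 0\<close> by simp
    qed
    have near: "dist (x + s *\<^sub>R u + t *\<^sub>R v) x < d" if "0 \<le> s" "s \<le> h" "0 \<le> t" "t \<le> h" for s t
    proof -
      have "dist (x + s *\<^sub>R u + t *\<^sub>R v) x = norm (s *\<^sub>R u + t *\<^sub>R v)" by (simp add: dist_norm)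
      also have "\<dots> \<le> s * norm u + t * norm v"
        using norm_triangle_ineq[of "s *\<^sub>R u" "t *\<^sub>R v"] that by simp
      also have "\<dots> \<le> h * norm u + h * norm v"
        using that by (intro add_mono mult_right_mono) auto
      also have "\<dots> \<le> h * (norm u + norm v + 1)" using h by (simp add: algebra_simps)
      finally show ?thesis using hd by simp
    qed
    have near': "dist (x + s *\<^sub>R v + t *\<^sub>R u) x < d" if "0 \<le> s" "s \<le> h" "0 \<le> t" "t \<le> h" for s t
      using near[of t s] that by (simp add: algebra_simps)
    have inS: "y \<in> S" if "dist y x < d" for y
      using that d3(2) by (auto simp: d_def dist_commute subset_iff)
    obtain s t where st: "0 < s" "s < h" "0 < t" "t < h"
      "f (x + h *\<^sub>R u + h *\<^sub>R v) - f (x + h *\<^sub>R u) - f (x + h *\<^sub>R v) + f x =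
      h * h * ?DD u v (x + s *\<^sub>R u + t *\<^sub>R v)"
      using quot[OF h, of u v] inS near by metis
    obtain s' t' where st': "0 < s'" "s' < h" "0 < t'" "t' < h"
      "f (x + h *\<^sub>R v + h *\<^sub>R u) - f (x + h *\<^sub>R v) - f (x + h *\<^sub>R u) + f x =
      h * h * ?DD v u (x + s' *\<^sub>R v + t' *\<^sub>R u)"
      using quot[OF h, of v u] inS near' by metis
    have "h * h * ?DD u v (x + s *\<^sub>R u + t *\<^sub>R v) = h * h * ?DD v u (x + s' *\<^sub>R v + t' *\<^sub>R u)"
      using st(5) st'(5) by (simp add: algebra_simps)
    then have "?DD u v (x + s *\<^sub>R u + t *\<^sub>R v) = ?DD v u (x + s' *\<^sub>R v + t' *\<^sub>R u)"
      using h by simp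
    moreover have "dist (?DD u v (x + s *\<^sub>R u + t *\<^sub>R v)) (?DD u v x) < e / 2"
      using near[of s t] st by (intro d1) (auto simp: d_def)
    moreover have "dist (?DD v u (x + s' *\<^sub>R v + t' *\<^sub>R u)) (?DD v u x) < e / 2"
      using near'[of s' t'] st' by (intro d2) (auto simp: d_def)
    ultimately show ?thesis unfolding dist_real_def by linarith
  qed
  \<comment> \<open>A nonzero difference would allow its own absolute value as \<open>e\<close>,
    making that value smaller than itself.\<close>
  from this[of "\<bar>?DD u v x - ?DD v u x\<bar>"] show ?thesis by force
qed

text \<open>Reduction to the real case: the inner product with a basis vector commutes with both
  differentiations. This symmetry is what makes the Lie bracket a tangent vector.\<close>

lemma smooth_on_second_derivative_symmetric:
  fixes f :: "'e::euclidean_space \<Rightarrow> 'f::euclidean_space"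
  assumes "open S" "smooth_on S f" "x \<in> S"
  shows "frechet_derivative (\<lambda>y. frechet_derivative f (at y) u) (at x) v =
    frechet_derivative (\<lambda>y. frechet_derivative f (at y) v) (at x) u"
proof (rule euclidean_eqI)
  fix b :: 'f assume "b \<in> Basis"
  have inner: "frechet_derivative (\<lambda>y. F y \<bullet> b) (at y) w = frechet_derivative F (at y) w \<bullet> b"
    if "smooth_on S F" "y \<in> S" for F :: "'e \<Rightarrow> 'f" and y w
    using frechet_derivative_at[OF bounded_linear.has_derivative[OF bounded_linear_inner_left
      smooth_on_has_derivative[OF that]], of b] by metis
  have s: "smooth_on S (\<lambda>y. f y \<bullet> b)"
    by (intro smooth_on_inner smooth_on_const assms)
  have "frechet_derivative (\<lambda>y. frechet_derivative f (at y) u) (at x) v \<bullet> b =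
      frechet_derivative (\<lambda>y. frechet_derivative (\<lambda>y. f y \<bullet> b) (at y) u) (at x) v" for u v
  proof -
    have "frechet_derivative (\<lambda>y. frechet_derivative f (at y) u \<bullet> b) (at x) =
        frechet_derivative (\<lambda>y. frechet_derivative (\<lambda>y. f y \<bullet> b) (at y) u) (at x)"
      by (rule frechet_derivative_transform_within_open[OF _ assms(1,3)])
        (use inner[OF assms(2)] smooth_on_imp_differentiable[OF smooth_on_inner[OF assms(1)
          smooth_on_frechet[OF assms(2)] smooth_on_const[OF assms(1)]] assms(3)] in auto)
    then show ?thesis using inner[OF smooth_on_frechet[OF assms(2)] assms(3)] by metis
  qed
  with smooth_on_second_derivative_symmetric_real[OF assms(1) s assms(3)]
  show "frechet_derivative (\<lambda>y. frechet_derivative f (at y) u) (at x) v \<bullet> b =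
    frechet_derivative (\<lambda>y. frechet_derivative f (at y) v) (at x) u \<bullet> b" by simp
qed

text \<open>The function exp(-1/t), extended by 0, does not reproduce itself under differentiation;
  with the factors t^(-n) the family is closed under it up to linear combinations, so that one
  induction covers all orders.\<close>

definition flat_exp :: "nat \<Rightarrow> real \<Rightarrow> real"
  where "flat_exp n t = (if t > 0 then inverse t ^ n * exp (- inverse t) else 0)"

text \<open>x^n / n! is one term of the exponential series, all of whose terms are nonnegative
  here.\<close>

lemma power_le_fact_mult_exp:
  fixes x :: real
  assumes "x \<ge> 0"
  shows "x ^ n \<le> fact n * exp x"
proof -
  have "(\<Sum>k\<in>{n}. x ^ k /\<^sub>R fact k) \<le> exp x"
    unfolding exp_def using summable_exp_generic[of x] assms by (intro sum_le_suminf) auto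
  then show ?thesis by (simp add: field_simps)
qed

text \<open>The previous bound at 1/t with exponent n + 2: the two extra powers leave a factor t^2,
  so that the difference quotient at 0 tends to 0.\<close>

lemma flat_exp_le: "\<bar>flat_exp n t\<bar> \<le> fact (n + 2) * t\<^sup>2"
proof (cases "t > 0")
  case True
  have "inverse t ^ (n + 2) \<le> fact (n + 2) * exp (inverse t)"
    using True by (intro power_le_fact_mult_exp) simp
  then have "inverse t ^ (n + 2) * (t\<^sup>2 * exp (- inverse t)) \<le>
      fact (n + 2) * exp (inverse t) * (t\<^sup>2 * exp (- inverse t))"
    using True by (intro mult_right_mono) auto
  also have "inverse t ^ (n + 2) * (t\<^sup>2 * exp (- inverse t)) = flat_exp n t"
    using True by (simp add: flat_exp_def field_simps power_add power2_eq_square)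
  also have "fact (n + 2) * exp (inverse t) * (t\<^sup>2 * exp (- inverse t)) = fact (n + 2) * t\<^sup>2"
    by (simp add: exp_minus field_simps)
  finally show ?thesis using True by (simp add: flat_exp_def)
qed (simp add: flat_exp_def)

lemma has_real_derivative_flat_exp:
  "(flat_exp n has_real_derivative (flat_exp (n + 2) t - n * flat_exp (n + 1) t)) (at t)"
proof -
  consider "t > 0" | "t < 0" | "t = 0" by linarith
  then show ?thesis
  proof cases
    case 1
    have "((\<lambda>t. inverse t ^ n * exp (- inverse t)) has_real_derivative
        (flat_exp (n + 2) t - n * flat_exp (n + 1) t)) (at t)"
    proof -
      have i: "(inverse has_real_derivative - (inverse t ^ 2)) (at t)"
        using DERIV_inverse[of t UNIV] 1 by (simp add: numeral_2_eq_2)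
      have "((\<lambda>t. inverse t ^ n) has_real_derivative - (real n * inverse t ^ (n + 1))) (at t)"
        using DERIV_power[OF i, of n] by (cases n) (simp_all add: algebra_simps power2_eq_square)
      moreover have "((\<lambda>t. exp (- inverse t)) has_real_derivative exp (- inverse t) * inverse t ^ 2) (at t)"
        using DERIV_chain2[OF DERIV_exp DERIV_minus[OF i]] by simp
      ultimately have "((\<lambda>t. inverse t ^ n * exp (- inverse t)) has_real_derivative
          - (real n * inverse t ^ (n + 1)) * exp (- inverse t) +
          exp (- inverse t) * inverse t ^ 2 * inverse t ^ n) (at t)"
        by (rule DERIV_mult)
      then show ?thesis
        using 1 by (simp add: flat_exp_def algebra_simps power2_eq_square)
    qed
    then show ?thesis
      by (rule has_field_derivative_transform_within_open[where S="{0<..}"]) (use 1 in \<open>auto simp: flat_exp_def\<close>)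
  next
    case 2
    have "((\<lambda>t. 0) has_real_derivative (flat_exp (n + 2) t - n * flat_exp (n + 1) t)) (at t)"
      using 2 by (simp add: flat_exp_def)
    then show ?thesis
      by (rule has_field_derivative_transform_within_open[where S="{..<0}"]) (use 2 in \<open>auto simp: flat_exp_def\<close>)
  next
    case 3
    have "((\<lambda>h. flat_exp n h / h) \<longlongrightarrow> 0) (at 0)"
    proof (rule Lim_null_comparison)
      show "\<forall>\<^sub>F h in at 0. norm (flat_exp n h / h) \<le> fact (n + 2) * \<bar>h\<bar>"
      proof (rule always_eventually, rule allI)
        fix h :: real
        have "\<bar>flat_exp n h\<bar> \<le> fact (n + 2) * (\<bar>h\<bar> * \<bar>h\<bar>)"
          using flat_exp_le[of n h] by (simp add: power2_eq_square)
        then show "norm (flat_exp n h / h) \<le> fact (n + 2) * \<bar>h\<bar>"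
          by (cases "h = 0") (simp_all add: abs_divide divide_le_eq mult.assoc)
      qed
      show "((\<lambda>h. fact (n + 2) * \<bar>h\<bar>) \<longlongrightarrow> (0::real)) (at 0)"
        by (rule tendsto_eq_intros refl | simp)+
    qed
    then show ?thesis using 3 by (simp add: DERIV_def flat_exp_def)
  qed
qed

lemma smooth_on_flat_exp: "smooth_on UNIV (flat_exp n)"
  unfolding smooth_on_def
proof
  show "Ck_on k UNIV (flat_exp n)" for k
  proof (induction k arbitrary: n)
    case 0
    show ?case
      using has_real_derivative_flat_exp[THEN DERIV_isCont] by (simp add: continuous_at_imp_continuous_on)
  next
    case (Suc k)
    show ?case
    proof (rule Ck_on_SucI)
      show "(flat_exp n has_derivative (\<lambda>v. (flat_exp (n + 2) t - n * flat_exp (n + 1) t) * v)) (at t)" for t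
        using has_real_derivative_flat_exp unfolding has_field_derivative_def .
      have "Ck_on k UNIV (\<lambda>t. flat_exp (n + 2) t + (- (n * v)) *\<^sub>R flat_exp (n + 1) t)" for v
        by (intro Ck_on_add Ck_on_bounded_linear[OF _ bounded_linear_scaleR_right] Suc.IH) simp_all
      have "Ck_on k UNIV (\<lambda>t. v *\<^sub>R (flat_exp (n + 2) t + (- n) *\<^sub>R flat_exp (n + 1) t))" for v
        by (intro Ck_on_add Ck_on_bounded_linear[OF _ bounded_linear_scaleR_right] Suc.IH) simp_all
      then show "Ck_on k UNIV (\<lambda>t. (flat_exp (n + 2) t - n * flat_exp (n + 1) t) * v)" for v
        by (simp add: mult.commute)
    qed simp
  qed
qed

text \<open>The squared distance, unlike the norm, is smooth at the centre too. No plateau is built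
  in: the function is merely positive on the ball, and later constructions divide by it.\<close>

definition bump :: "'e::euclidean_space \<Rightarrow> real \<Rightarrow> 'e \<Rightarrow> real"
  where "bump x r y = flat_exp 0 (r\<^sup>2 - (y - x) \<bullet> (y - x))"

lemma smooth_on_bump: "smooth_on UNIV (bump x r)"
proof -
  have "smooth_on UNIV (\<lambda>y. flat_exp 0 (r\<^sup>2 - (y - x) \<bullet> (y - x)))"
    by (rule smooth_on_compose[OF _ _ _ _ smooth_on_flat_exp]) (auto intro!: smooth_intros)
  then show ?thesis by (simp add: bump_def[abs_def])
qed

lemma bump_pos_iff: "r > 0 \<Longrightarrow> bump x r y > 0 \<longleftrightarrow> y \<in> ball x r"
  using norm_lt_square[of "y - x" r]
  by (simp add: bump_def flat_exp_def dist_norm norm_minus_commute)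

lemma bump_eq_0: "r > 0 \<Longrightarrow> y \<notin> ball x r \<Longrightarrow> bump x r y = 0"
  using bump_pos_iff[of r x y] by (auto simp: bump_def flat_exp_def split: if_splits)

text \<open>Needed for the fibre part of a transition map of TM, where base point and direction vary
  independently.\<close>

lemma smooth_on_frechet_comp:
  fixes f :: "'e::euclidean_space \<Rightarrow> 'f::real_normed_vector" and \<phi> w :: "'d::euclidean_space \<Rightarrow> 'e"
  assumes "open T" "open S" "smooth_on S f" "smooth_on T \<phi>" "\<phi> ` T \<subseteq> S" "smooth_on T w"
  shows "smooth_on T (\<lambda>z. frechet_derivative f (at (\<phi> z)) (w z))"
proof -
  have "smooth_on T (\<lambda>z. frechet_derivative f (at (\<phi> z)) b)" for b
    by (rule smooth_on_compose[OF assms(1,2,5,4) smooth_on_frechet[OF assms(3)]])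
  then have "smooth_on T (\<lambda>z. \<Sum>b\<in>Basis. (w z \<bullet> b) *\<^sub>R frechet_derivative f (at (\<phi> z)) b)"
    by (intro smooth_on_sum smooth_on_scaleR smooth_on_inner smooth_on_const assms)
  then show ?thesis
    by (rule smooth_on_cong[OF assms(1), rotated])
      (rule linear_expand_Basis, rule smooth_on_linear_frechet[OF assms(3)], use assms(5) in auto)
qed

lemma frechet_derivative_eqI: "(f has_derivative f') (at x) \<Longrightarrow> frechet_derivative f (at x) = f'"
  using frechet_derivative_at by metis

text \<open>The product rule for a derivative taken along a moving vector. Its second summand, a
  second derivative of f, is the term that disappears from the Lie bracket by symmetry.\<close>

lemma has_derivative_frechet_along:
  fixes f :: "'e::euclidean_space \<Rightarrow> 'f::real_normed_vector"
  assumes "open S" "smooth_on S f" "x \<in> S" "(w has_derivative w') (at x)"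
  shows "((\<lambda>y. frechet_derivative f (at y) (w y)) has_derivative
    (\<lambda>v. frechet_derivative f (at x) (w' v) +
      frechet_derivative (\<lambda>y. frechet_derivative f (at y) (w x)) (at x) v)) (at x)"
proof -
  let ?D = "\<lambda>b. frechet_derivative (\<lambda>y. frechet_derivative f (at y) b) (at x)"
  have D: "((\<lambda>y. frechet_derivative f (at y) b) has_derivative ?D b) (at x)" for b
    by (rule smooth_on_has_derivative[OF smooth_on_frechet[OF assms(2)] assms(3)])
  have sum: "((\<lambda>y. \<Sum>b\<in>Basis. (u y \<bullet> b) *\<^sub>R frechet_derivative f (at y) b) has_derivative
      (\<lambda>v. \<Sum>b\<in>Basis. (u x \<bullet> b) *\<^sub>R ?D b v + (u' v \<bullet> b) *\<^sub>R frechet_derivative f (at x) b)) (at x)"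
    if "(u has_derivative u') (at x)" for u u'
    by (intro has_derivative_sum has_derivative_scaleR D has_derivative_inner_left that)
  have tr: "((\<lambda>y. frechet_derivative f (at y) (u y)) has_derivative L) (at x)"
    if "((\<lambda>y. \<Sum>b\<in>Basis. (u y \<bullet> b) *\<^sub>R frechet_derivative f (at y) b) has_derivative L) (at x)" for u L
    by (rule has_derivative_transform_within_open[OF that assms(1,3)])
      (rule linear_expand_Basis, rule smooth_on_linear_frechet[OF assms(2)])
  \<comment> \<open>Linearity of the second derivative in its inner direction, obtained by
    differentiating the basis expansion for a constant direction.\<close>
  have c: "?D c v = (\<Sum>b\<in>Basis. (c \<bullet> b) *\<^sub>R ?D b v)" for c v
  proof -
    have "((\<lambda>y. c) has_derivative (\<lambda>v. 0)) (at x)" by simp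
    from fun_cong[OF frechet_derivative_eqI[OF tr[OF sum[OF this]]], of v] show ?thesis by simp
  qed
  have "(\<lambda>v. \<Sum>b\<in>Basis. (w x \<bullet> b) *\<^sub>R ?D b v + (w' v \<bullet> b) *\<^sub>R frechet_derivative f (at x) b) =
      (\<lambda>v. frechet_derivative f (at x) (w' v) + ?D (w x) v)"
    by (simp add: sum.distrib c[symmetric] linear_expand_Basis[OF smooth_on_linear_frechet[OF assms(2,3)]] add.commute)
  with tr[OF sum[OF assms(4)]] show ?thesis by simp
qed

section \<open>Manifolds given by an atlas\<close>

text \<open>Just compatibility of the charts: in this form the locale serves both for
  \<open>A\<close> and for \<open>tangent_atlas A\<close>, which consists of the induced charts
  only.\<close>

locale atlas =
  fixes A :: "('a, 'e::euclidean_space) chart set"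
  assumes smooth_atlas: "smooth_atlas A"
begin

abbreviation transition where "transition c d \<equiv> snd d \<circ> chart_inv c"

lemma inj_on_chart: "c \<in> A \<Longrightarrow> inj_on (snd c) (fst c)"
  and open_chart: "c \<in> A \<Longrightarrow> open (snd c ` fst c)"
  using smooth_atlas by (auto simp: smooth_atlas_def is_chart_def)

lemma open_overlap: "c \<in> A \<Longrightarrow> d \<in> A \<Longrightarrow> open (snd c ` (fst c \<inter> fst d))"
  and smooth_on_transition: "c \<in> A \<Longrightarrow> d \<in> A \<Longrightarrow> smooth_on (snd c ` (fst c \<inter> fst d)) (transition c d)"
  using smooth_atlas by (auto simp: smooth_atlas_def smooth_transition_def)

lemma chart_inv_chart [simp]: "c \<in> A \<Longrightarrow> p \<in> fst c \<Longrightarrow> chart_inv c (snd c p) = p"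
  by (simp add: chart_inv_def inj_on_chart)

lemma chart_image_iff: "c \<in> A \<Longrightarrow> p \<in> fst c \<Longrightarrow> W \<subseteq> fst c \<Longrightarrow> snd c p \<in> snd c ` W \<longleftrightarrow> p \<in> W"
  using inj_on_chart inj_on_image_mem_iff by metis

lemma transition_has_derivative:
  assumes "c \<in> A" "d \<in> A" "p \<in> fst c" "p \<in> fst d"
  shows "(transition c d has_derivative transition_deriv c d p) (at (snd c p))"
  unfolding transition_deriv_def
  using smooth_on_has_derivative[OF smooth_on_transition] assms by blast

lemma linear_transition_deriv:
  "c \<in> A \<Longrightarrow> d \<in> A \<Longrightarrow> p \<in> fst c \<Longrightarrow> p \<in> fst d \<Longrightarrow> linear (transition_deriv c d p)"
  using transition_has_derivative has_derivative_linear by blast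

lemma has_derivative_change_chart:
  assumes "c \<in> A" "d \<in> A" "p \<in> fst c" "p \<in> fst d" "((f \<circ> chart_inv d) has_derivative L) (at (snd d p))"
  shows "((f \<circ> chart_inv c) has_derivative (\<lambda>v. L (transition_deriv c d p v))) (at (snd c p))"
proof -
  have "((\<lambda>x. (f \<circ> chart_inv d) (transition c d x)) has_derivative (\<lambda>v. L (transition_deriv c d p v))) (at (snd c p))"
    using has_derivative_compose[OF transition_has_derivative[OF assms(1-4)], of "f \<circ> chart_inv d" L] assms by simp
  then show ?thesis
    by (rule has_derivative_transform_within_open[OF _ open_overlap[OF assms(1,2)]]) (use assms in auto)
qed

text \<open>Cocycle rule: the chain rule gives one derivative of the transition from
  \<open>c\<close> to \<open>e\<close>, its definition another, and derivatives are unique.\<close>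

lemma transition_deriv_compose:
  assumes "c \<in> A" "d \<in> A" "e \<in> A" "p \<in> fst c" "p \<in> fst d" "p \<in> fst e"
  shows "transition_deriv d e p (transition_deriv c d p v) = transition_deriv c e p v"
  using fun_cong[OF has_derivative_unique[OF has_derivative_change_chart[OF assms(1,2,4,5)
        transition_has_derivative[OF assms(2,3,5,6)]] transition_has_derivative[OF assms(1,3,4,6)]], of v]
  by simp

lemma transition_deriv_self:
  assumes "c \<in> A" "p \<in> fst c"
  shows "transition_deriv c c p v = v"
proof -
  have "(transition c c has_derivative (\<lambda>v. v)) (at (snd c p))"
    by (rule has_derivative_transform_within_open[OF _ open_chart[OF assms(1)], where f="\<lambda>x. x"])
      (use assms in auto)
  from has_derivative_unique[OF this transition_has_derivative[OF assms(1,1,2,2)]]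
  show ?thesis by (rule fun_cong[symmetric])
qed

lemma tangent_spaceD:
  "w \<in> tangent_space A p \<Longrightarrow> c \<in> A \<Longrightarrow> d \<in> A \<Longrightarrow> p \<in> fst c \<Longrightarrow> p \<in> fst d \<Longrightarrow>
    w d = transition_deriv c d p (w c)"
  unfolding tangent_space_def by blast

lemma tangent_space_0D: "w \<in> tangent_space A p \<Longrightarrow> \<not> (c \<in> A \<and> p \<in> fst c) \<Longrightarrow> w c = 0"
  unfolding tangent_space_def by blast

lemma tangent_spaceI:
  assumes "\<And>c. \<not> (c \<in> A \<and> p \<in> fst c) \<Longrightarrow> w c = 0"
    and "\<And>c d. c \<in> A \<Longrightarrow> d \<in> A \<Longrightarrow> p \<in> fst c \<Longrightarrow> p \<in> fst d \<Longrightarrow> w d = transition_deriv c d p (w c)"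
  shows "w \<in> tangent_space A p"
  using assms unfolding tangent_space_def by blast

text \<open>The transformation law recovers all components from those in one chart. Most later
  equations between tangent vectors are checked in a single chart in this way.\<close>

lemma tangent_space_eqI:
  assumes "v \<in> tangent_space A p" "w \<in> tangent_space A p" "c \<in> A" "p \<in> fst c" "v c = w c"
  shows "v = w"
proof
  fix d show "v d = w d"
  proof (cases "d \<in> A \<and> p \<in> fst d")
    case True
    then show ?thesis
      using tangent_spaceD[OF assms(1,3) _ assms(4), of d] tangent_spaceD[OF assms(2,3) _ assms(4), of d] assms(5)
      by simp
  next
    case False
    then show ?thesis
      using tangent_space_0D[OF assms(1) False] tangent_space_0D[OF assms(2) False] by simp
  qed
qed

lemma coord_vector_tangent: "c \<in> A \<Longrightarrow> p \<in> fst c \<Longrightarrow> coord_vector A c e p \<in> tangent_space A p"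
  by (rule tangent_spaceI) (auto simp: coord_vector_def transition_deriv_compose)

lemma coord_vector_apply [simp]: "c \<in> A \<Longrightarrow> p \<in> fst c \<Longrightarrow> coord_vector A c e p c = e"
  by (simp add: coord_vector_def transition_deriv_self)

lemma subspace_tangent_space: "subspace (tangent_space A p)"
  unfolding subspace_def
proof (intro conjI ballI allI)
  note lin = linear_transition_deriv[of _ _ p]
  show "0 \<in> tangent_space A p"
    by (rule tangent_spaceI) (simp_all add: linear_0[OF lin])
  show "x + y \<in> tangent_space A p" if "x \<in> tangent_space A p" "y \<in> tangent_space A p" for x y
  proof (rule tangent_spaceI)
    show "(x + y) c = 0" if "\<not> (c \<in> A \<and> p \<in> fst c)" for c
      using that tangent_space_0D \<open>x \<in> _\<close> \<open>y \<in> _\<close> by (metis add_0 plus_fun_apply)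
    show "(x + y) d = transition_deriv c d p ((x + y) c)"
      if "c \<in> A" "d \<in> A" "p \<in> fst c" "p \<in> fst d" for c d
      using tangent_spaceD[OF \<open>x \<in> _\<close> that] tangent_spaceD[OF \<open>y \<in> _\<close> that]
      by (simp add: linear_add[OF lin[OF that]])
  qed
  show "r *\<^sub>R x \<in> tangent_space A p" if "x \<in> tangent_space A p" for r x
  proof (rule tangent_spaceI)
    show "(r *\<^sub>R x) c = 0" if "\<not> (c \<in> A \<and> p \<in> fst c)" for c
      using tangent_space_0D[OF \<open>x \<in> _\<close> that] by (simp add: scaleR_fun_def)
    show "(r *\<^sub>R x) d = transition_deriv c d p ((r *\<^sub>R x) c)"
      if "c \<in> A" "d \<in> A" "p \<in> fst c" "p \<in> fst d" for c d
      using tangent_spaceD[OF \<open>x \<in> _\<close> that] by (simp add: scaleR_fun_def linear_scale[OF lin[OF that]])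
  qed
qed

text \<open>\<open>tderiv\<close> computes in a chart chosen by \<open>SOME\<close>; under a change
  of chart, the chain rule and the transformation law of \<open>w\<close> compensate each
  other.\<close>

lemma tderiv_chart:
  assumes "c \<in> A" "p \<in> fst c" "w \<in> tangent_space A p" "((f \<circ> chart_inv c) has_derivative L) (at (snd c p))"
  shows "tderiv A p w f = L (w c)"
proof -
  define d where "d = (SOME c. c \<in> A \<and> p \<in> fst c)"
  have d: "d \<in> A" "p \<in> fst d" using someI[of "\<lambda>c. c \<in> A \<and> p \<in> fst c"] assms by (auto simp: d_def)
  have "frechet_derivative (f \<circ> chart_inv d) (at (snd d p)) = (\<lambda>v. L (transition_deriv d c p v))"
    by (rule frechet_derivative_eqI[OF has_derivative_change_chart[OF d(1) assms(1) d(2) assms(2,4)]])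
  then show ?thesis
    using tangent_spaceD[OF assms(3) d(1) assms(1) d(2) assms(2)]
    by (simp add: tderiv_def d_def[symmetric])
qed

text \<open>The value of \<open>topology\<close> is meaningful only once the predicate is known to
  define a topology; for intersections this rests on the injectivity of the charts.\<close>

lemma openin_manifold_topology:
  "openin (manifold_topology A) W \<longleftrightarrow> W \<subseteq> points A \<and> (\<forall>c\<in>A. open (snd c ` (W \<inter> fst c)))"
proof -
  have "istopology (\<lambda>W. W \<subseteq> points A \<and> (\<forall>c\<in>A. open (snd c ` (W \<inter> fst c))))"
    unfolding istopology_def
  proof (intro conjI allI impI ballI; (elim conjE)?)
    fix S T c assume "c \<in> A" and *: "\<forall>c\<in>A. open (snd c ` (S \<inter> fst c))" "\<forall>c\<in>A. open (snd c ` (T \<inter> fst c))"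
    have "snd c ` (S \<inter> T \<inter> fst c) = snd c ` (S \<inter> fst c) \<inter> snd c ` (T \<inter> fst c)"
      using inj_on_image_Int[OF inj_on_chart[OF \<open>c \<in> A\<close>], of "S \<inter> fst c" "T \<inter> fst c"] by (auto simp: Int_ac)
    then show "open (snd c ` (S \<inter> T \<inter> fst c))" using * \<open>c \<in> A\<close> by auto
  next
    fix K c assume "c \<in> A" and *: "\<forall>S\<in>K. S \<subseteq> points A \<and> (\<forall>c\<in>A. open (snd c ` (S \<inter> fst c)))"
    have "snd c ` (\<Union>K \<inter> fst c) = (\<Union>S\<in>K. snd c ` (S \<inter> fst c))" by auto
    then show "open (snd c ` (\<Union>K \<inter> fst c))" using * \<open>c \<in> A\<close> by auto
  qed auto
  then show ?thesis by (simp add: manifold_topology_def topology_inverse')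
qed

lemma topspace_manifold_topology: "topspace (manifold_topology A) = points A"
proof
  show "topspace (manifold_topology A) \<subseteq> points A"
    using openin_manifold_topology[of "topspace (manifold_topology A)"] by simp
  have "snd c ` (points A \<inter> fst c) = snd c ` fst c" if "c \<in> A" for c
    using that by (auto simp: points_def)
  then have "openin (manifold_topology A) (points A)"
    using open_chart by (simp add: openin_manifold_topology)
  then show "points A \<subseteq> topspace (manifold_topology A)" by (rule openin_subset)
qed

lemma open_overlap_vimage:
  assumes "c \<in> A" "d \<in> A" "open S"
  shows "open (snd d ` (fst d \<inter> fst c) \<inter> transition d c -` S)"
  by (rule continuous_open_preimage[OF smooth_on_imp_continuous_on[OF smooth_on_transition] open_overlap])
    (use assms in auto)

lemma smooth_on_change_chart:
  assumes "c \<in> A" "d \<in> A" "p \<in> fst c" "p \<in> fst d" "open S" "snd c p \<in> S" "smooth_on S f"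
  obtains T where "open T" "snd d p \<in> T" "T \<subseteq> snd d ` (fst d \<inter> fst c)" "transition d c ` T \<subseteq> S"
    "smooth_on T (\<lambda>y. f (transition d c y))"
proof
  let ?T = "snd d ` (fst d \<inter> fst c) \<inter> transition d c -` S"
  show o: "open ?T" by (rule open_overlap_vimage[OF assms(1,2,5)])
  show "snd d p \<in> ?T" using assms by auto
  show i: "transition d c ` ?T \<subseteq> S" by auto
  show "smooth_on ?T (\<lambda>y. f (transition d c y))"
    by (rule smooth_on_compose[OF o assms(5) i smooth_on_subset[OF smooth_on_transition[OF assms(2,1)]] assms(7)])
      auto
qed auto

text \<open>The definition asks for smoothness in every chart; since transitions are smooth, one
  chart around each point is enough.\<close>

lemma smooth_functionI:
  assumes "\<And>p. p \<in> W \<Longrightarrow> \<exists>c\<in>A. p \<in> fst c \<and> (\<exists>S. open S \<and> snd c p \<in> S \<and> smooth_on S (f \<circ> chart_inv c))"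
  shows "smooth_function A W f"
  unfolding smooth_function_def
proof (intro ballI smooth_on_local)
  fix d y assume "d \<in> A" "y \<in> snd d ` (W \<inter> fst d)"
  then obtain p where p: "p \<in> W" "p \<in> fst d" "y = snd d p" by auto
  then obtain c S where c: "c \<in> A" "p \<in> fst c" "open S" "snd c p \<in> S" "smooth_on S (f \<circ> chart_inv c)"
    using assms[OF p(1)] by (elim bexE conjE exE)
  obtain T where T: "open T" "snd d p \<in> T" "T \<subseteq> snd d ` (fst d \<inter> fst c)" "transition d c ` T \<subseteq> S"
    "smooth_on T (\<lambda>y. (f \<circ> chart_inv c) (transition d c y))"
    using smooth_on_change_chart[OF c(1) \<open>d \<in> A\<close> c(2) p(2) c(3-5)] .
  have "smooth_on T (f \<circ> chart_inv d)"
    by (rule smooth_on_cong[OF T(1) _ T(5)]) (use T(3) c(1) \<open>d \<in> A\<close> in auto)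
  then show "\<exists>T. open T \<and> y \<in> T \<and> smooth_on T (f \<circ> chart_inv d)"
    by (intro exI[of _ T] conjI) (simp_all add: T p)
qed

text \<open>Again one chart per point suffices, but the components now also pass through the
  derivative of the transition. \<open>S\<close> is kept inside the image of \<open>W\<close>
  because the transformation law is available only where \<open>X\<close> is tangent.\<close>

lemma sectionsI:
  assumes "X \<in> extensional W" "\<And>p. p \<in> W \<Longrightarrow> X p \<in> V p" "\<And>p. p \<in> W \<Longrightarrow> X p \<in> tangent_space A p"
    and "\<And>p. p \<in> W \<Longrightarrow> \<exists>c\<in>A. p \<in> fst c \<and> (\<exists>S. open S \<and> snd c p \<in> S \<and> S \<subseteq> snd c ` (W \<inter> fst c) \<and>
      smooth_on S (\<lambda>x. X (chart_inv c x) c))"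
  shows "X \<in> sections A W V"
  unfolding sections_def
proof (intro CollectI conjI ballI smooth_on_local)
  fix d y assume "d \<in> A" "y \<in> snd d ` (W \<inter> fst d)"
  then obtain p where p: "p \<in> W" "p \<in> fst d" "y = snd d p" by auto
  then obtain c S where c: "c \<in> A" "p \<in> fst c" "open S" "snd c p \<in> S" "S \<subseteq> snd c ` (W \<inter> fst c)"
    "smooth_on S (\<lambda>x. X (chart_inv c x) c)"
    using assms(4)[OF p(1)] by (elim bexE conjE exE)
  let ?S = "S \<inter> snd c ` (fst c \<inter> fst d)"
  have oS: "open ?S" using c open_overlap \<open>d \<in> A\<close> by blast
  have G: "smooth_on ?S (\<lambda>x. frechet_derivative (transition c d) (at x) (X (chart_inv c x) c))"
    by (rule smooth_on_frechet_along[OF oS smooth_on_subset[OF smooth_on_transition]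
          smooth_on_subset[OF c(6)]]) (use c \<open>d \<in> A\<close> in auto)
  have "snd c p \<in> ?S" using c p by auto
  then obtain T where T: "open T" "snd d p \<in> T" "T \<subseteq> snd d ` (fst d \<inter> fst c)"
    "transition d c ` T \<subseteq> ?S"
    "smooth_on T (\<lambda>y. frechet_derivative (transition c d) (at (transition d c y)) (X (chart_inv c (transition d c y)) c))"
    by (rule smooth_on_change_chart[OF c(1) \<open>d \<in> A\<close> c(2) p(2) oS _ G])
  have "smooth_on T (\<lambda>y. X (chart_inv d y) d)"
  proof (rule smooth_on_cong[OF T(1) _ T(5)])
    fix y assume "y \<in> T"
    then obtain q where q: "q \<in> fst d" "q \<in> fst c" "y = snd d q" using T(3) by auto
    have "snd c q \<in> ?S" using T(4) \<open>y \<in> T\<close> q \<open>d \<in> A\<close> by (force simp: image_subset_iff)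
    then have "q \<in> W" using c(5) q chart_image_iff[OF c(1) q(2), of "W \<inter> fst c"] by auto
    then show "frechet_derivative (transition c d) (at (transition d c y)) (X (chart_inv c (transition d c y)) c) =
        X (chart_inv d y) d"
      using tangent_spaceD[OF assms(3) c(1) \<open>d \<in> A\<close> q(2,1)] q c(1) \<open>d \<in> A\<close>
      by (simp add: transition_deriv_def)
  qed
  then show "\<exists>T. open T \<and> y \<in> T \<and> smooth_on T (\<lambda>y. X (chart_inv d y) d)"
    by (intro exI[of _ T] conjI) (simp_all add: T p)
qed (use assms in auto)

lemma sections_smooth: "X \<in> sections A W V \<Longrightarrow> c \<in> A \<Longrightarrow> smooth_on (snd c ` (W \<inter> fst c)) (\<lambda>x. X (chart_inv c x) c)"
  and sections_in: "X \<in> sections A W V \<Longrightarrow> p \<in> W \<Longrightarrow> X p \<in> V p"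
  and sections_extensional: "X \<in> sections A W V \<Longrightarrow> X \<in> extensional W"
  by (auto simp: sections_def)

lemma lie_bracket_apply:
  assumes "openin (manifold_topology A) W" "X \<in> vector_fields A W" "Y \<in> vector_fields A W" "p \<in> W"
    and "c \<in> A" "p \<in> fst c"
  shows "lie_bracket A X Y p c =
    frechet_derivative (\<lambda>x. Y (chart_inv c x) c) (at (snd c p)) (X p c) -
    frechet_derivative (\<lambda>x. X (chart_inv c x) c) (at (snd c p)) (Y p c)"
proof -
  have x: "snd c p \<in> snd c ` (W \<inter> fst c)" using assms by auto
  have T: "tderiv A p (Z p) (\<lambda>q. Z' q c) = frechet_derivative (\<lambda>x. Z' (chart_inv c x) c) (at (snd c p)) (Z p c)"
    if "Z \<in> vector_fields A W" "Z' \<in> vector_fields A W" for Z Z'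
    by (rule tderiv_chart[OF assms(5,6) sections_in[OF that(1) assms(4)]], unfold o_def)
      (rule smooth_on_has_derivative[OF sections_smooth[OF that(2) assms(5)] x])
  show ?thesis
    using assms(5,6) by (simp add: lie_bracket_def T[OF assms(2,3)] T[OF assms(3,2)])
qed

text \<open>In another chart the components of a field are the transition derivative applied to the
  old ones. Differentiating them produces a second derivative of the transition, symmetric in the
  two fields, which drops out of the difference.\<close>

lemma lie_bracket_tangent:
  assumes "openin (manifold_topology A) W" "X \<in> vector_fields A W" "Y \<in> vector_fields A W" "p \<in> W"
  shows "lie_bracket A X Y p \<in> tangent_space A p"
proof (rule tangent_spaceI)
  show "lie_bracket A X Y p c = 0" if "\<not> (c \<in> A \<and> p \<in> fst c)" for c
    by (simp only: lie_bracket_def that if_False)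
  fix c d assume c: "c \<in> A" and d: "d \<in> A" and p: "p \<in> fst c" "p \<in> fst d"
  let ?\<tau> = "transition c d" and ?x = "snd c p" and ?O = "snd c ` (fst c \<inter> fst d)" and ?U = "snd c ` (W \<inter> fst c)"
  let ?D2 = "\<lambda>u. frechet_derivative (\<lambda>y. frechet_derivative ?\<tau> (at y) u) (at ?x)"
  have oU: "open ?U" using assms(1) c by (simp add: openin_manifold_topology)
  have x: "?x \<in> ?U" "?x \<in> ?O" using assms(4) p by auto
  have main: "tderiv A p (Z p) (\<lambda>q. Z' q d) = transition_deriv c d p
      (frechet_derivative (\<lambda>x. Z' (chart_inv c x) c) (at ?x) (Z p c)) + ?D2 (Z' p c) (Z p c)"
    if "Z \<in> vector_fields A W" "Z' \<in> vector_fields A W" for Z Z'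
  proof (rule tderiv_chart[OF c p(1) sections_in[OF that(1) assms(4)]])
    let ?f = "\<lambda>x. Z' (chart_inv c x) c"
    have f: "(?f has_derivative frechet_derivative ?f (at ?x)) (at ?x)"
      by (rule smooth_on_has_derivative[OF sections_smooth[OF that(2) c] x(1)])
    have "((\<lambda>y. frechet_derivative ?\<tau> (at y) (?f y)) has_derivative
        (\<lambda>v. transition_deriv c d p (frechet_derivative ?f (at ?x) v) + ?D2 (Z' p c) v)) (at ?x)"
      using has_derivative_frechet_along[OF open_overlap[OF c d] smooth_on_transition[OF c d] x(2) f] c p
      by (simp add: transition_deriv_def)
    then show "(((\<lambda>q. Z' q d) \<circ> chart_inv c) has_derivative
        (\<lambda>v. transition_deriv c d p (frechet_derivative ?f (at ?x) v) + ?D2 (Z' p c) v)) (at ?x)"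
    proof (rule has_derivative_transform_within_open[where s="?U \<inter> ?O"])
      show "open (?U \<inter> ?O)" using oU open_overlap[OF c d] by blast
      show "?x \<in> ?U \<inter> ?O" using x by blast
      fix y assume y: "y \<in> ?U \<inter> ?O"
      then obtain q where q: "q \<in> fst c" "q \<in> fst d" "y = snd c q" by auto
      then have "q \<in> W" using y chart_image_iff[OF c q(1), of "W \<inter> fst c"] by auto
      then show "frechet_derivative ?\<tau> (at y) (?f y) = ((\<lambda>q. Z' q d) \<circ> chart_inv c) y"
        using tangent_spaceD[OF sections_in[OF that(2)] c d q(1,2)] q c
        by (simp add: transition_deriv_def)
    qed
  qed
  have sym: "?D2 u v = ?D2 v u" for u v
  by (rule smooth_on_second_derivative_symmetric[OF open_overlap[OF c d] smooth_on_transition[OF c d] x(2)])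
  show "lie_bracket A X Y p d = transition_deriv c d p (lie_bracket A X Y p c)"
    unfolding lie_bracket_apply[OF assms c p(1)] linear_diff[OF linear_transition_deriv[OF c d p]]
    using main[OF assms(2,3)] main[OF assms(3,2)] sym[of "X p c" "Y p c"] d p
    by (simp add: lie_bracket_def)
qed

end

section \<open>The tangent bundle\<close>

context atlas
begin

lemma fst_tangent_chart: "q \<in> fst (tangent_chart A c) \<longleftrightarrow> fst q \<in> fst c \<and> snd q \<in> tangent_space A (fst q)"
  by (cases q) (simp add: tangent_chart_def)

lemma snd_tangent_chart: "snd (tangent_chart A c) q = (snd c (fst q), snd q c)"
  by (cases q) (simp add: tangent_chart_def)

lemma tangent_chart_image:
  assumes "c \<in> A" "S \<subseteq> fst c"
  shows "snd (tangent_chart A c) ` {q. fst q \<in> S \<and> snd q \<in> tangent_space A (fst q)} = (snd c ` S) \<times> UNIV"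
proof (intro equalityI subsetI)
  fix z assume "z \<in> (snd c ` S) \<times> (UNIV :: 'e set)"
  then obtain p where p: "p \<in> S" "fst z = snd c p" by auto
  then have "p \<in> fst c" using assms by auto
  then have "z = snd (tangent_chart A c) (p, coord_vector A c (snd z) p)"
    using p assms(1) by (simp add: snd_tangent_chart prod_eq_iff)
  moreover have "(p, coord_vector A c (snd z) p) \<in> {q. fst q \<in> S \<and> snd q \<in> tangent_space A (fst q)}"
    using p coord_vector_tangent[OF assms(1) \<open>p \<in> fst c\<close>] by simp
  ultimately show "z \<in> snd (tangent_chart A c) ` {q. fst q \<in> S \<and> snd q \<in> tangent_space A (fst q)}"
    by (rule image_eqI)
qed (auto simp: snd_tangent_chart)

lemma inj_on_tangent_chart:
  assumes "c \<in> A"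
  shows "inj_on (snd (tangent_chart A c)) (fst (tangent_chart A c))"
proof (rule inj_onI)
  fix q r assume q: "q \<in> fst (tangent_chart A c)" and r: "r \<in> fst (tangent_chart A c)"
    and eq: "snd (tangent_chart A c) q = snd (tangent_chart A c) r"
  have "fst q = fst r"
    using inj_onD[OF inj_on_chart[OF assms]] q r eq by (simp add: fst_tangent_chart snd_tangent_chart)
  moreover have "snd q = snd r"
    using tangent_space_eqI[of "snd q" "fst q" "snd r" c] q r eq assms calculation
    by (simp add: fst_tangent_chart snd_tangent_chart)
  ultimately show "q = r" by (simp add: prod_eq_iff)
qed

lemma tangent_chart_inv:
  assumes "c \<in> A" "p \<in> fst c"
  shows "chart_inv (tangent_chart A c) (snd c p, e) = (p, coord_vector A c e p)"
  unfolding chart_inv_def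
  by (rule inv_into_f_eq[OF inj_on_tangent_chart[OF assms(1)]])
    (use assms coord_vector_tangent[OF assms] in \<open>simp_all add: fst_tangent_chart snd_tangent_chart\<close>)

lemma tangent_chart_overlap:
  "fst (tangent_chart A c) \<inter> fst (tangent_chart A d) =
    {q. fst q \<in> fst c \<inter> fst d \<and> snd q \<in> tangent_space A (fst q)}"
  by (auto simp: fst_tangent_chart)

text \<open>In induced coordinates a transition sends (x, y) to (f x, Df(x) y), with f the
  transition of M; it is defined over a full cylinder, since the fibre coordinate is
  unrestricted.\<close>

lemma smooth_atlas_tangent_atlas: "smooth_atlas (tangent_atlas A)"
  unfolding smooth_atlas_def tangent_atlas_def
proof (intro conjI ballI; elim imageE; hypsubst)
  fix c assume c: "c \<in> A"
  have "fst (tangent_chart A c) = {q. fst q \<in> fst c \<and> snd q \<in> tangent_space A (fst q)}"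
    by (auto simp: fst_tangent_chart)
  then show "is_chart (tangent_chart A c)"
    unfolding is_chart_def
    using inj_on_tangent_chart[OF c] open_chart[OF c] tangent_chart_image[OF c subset_refl]
    by (simp add: open_Times)
next
  fix c d assume c: "c \<in> A" and d: "d \<in> A"
  let ?O = "snd c ` (fst c \<inter> fst d)"
  have img: "snd (tangent_chart A c) ` (fst (tangent_chart A c) \<inter> fst (tangent_chart A d)) = ?O \<times> UNIV"
    unfolding tangent_chart_overlap by (rule tangent_chart_image[OF c]) auto
  have o: "open (?O \<times> (UNIV::'e set))" by (intro open_Times open_overlap c d open_UNIV)
  have "smooth_on (?O \<times> (UNIV::'e set)) (\<lambda>z. (transition c d (fst z), frechet_derivative (transition c d) (at (fst z)) (snd z)))"
  proof (intro smooth_on_Pair o)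
    have f: "smooth_on (?O \<times> (UNIV::'e set)) fst" by (intro smooth_on_fst smooth_on_id o)
    have s: "smooth_on (?O \<times> (UNIV::'e set)) snd" by (intro smooth_on_snd smooth_on_id o)
    show "smooth_on (?O \<times> (UNIV::'e set)) (\<lambda>z. transition c d (fst z))"
      by (rule smooth_on_compose[OF o open_overlap[OF c d] _ f smooth_on_transition[OF c d]]) auto
    show "smooth_on (?O \<times> (UNIV::'e set)) (\<lambda>z. frechet_derivative (transition c d) (at (fst z)) (snd z))"
      by (rule smooth_on_frechet_comp[OF o open_overlap[OF c d] smooth_on_transition[OF c d] f _ s]) auto
  qed
  then have "smooth_on (?O \<times> (UNIV::'e set)) (snd (tangent_chart A d) \<circ> chart_inv (tangent_chart A c))"
  proof (rule smooth_on_cong[OF o, rotated])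
    fix z assume "z \<in> ?O \<times> (UNIV::'e set)"
    then obtain p e where p: "p \<in> fst c" "p \<in> fst d" "z = (snd c p, e)" by (cases z) auto
    then show "(transition c d (fst z), frechet_derivative (transition c d) (at (fst z)) (snd z)) =
        (snd (tangent_chart A d) \<circ> chart_inv (tangent_chart A c)) z"
      using c d by (simp add: tangent_chart_inv snd_tangent_chart coord_vector_def transition_deriv_def)
  qed
  then show "smooth_transition (tangent_chart A c) (tangent_chart A d)"
    using o unfolding smooth_transition_def img by blast
qed

lemma atlas_tangent: "atlas (tangent_atlas A)"
  by unfold_locales (rule smooth_atlas_tangent_atlas)

lemma tangent_chart_in_atlas: "c \<in> A \<Longrightarrow> tangent_chart A c \<in> tangent_atlas A"
  by (simp add: tangent_atlas_def)

text \<open>In induced coordinates the projection to M is \<open>fst\<close>, followed here by the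
  transition from \<open>c\<close> to \<open>d\<close>.\<close>

lemma tangent_differential_apply:
  assumes "c \<in> A" "d \<in> A" "q \<in> fst (tangent_chart A c)" "fst q \<in> fst d" "w \<in> tangent_space (tangent_atlas A) q"
  shows "differential (tangent_atlas A) A fst q w d = transition_deriv c d (fst q) (fst (w (tangent_chart A c)))"
proof -
  interpret TM: atlas "tangent_atlas A" by (rule atlas_tangent)
  let ?C = "tangent_chart A c"
  have p: "fst q \<in> fst c" using assms(3) by (simp add: fst_tangent_chart)
  have o: "open (snd ?C ` fst ?C)" by (rule TM.open_chart[OF tangent_chart_in_atlas[OF assms(1)]])
  have "(transition c d has_derivative transition_deriv c d (fst q)) (at (fst (snd ?C q)))"
    using transition_has_derivative[OF assms(1,2) p assms(4)] by (simp add: snd_tangent_chart)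
  from has_derivative_compose[OF has_derivative_fst[OF has_derivative_ident] this]
  have "((\<lambda>z. transition c d (fst z)) has_derivative (\<lambda>z. transition_deriv c d (fst q) (fst z))) (at (snd ?C q))" .
  then have "(((snd d \<circ> fst) \<circ> chart_inv ?C) has_derivative (\<lambda>z. transition_deriv c d (fst q) (fst z))) (at (snd ?C q))"
  proof (rule has_derivative_transform_within_open[OF _ o])
    show "snd ?C q \<in> snd ?C ` fst ?C" using assms by blast
    fix z assume "z \<in> snd ?C ` fst ?C"
    then obtain r where r: "fst r \<in> fst c" "z = (snd c (fst r), snd r c)"
      by (auto simp: fst_tangent_chart snd_tangent_chart)
    then show "transition c d (fst z) = ((snd d \<circ> fst) \<circ> chart_inv ?C) z"
      using assms(1) by (simp add: tangent_chart_inv)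
  qed
  from TM.tderiv_chart[OF tangent_chart_in_atlas[OF assms(1)] assms(3,5) this]
  show ?thesis using assms(2,4) by (simp add: differential_def)
qed

text \<open>Verticality concerns the components of the projected vector in all charts of M; these
  are linear images of the base component in \<open>c\<close>, so a single chart decides.\<close>

lemma vertical_iff:
  assumes "c \<in> A" "q \<in> fst (tangent_chart A c)" "w \<in> tangent_space (tangent_atlas A) q"
  shows "w \<in> vertical A q \<longleftrightarrow> fst (w (tangent_chart A c)) = 0"
proof
  have p: "fst q \<in> fst c" using assms(2) by (simp add: fst_tangent_chart)
  assume "w \<in> vertical A q"
  then have "differential (tangent_atlas A) A fst q w = 0" by (simp add: vertical_def)
  then have "differential (tangent_atlas A) A fst q w c = 0" by simp
  then show "fst (w (tangent_chart A c)) = 0"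
    using tangent_differential_apply[OF assms(1,1,2) p assms(3)] transition_deriv_self[OF assms(1) p] by simp
next
  have p: "fst q \<in> fst c" using assms(2) by (simp add: fst_tangent_chart)
  assume 0: "fst (w (tangent_chart A c)) = 0"
  have "differential (tangent_atlas A) A fst q w d = 0" for d
  proof (cases "d \<in> A \<and> fst q \<in> fst d")
    case True
    then show ?thesis
      using tangent_differential_apply[OF assms(1) _ assms(2) _ assms(3), of d] 0
        linear_0[OF linear_transition_deriv[OF assms(1) _ p, of d]] by simp
  next
    case False
    then show ?thesis unfolding differential_def by (simp only: if_False)
  qed
  then show "w \<in> vertical A q" using assms(3) by (auto simp: vertical_def fun_eq_iff)
qed

lemma vertical_subset: "vertical A q \<subseteq> tangent_space (tangent_atlas A) q"
  by (auto simp: vertical_def)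

end

text \<open>A chart inverse is continuous, hence maps compact sets to compact sets, and these are
  closed in a Hausdorff space. This is where the Hausdorff property enters.\<close>

lemma (in atlas) closedin_chart_inv_compact:
  assumes "Hausdorff_space (manifold_topology A)" "c \<in> A" "compact K" "K \<subseteq> snd c ` fst c"
  shows "closedin (manifold_topology A) (chart_inv c ` K)"
proof -
  let ?O = "snd c ` fst c"
  have "continuous_map (subtopology euclidean ?O) (manifold_topology A) (chart_inv c)"
    unfolding continuous_map_def
  proof (intro conjI allI impI)
    have "chart_inv c x \<in> points A" if "x \<in> ?O" for x
      using that assms(2) by (auto simp: points_def)
    then show "chart_inv c \<in> topspace (subtopology euclidean ?O) \<rightarrow> topspace (manifold_topology A)"
      by (simp add: topspace_manifold_topology)
    fix W assume W: "openin (manifold_topology A) W"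
    have "{x \<in> topspace (subtopology euclidean ?O). chart_inv c x \<in> W} = snd c ` (W \<inter> fst c)"
      using assms(2) by auto
    moreover have "open (snd c ` (W \<inter> fst c))" using W assms(2) by (simp add: openin_manifold_topology)
    moreover have "snd c ` (W \<inter> fst c) \<subseteq> ?O" by auto
    ultimately show "openin (subtopology euclidean ?O) {x \<in> topspace (subtopology euclidean ?O). chart_inv c x \<in> W}"
      by (simp add: open_openin_trans open_chart[OF assms(2)] openin_open_eq)
  qed
  moreover have "compactin (subtopology euclidean ?O) K"
    using assms(3,4) by (simp add: compactin_subtopology)
  ultimately have "compactin (manifold_topology A) (chart_inv c ` K)" by (rule image_compactin[rotated])
  then show ?thesis by (rule compactin_imp_closedin[OF assms(1)])
qed

section \<open>Tensor fields act pointwise\<close>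

locale tangent_open = atlas A for A :: "('a, 'e::euclidean_space) chart set" +
  fixes M' :: "('a, 'e) tpoint set"
  assumes hausdorff: "Hausdorff_space (manifold_topology A)"
    and openM: "openin (manifold_topology (tangent_atlas A)) M'"
begin

sublocale TM: atlas "tangent_atlas A"
  by (rule atlas_tangent)

lemma obtain_chart:
  assumes "q \<in> M'"
  obtains c where "c \<in> A" "q \<in> fst (tangent_chart A c)"
  using openM[unfolded TM.openin_manifold_topology] assms by (auto simp: points_def tangent_atlas_def)

lemma zero_vertical: "q \<in> M' \<Longrightarrow> 0 \<in> vertical A q"
proof -
  assume "q \<in> M'"
  then obtain c where c: "c \<in> A" "q \<in> fst (tangent_chart A c)"
    using obtain_chart by blast
  show ?thesis
    by (subst vertical_iff[OF c subspace_0[OF TM.subspace_tangent_space]]) simp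
qed

lemma open_M_chart: "c \<in> A \<Longrightarrow> open (snd (tangent_chart A c) ` (M' \<inter> fst (tangent_chart A c)))"
  using openM[unfolded TM.openin_manifold_topology] tangent_chart_in_atlas by blast

end

text \<open>The closed ball has to lie in the image of \<open>M'\<close>, for it is compact: its
  projection is then closed in M, and the extension by 0 stays smooth beyond the chart.\<close>

locale cutoff = tangent_open A M' for A :: "('a, 'e::euclidean_space) chart set" and M' +
  fixes c z0 and r :: real
  assumes c: "c \<in> A" and r: "r > 0"
    and cball: "cball z0 r \<subseteq> snd (tangent_chart A c) ` (M' \<inter> fst (tangent_chart A c))"
begin

abbreviation "C \<equiv> tangent_chart A c"

lemma C_in: "C \<in> tangent_atlas A"
  by (rule tangent_chart_in_atlas[OF c])

definition cutoff_fun :: "('a, 'e) tpoint \<Rightarrow> real"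
  where "cutoff_fun q = (if q \<in> fst C then bump z0 r (snd C q) else 0)"

definition extend_fun :: "('e \<times> 'e \<Rightarrow> real) \<Rightarrow> ('a, 'e) tpoint \<Rightarrow> real"
  where "extend_fun f q = cutoff_fun q * f (snd C q)"

text \<open>Outside the chart the coordinate vector has coefficient 0, so that the value there is
  the zero vector.\<close>

definition extend_vertical :: "('e \<times> 'e \<Rightarrow> 'e) \<Rightarrow> ('a, 'e) tpoint \<Rightarrow> ('a, 'e) ttvec"
  where "extend_vertical u = (\<lambda>q\<in>M'. cutoff_fun q *\<^sub>R coord_vector (tangent_atlas A) C (0, u (snd C q)) q)"

text \<open>A point of \<open>M'\<close> outside the domain of \<open>C\<close> lies over a point of \<open>M\<close> outside the domain of \<open>c\<close>, so it is
  enough to separate it from the projection of the support, which is compact in \<open>M\<close>.\<close>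

lemma cutoff_fun_vanishes_near:
  assumes "q \<in> M'" "q \<notin> fst C"
  obtains D S where "D \<in> tangent_atlas A" "q \<in> fst D" "open S" "snd D q \<in> S" "S \<subseteq> snd D ` (M' \<inter> fst D)"
    "\<And>x. x \<in> S \<Longrightarrow> cutoff_fun (chart_inv D x) = 0"
proof -
  obtain d where d: "d \<in> A" "q \<in> fst (tangent_chart A d)"
    using obtain_chart[OF assms(1)] by blast
  let ?D = "tangent_chart A d"
  define L where "L = chart_inv c ` (fst ` cball z0 r)"
  have sub: "fst ` cball z0 r \<subseteq> snd c ` fst c"
  proof
    fix x assume "x \<in> fst ` cball z0 r"
    then obtain q where "q \<in> fst C" "x = fst (snd C q)" using cball by auto
    then show "x \<in> snd c ` fst c" by (auto simp: fst_tangent_chart snd_tangent_chart)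
  qed
  have "compact (fst ` cball z0 r)"
    by (intro compact_continuous_image continuous_on_fst continuous_on_id compact_cball)
  then have "closedin (manifold_topology A) L"
    unfolding L_def by (rule closedin_chart_inv_compact[OF hausdorff c _ sub])
  then have V: "openin (manifold_topology A) (points A - L)"
    unfolding closedin_def topspace_manifold_topology by blast
  have L: "L \<subseteq> fst c" using sub c by (auto simp: L_def)
  have D: "?D \<in> tangent_atlas A" by (rule tangent_chart_in_atlas[OF d(1)])
  let ?S = "(snd d ` ((points A - L) \<inter> fst d)) \<times> UNIV \<inter> snd ?D ` (M' \<inter> fst ?D)"
  show thesis
  proof (rule that[OF D d(2)])
    have "open (snd d ` ((points A - L) \<inter> fst d))" using V d(1) unfolding openin_manifold_topology by blast
    then show "open ?S" by (intro open_Int open_Times open_UNIV open_M_chart[OF d(1)])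
    have q: "fst q \<in> fst d" "snd q \<in> tangent_space A (fst q)" using d(2) by (auto simp: fst_tangent_chart)
    then have "fst q \<notin> fst c" using assms(2) by (simp add: fst_tangent_chart)
    then have "fst q \<in> (points A - L) \<inter> fst d" using L q d(1) by (auto simp: points_def)
    then show "snd ?D q \<in> ?S" using assms(1) d(2) by (auto simp: snd_tangent_chart)
    fix x assume x: "x \<in> ?S"
    then obtain p where p: "p \<in> M'" "p \<in> fst ?D" "x = snd ?D p" by blast
    then have inv: "chart_inv ?D x = p" using TM.chart_inv_chart[OF D] by simp
    have "snd d (fst p) \<in> snd d ` ((points A - L) \<inter> fst d)" using x p by (simp add: snd_tangent_chart)
    then have pL: "fst p \<notin> L"
      using chart_image_iff[OF d(1), of "fst p" "(points A - L) \<inter> fst d"] p(2) by (auto simp: fst_tangent_chart)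
    \<comment> \<open>A point of the ball would project into \<open>L\<close>, which the choice of
      the neighbourhood excludes.\<close>
    have "bump z0 r (snd C p) = 0" if "p \<in> fst C"
    proof (rule bump_eq_0[OF r], rule notI)
      assume "snd C p \<in> ball z0 r"
      then have "fst (snd C p) \<in> fst ` cball z0 r" using ball_subset_cball by blast
      then have "chart_inv c (snd c (fst p)) \<in> L" by (simp add: L_def snd_tangent_chart)
      then show False using pL that c by (simp add: fst_tangent_chart)
    qed
    then show "cutoff_fun (chart_inv ?D x) = 0" by (simp add: inv cutoff_fun_def)
  qed blast
qed

lemma smooth_cutoff_chart:
  "smooth_on (snd C ` (M' \<inter> fst C)) (bump z0 r)"
  using smooth_on_bump smooth_on_subset by blast

lemma smooth_extend_fun:
  assumes "smooth_on (snd C ` (M' \<inter> fst C)) f"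
  shows "smooth_function (tangent_atlas A) M' (extend_fun f)"
proof (rule TM.smooth_functionI)
  fix q assume q: "q \<in> M'"
  show "\<exists>D\<in>tangent_atlas A. q \<in> fst D \<and> (\<exists>S. open S \<and> snd D q \<in> S \<and> smooth_on S (extend_fun f \<circ> chart_inv D))"
  proof (cases "q \<in> fst C")
    case True
    let ?S = "snd C ` (M' \<inter> fst C)"
    have "smooth_on ?S (\<lambda>z. bump z0 r z * f z)"
      by (intro smooth_on_mult open_M_chart c smooth_cutoff_chart assms)
    then have "smooth_on ?S (extend_fun f \<circ> chart_inv C)"
    proof (rule smooth_on_cong[OF open_M_chart[OF c], rotated])
      show "bump z0 r z * f z = (extend_fun f \<circ> chart_inv C) z" if "z \<in> ?S" for z
        using that TM.chart_inv_chart[OF C_in] by (auto simp: extend_fun_def cutoff_fun_def)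
    qed
    then show ?thesis
      by (intro bexI[OF _ C_in] conjI exI[of _ ?S] open_M_chart c imageI IntI q True subset_refl)
  next
    case False
    obtain D S where D: "D \<in> tangent_atlas A" "q \<in> fst D" "open S" "snd D q \<in> S"
      "\<And>x. x \<in> S \<Longrightarrow> cutoff_fun (chart_inv D x) = 0"
      using cutoff_fun_vanishes_near[OF q False] by metis
    have "smooth_on S (extend_fun f \<circ> chart_inv D)"
      by (rule smooth_on_cong[OF D(3) _ smooth_on_const[OF D(3), of 0]]) (simp add: extend_fun_def D(5))
    then show ?thesis
      by (intro bexI[OF _ D(1)] conjI exI[of _ S] D)
  qed
qed

lemma extend_vertical_chart:
  assumes "q \<in> M'" "q \<in> fst C"
  shows "extend_vertical u q C = (0, bump z0 r (snd C q) *\<^sub>R u (snd C q))"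
  using assms TM.coord_vector_apply[OF C_in assms(2)]
  by (simp add: extend_vertical_def cutoff_fun_def scaleR_fun_def)

lemma extend_vertical_section:
  assumes "smooth_on (snd C ` (M' \<inter> fst C)) u"
  shows "extend_vertical u \<in> sections (tangent_atlas A) M' (vertical A)"
proof (rule TM.sectionsI)
  show "extend_vertical u \<in> extensional M'" by (simp add: extend_vertical_def)
  fix q assume q: "q \<in> M'"
  show tan: "extend_vertical u q \<in> tangent_space (tangent_atlas A) q"
  proof (cases "q \<in> fst C")
    case True
    then show ?thesis
      using q subspace_scale[OF TM.subspace_tangent_space TM.coord_vector_tangent[OF C_in True]]
      by (simp add: extend_vertical_def)
  next
    case False
    then show ?thesis using q subspace_0[OF TM.subspace_tangent_space]
      by (simp add: extend_vertical_def cutoff_fun_def)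
  qed
  show "extend_vertical u q \<in> vertical A q"
  proof (cases "q \<in> fst C")
    case True
    then show ?thesis using vertical_iff[OF c True tan] extend_vertical_chart[OF q True] by simp
  next
    case False
    then show ?thesis using q zero_vertical[OF q] by (simp add: extend_vertical_def cutoff_fun_def)
  qed
  show "\<exists>D\<in>tangent_atlas A. q \<in> fst D \<and> (\<exists>S. open S \<and> snd D q \<in> S \<and> S \<subseteq> snd D ` (M' \<inter> fst D) \<and>
      smooth_on S (\<lambda>x. extend_vertical u (chart_inv D x) D))"
  proof (cases "q \<in> fst C")
    case True
    let ?S = "snd C ` (M' \<inter> fst C)"
    have "smooth_on ?S (\<lambda>z. (0::'e, bump z0 r z *\<^sub>R u z))"
      by (intro smooth_on_Pair smooth_on_const smooth_on_scaleR open_M_chart c smooth_cutoff_chart assms)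
    then have "smooth_on ?S (\<lambda>x. extend_vertical u (chart_inv C x) C)"
    proof (rule smooth_on_cong[OF open_M_chart[OF c], rotated])
      show "(0, bump z0 r z *\<^sub>R u z) = extend_vertical u (chart_inv C z) C" if "z \<in> ?S" for z
        using that TM.chart_inv_chart[OF C_in] extend_vertical_chart by auto
    qed
    then show ?thesis
      by (intro bexI[OF _ C_in] conjI exI[of _ ?S] open_M_chart c imageI IntI q True subset_refl)
  next
    case False
    obtain D S where D: "D \<in> tangent_atlas A" "q \<in> fst D" "open S" "snd D q \<in> S" "S \<subseteq> snd D ` (M' \<inter> fst D)"
      "\<And>x. x \<in> S \<Longrightarrow> cutoff_fun (chart_inv D x) = 0"
      using cutoff_fun_vanishes_near[OF q False] by metis
    have "smooth_on S (\<lambda>x. extend_vertical u (chart_inv D x) D)"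
    proof (rule smooth_on_cong[OF D(3) _ smooth_on_const[OF D(3), of 0]])
      fix x assume x: "x \<in> S"
      then have "chart_inv D x \<in> M'" using D(1,5) TM.chart_inv_chart by fastforce
      then show "0 = extend_vertical u (chart_inv D x) D" using D(6)[OF x] by (simp add: extend_vertical_def)
    qed
    then show ?thesis
      by (intro bexI[OF _ D(1)] conjI exI[of _ S] D)
  qed
qed

end

section \<open>Sums and multiples of sections\<close>

context atlas
begin

lemma open_chart_image: "openin (manifold_topology A) W \<Longrightarrow> c \<in> A \<Longrightarrow> open (snd c ` (W \<inter> fst c))"
  by (simp add: openin_manifold_topology)

lemma sections_add:
  assumes "openin (manifold_topology A) W" "X \<in> sections A W V" "Y \<in> sections A W V"
    and "\<And>p. p \<in> W \<Longrightarrow> subspace (V p)"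
  shows "sec_add W X Y \<in> sections A W V"
  unfolding sections_def
proof (intro CollectI conjI ballI)
  show "sec_add W X Y \<in> extensional W" by (simp add: sec_add_def)
  show "sec_add W X Y p \<in> V p" if "p \<in> W" for p
    using that sections_in[OF assms(2)] sections_in[OF assms(3)] subspace_add[OF assms(4)] by (simp add: sec_add_def)
  fix c assume c: "c \<in> A"
  note o = open_chart_image[OF assms(1) c]
  show "smooth_on (snd c ` (W \<inter> fst c)) (\<lambda>x. sec_add W X Y (chart_inv c x) c)"
    by (rule smooth_on_cong[OF o _ smooth_on_add[OF o sections_smooth[OF assms(2) c] sections_smooth[OF assms(3) c]]])
      (use c in \<open>auto simp: sec_add_def\<close>)
qed

lemma sections_scale:
  assumes "openin (manifold_topology A) W" "X \<in> sections A W V" "smooth_function A W f"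
    and "\<And>p. p \<in> W \<Longrightarrow> subspace (V p)"
  shows "sec_scale W f X \<in> sections A W V"
  unfolding sections_def
proof (intro CollectI conjI ballI)
  show "sec_scale W f X \<in> extensional W" by (simp add: sec_scale_def)
  show "sec_scale W f X p \<in> V p" if "p \<in> W" for p
    using that sections_in[OF assms(2)] subspace_scale[OF assms(4)] by (simp add: sec_scale_def)
  fix c assume c: "c \<in> A"
  note o = open_chart_image[OF assms(1) c]
  have f: "smooth_on (snd c ` (W \<inter> fst c)) (f \<circ> chart_inv c)" using assms(3) c by (simp add: smooth_function_def)
  show "smooth_on (snd c ` (W \<inter> fst c)) (\<lambda>x. sec_scale W f X (chart_inv c x) c)"
    by (rule smooth_on_cong[OF o _ smooth_on_scaleR[OF o f sections_smooth[OF assms(2) c]]])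
      (use c in \<open>auto simp: sec_scale_def scaleR_fun_def\<close>)
qed

lemma smooth_function_const: "openin (manifold_topology A) W \<Longrightarrow> smooth_function A W (\<lambda>p. k)"
  unfolding smooth_function_def o_def by (intro ballI smooth_on_const open_chart_image)

end

context tangent_open
begin

lemma subspace_vertical:
  assumes "q \<in> M'"
  shows "subspace (vertical A q)"
proof -
  obtain c where c: "c \<in> A" "q \<in> fst (tangent_chart A c)"
    using obtain_chart[OF assms] by blast
  note T = TM.subspace_tangent_space[of q]
  show ?thesis
    unfolding subspace_def
  proof (intro conjI ballI allI)
    show "0 \<in> vertical A q" by (rule zero_vertical[OF assms])
    fix u w k assume u: "u \<in> vertical A q"
    note ut = subsetD[OF vertical_subset u]
    show "k *\<^sub>R u \<in> vertical A q"
      unfolding vertical_iff[OF c subspace_scale[OF T ut]]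
      using u[unfolded vertical_iff[OF c ut]] by (simp add: scaleR_fun_def)
    assume w: "w \<in> vertical A q"
    note wt = subsetD[OF vertical_subset w]
    show "u + w \<in> vertical A q"
      unfolding vertical_iff[OF c subspace_add[OF T ut wt]]
      using u[unfolded vertical_iff[OF c ut]] w[unfolded vertical_iff[OF c wt]] by simp
  qed
qed

lemma obtain_cutoff:
  assumes "c \<in> A" "q \<in> M'" "q \<in> fst (tangent_chart A c)"
  obtains r where "cutoff A M' c (snd (tangent_chart A c) q) r"
proof -
  obtain r where "r > 0" "cball (snd (tangent_chart A c) q) r \<subseteq> snd (tangent_chart A c) ` (M' \<inter> fst (tangent_chart A c))"
    using open_M_chart[OF assms(1)] assms(2,3) open_contains_cball by (metis IntI imageI)
  then have "cutoff A M' c (snd (tangent_chart A c) q) r"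
    by unfold_locales (use assms in auto)
  then show thesis by (rule that)
qed

end

locale skew_tensor = tangent_open A M' for A :: "('a, 'e::euclidean_space) chart set" and M' +
  fixes S
  assumes skew_finsler: "skew_finsler_tensor A M' S"
begin

abbreviation "\<Gamma> \<equiv> sections (tangent_atlas A) M' (vertical A)"

lemma S_in: "X \<in> \<Gamma> \<Longrightarrow> Y \<in> \<Gamma> \<Longrightarrow> S X Y \<in> \<Gamma>"
  and S_add: "X \<in> \<Gamma> \<Longrightarrow> X' \<in> \<Gamma> \<Longrightarrow> Y \<in> \<Gamma> \<Longrightarrow> S (sec_add M' X X') Y = sec_add M' (S X Y) (S X' Y)"
  and S_scale: "X \<in> \<Gamma> \<Longrightarrow> Y \<in> \<Gamma> \<Longrightarrow> smooth_function (tangent_atlas A) M' f \<Longrightarrow>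
    S (sec_scale M' f X) Y = sec_scale M' f (S X Y)"
  and S_skew: "X \<in> \<Gamma> \<Longrightarrow> Y \<in> \<Gamma> \<Longrightarrow> S X Y = sec_scale M' (\<lambda>p. -1) (S Y X)"
  using skew_finsler unfolding skew_finsler_tensor_def Let_def by blast+

lemma S_skew_at: "X \<in> \<Gamma> \<Longrightarrow> Y \<in> \<Gamma> \<Longrightarrow> q \<in> M' \<Longrightarrow> S X Y q = - S Y X q"
  by (subst S_skew) (simp_all add: sec_scale_def)

lemma \<Gamma>_add: "X \<in> \<Gamma> \<Longrightarrow> Y \<in> \<Gamma> \<Longrightarrow> sec_add M' X Y \<in> \<Gamma>"
  by (intro TM.sections_add openM subspace_vertical)

lemma \<Gamma>_scale: "X \<in> \<Gamma> \<Longrightarrow> smooth_function (tangent_atlas A) M' f \<Longrightarrow> sec_scale M' f X \<in> \<Gamma>"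
  by (intro TM.sections_scale openM subspace_vertical)

text \<open>Starting the induction with a single term keeps the zero section out of the argument.
  Membership in \<open>\<Gamma>\<close> is carried along because \<open>S_add\<close> demands
  it.\<close>

lemma S_linear_combination:
  assumes "finite I" "I \<noteq> {}" "\<And>i. i \<in> I \<Longrightarrow> smooth_function (tangent_atlas A) M' (f i)" "\<And>i. i \<in> I \<Longrightarrow> E i \<in> \<Gamma>" "Y \<in> \<Gamma>"
  shows "(\<lambda>q\<in>M'. \<Sum>i\<in>I. f i q *\<^sub>R E i q) \<in> \<Gamma> \<and>
    S (\<lambda>q\<in>M'. \<Sum>i\<in>I. f i q *\<^sub>R E i q) Y = (\<lambda>q\<in>M'. \<Sum>i\<in>I. f i q *\<^sub>R S (E i) Y q)"
  using assms(1-4)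
proof (induction I rule: finite_ne_induct)
  case (singleton i)
  have "(\<lambda>q\<in>M'. \<Sum>i\<in>{i}. f i q *\<^sub>R E i q) = sec_scale M' (f i) (E i)"
    "(\<lambda>q\<in>M'. \<Sum>i\<in>{i}. f i q *\<^sub>R S (E i) Y q) = sec_scale M' (f i) (S (E i) Y)"
    by (simp_all add: sec_scale_def)
  then show ?case using \<Gamma>_scale S_scale singleton assms(5) by simp
next
  case (insert i I)
  let ?X = "\<lambda>q\<in>M'. \<Sum>i\<in>I. f i q *\<^sub>R E i q"
  have eq: "(\<lambda>q\<in>M'. \<Sum>i\<in>insert i I. f i q *\<^sub>R E i q) = sec_add M' (sec_scale M' (f i) (E i)) ?X"
    using insert(1,3) by (auto simp: sec_scale_def sec_add_def restrict_def)
  have X: "?X \<in> \<Gamma>" "S ?X Y = (\<lambda>q\<in>M'. \<Sum>i\<in>I. f i q *\<^sub>R S (E i) Y q)"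
    using insert.IH[OF insert.prems] by blast+
  have E: "sec_scale M' (f i) (E i) \<in> \<Gamma>" using \<Gamma>_scale insert.prems by simp
  have i: "S (sec_scale M' (f i) (E i)) Y = sec_scale M' (f i) (S (E i) Y)"
    using S_scale insert.prems assms(5) by simp
  show ?case
    unfolding eq
  proof (rule conjI[OF \<Gamma>_add[OF E X(1)]], rule ext)
    show "S (sec_add M' (sec_scale M' (f i) (E i)) ?X) Y q = (\<lambda>q\<in>M'. \<Sum>i\<in>insert i I. f i q *\<^sub>R S (E i) Y q) q" for q
      unfolding S_add[OF E X(1) assms(5)] X(2) i
      using insert(1,3) by (cases "q \<in> M'") (simp_all add: sec_scale_def sec_add_def)
  qed
qed

text \<open>The square of the cutoff function makes both the coefficients and the frame fields of \<open>X\<close> global,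
  so that no function that is constant near a point is needed.\<close>

lemma bump_mult_S:
  assumes "cutoff A M' c z0 r" "X \<in> \<Gamma>" "Y \<in> \<Gamma>" "q \<in> M'" "q \<in> fst (tangent_chart A c)"
  defines "C \<equiv> tangent_chart A c"
  shows "(bump z0 r (snd C q) * bump z0 r (snd C q)) *\<^sub>R S X Y q =
    (\<Sum>i\<in>Basis. (bump z0 r (snd C q) * (snd (X q C) \<bullet> i)) *\<^sub>R S (cutoff.extend_vertical A M' c z0 r (\<lambda>z. i)) Y q)"
proof -
  interpret cutoff A M' c z0 r by (rule assms(1))
  let ?f = "\<lambda>i. extend_fun (\<lambda>z. snd (X (chart_inv C z) C) \<bullet> i)" and ?E = "\<lambda>i. extend_vertical (\<lambda>z. i)"
  let ?\<psi> = "extend_fun (bump z0 r)"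
  note o = open_M_chart[OF c]
  have Cdef: "tangent_chart A c = C" by (simp add: C_def)
  note C = C_in[unfolded Cdef]
  have f: "smooth_function (tangent_atlas A) M' (?f i)" for i
    by (intro smooth_extend_fun smooth_on_inner smooth_on_snd smooth_on_const o TM.sections_smooth[OF assms(2)])
      (use TM.sections_smooth[OF assms(2) C] in \<open>simp add: Cdef\<close>)
  have \<psi>: "smooth_function (tangent_atlas A) M' ?\<psi>"
    by (rule smooth_extend_fun[OF smooth_cutoff_chart])
  have E: "?E i \<in> \<Gamma>" for i
    by (rule extend_vertical_section[OF smooth_on_const[OF o]])
  have eq: "sec_scale M' ?\<psi> X = (\<lambda>q\<in>M'. \<Sum>i\<in>Basis. ?f i q *\<^sub>R ?E i q)"
  proof
    fix p
    show "sec_scale M' ?\<psi> X p = (\<lambda>q\<in>M'. \<Sum>i\<in>Basis. ?f i q *\<^sub>R ?E i q) p"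
    proof (cases "p \<in> M' \<and> p \<in> fst C")
      case True
      let ?\<beta> = "bump z0 r (snd C p)"
      have "X p \<in> vertical A p" using TM.sections_in[OF assms(2)] True by blast
      then have Xp: "X p \<in> tangent_space (tangent_atlas A) p" "X p \<in> vertical A p"
        using vertical_subset by blast+
      have "fst (X p C) = 0"
        using vertical_iff[OF c _ Xp(1)] True Xp(2) unfolding Cdef by blast
      then have X0: "X p C = (0, snd (X p C))" by (simp add: prod_eq_iff)
      have comp: "(\<Sum>i\<in>Basis. ?f i p *\<^sub>R ?E i p) C = (\<Sum>i\<in>Basis. ?f i p *\<^sub>R ?E i p C)"
        by (induction rule: infinite_finite_induct) (auto simp: scaleR_fun_def)
      have "?f i p *\<^sub>R ?E i p C = (0, (?\<beta> * ?\<beta>) *\<^sub>R ((snd (X p C) \<bullet> i) *\<^sub>R i))" for i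
        using True extend_vertical_chart[of p "\<lambda>z. i", unfolded Cdef] TM.chart_inv_chart[OF C]
        by (simp add: extend_fun_def cutoff_fun_def Cdef)
      then have "(\<Sum>i\<in>Basis. ?f i p *\<^sub>R ?E i p) C = (\<Sum>i\<in>Basis. (0, (?\<beta> * ?\<beta>) *\<^sub>R ((snd (X p C) \<bullet> i) *\<^sub>R i)))"
        unfolding comp by simp
      also have "\<dots> = (0, (?\<beta> * ?\<beta>) *\<^sub>R snd (X p C))"
        using euclidean_representation[of "(?\<beta> * ?\<beta>) *\<^sub>R snd (X p C)"] by (simp add: sum_prod)
      also have "\<dots> = (?\<beta> * ?\<beta>) *\<^sub>R X p C" by (subst X0) simp
      also have "\<dots> = (?\<psi> p *\<^sub>R X p) C"
        using True by (simp add: extend_fun_def cutoff_fun_def Cdef scaleR_fun_def)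
      finally have "(?\<psi> p *\<^sub>R X p) C = (\<Sum>i\<in>Basis. ?f i p *\<^sub>R ?E i p) C" by simp
      moreover have "?\<psi> p *\<^sub>R X p \<in> tangent_space (tangent_atlas A) p"
        by (rule subspace_scale[OF TM.subspace_tangent_space Xp(1)])
      moreover have "(\<Sum>i\<in>Basis. ?f i p *\<^sub>R ?E i p) \<in> tangent_space (tangent_atlas A) p"
        using True vertical_subset TM.sections_in[OF E]
        by (intro subspace_sum subspace_scale TM.subspace_tangent_space) blast
      ultimately have "?\<psi> p *\<^sub>R X p = (\<Sum>i\<in>Basis. ?f i p *\<^sub>R ?E i p)"
        using TM.tangent_space_eqI[OF _ _ C] True by blast
      then show ?thesis using True by (simp add: sec_scale_def)
    next
      case False
      then show ?thesis by (auto simp: sec_scale_def extend_fun_def cutoff_fun_def Cdef)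
    qed
  qed
  have "sec_scale M' ?\<psi> (S X Y) = S (sec_scale M' ?\<psi> X) Y"
    by (rule S_scale[OF assms(2,3) \<psi>, symmetric])
  also have "\<dots> = (\<lambda>q\<in>M'. \<Sum>i\<in>Basis. ?f i q *\<^sub>R S (?E i) Y q)"
    unfolding eq by (rule conjunct2[OF S_linear_combination[OF finite_Basis nonempty_Basis f E assms(3)]])
  finally have "sec_scale M' ?\<psi> (S X Y) q = (\<Sum>i\<in>Basis. ?f i q *\<^sub>R S (?E i) Y q)"
    using assms(4) by simp
  then show ?thesis
    using assms(4,5) TM.chart_inv_chart[OF C] by (simp add: sec_scale_def extend_fun_def cutoff_fun_def Cdef)
qed

text \<open>The right-hand side of \<open>bump_mult_S\<close> sees \<open>X\<close> only through its
  value at q, and the bump is positive there. This settles the first argument; skew symmetry carries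
  it over to the second.\<close>

lemma S_value_determined:
  assumes "X \<in> \<Gamma>" "Y \<in> \<Gamma>" "X' \<in> \<Gamma>" "Y' \<in> \<Gamma>" "q \<in> M'" "X q = X' q" "Y q = Y' q"
  shows "S X Y q = S X' Y' q"
proof -
  obtain c where c: "c \<in> A" "q \<in> fst (tangent_chart A c)"
    using obtain_chart[OF assms(5)] by blast
  obtain r where cut: "cutoff A M' c (snd (tangent_chart A c) q) r" using obtain_cutoff[OF c(1) assms(5) c(2)] .
  have "r > 0" using cut by (simp add: cutoff_def cutoff_axioms_def)
  then have pos: "bump (snd (tangent_chart A c) q) r (snd (tangent_chart A c) q) > 0"
    by (simp add: bump_pos_iff)
  have *: "S Z W q = S Z' W q" if "Z \<in> \<Gamma>" "Z' \<in> \<Gamma>" "W \<in> \<Gamma>" "Z q = Z' q" for Z Z' W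
  proof -
    let ?\<beta> = "bump (snd (tangent_chart A c) q) r (snd (tangent_chart A c) q)"
    have "(?\<beta> * ?\<beta>) *\<^sub>R S Z W q = (?\<beta> * ?\<beta>) *\<^sub>R S Z' W q"
      unfolding bump_mult_S[OF cut that(1,3) assms(5) c(2)] bump_mult_S[OF cut that(2,3) assms(5) c(2)]
      by (simp only: that(4))
    then show ?thesis using pos by simp
  qed
  have "S X Y q = S X' Y q" using * assms by blast
  also have "\<dots> = - S Y X' q" by (rule S_skew_at[OF assms(3,2,5)])
  also have "S Y X' q = S Y' X' q" using * assms by blast
  also have "- S Y' X' q = S X' Y' q" by (rule S_skew_at[OF assms(3,4,5), symmetric])
  finally show ?thesis .
qed

text \<open>Determination by values at q is exactly the uniqueness that the \<open>THE\<close> in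
  \<open>tensor_at\<close> asks for.\<close>

lemma tensor_at_eq:
  assumes "X \<in> \<Gamma>" "Y \<in> \<Gamma>" "q \<in> M'"
  shows "tensor_at A M' S q (X q) (Y q) = S X Y q"
  unfolding tensor_at_def
proof (rule the_equality)
  show "\<forall>X'\<in>\<Gamma>. \<forall>Y'\<in>\<Gamma>. X' q = X q \<and> Y' q = Y q \<longrightarrow> S X' Y' q = S X Y q"
    using S_value_determined assms by blast
  show "z = S X Y q" if "\<forall>X'\<in>\<Gamma>. \<forall>Y'\<in>\<Gamma>. X' q = X q \<and> Y' q = Y q \<longrightarrow> S X' Y' q = z" for z
    using that assms by blast
qed

text \<open>Every pair of vertical vectors must be attained by global sections; otherwise the
  condition in \<open>tensor_at\<close> would be vacuous and its value unspecified.\<close>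

lemma obtain_vertical_section:
  assumes "q \<in> M'" "u \<in> vertical A q"
  obtains X where "X \<in> \<Gamma>" "X q = u"
proof -
  obtain c where cq: "c \<in> A" "q \<in> fst (tangent_chart A c)"
    using obtain_chart[OF assms(1)] by blast
  obtain r where cut: "cutoff A M' c (snd (tangent_chart A c) q) r" using obtain_cutoff[OF cq(1) assms(1) cq(2)] .
  interpret cutoff A M' c "snd (tangent_chart A c) q" r by (rule cut)
  let ?\<beta> = "bump (snd C q) r (snd C q)"
  have pos: "?\<beta> > 0" using r by (simp add: bump_pos_iff)
  \<comment> \<open>Dividing by the value of the bump at q compensates the cutoff there.\<close>
  let ?X = "extend_vertical (\<lambda>z. (1 / ?\<beta>) *\<^sub>R snd (u C))"
  have X: "?X \<in> \<Gamma>" by (rule extend_vertical_section[OF smooth_on_const[OF open_M_chart[OF cq(1)]]])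
  have ut: "u \<in> tangent_space (tangent_atlas A) q" using vertical_subset assms(2) by blast
  have "u C = (0, snd (u C))" using vertical_iff[OF cq ut] assms(2) by (simp add: prod_eq_iff)
  then have "?X q C = u C"
    using extend_vertical_chart[OF assms(1) cq(2)] pos by simp
  moreover have "?X q \<in> tangent_space (tangent_atlas A) q"
    using TM.sections_in[OF X assms(1)] vertical_subset by blast
  ultimately have "?X q = u" using TM.tangent_space_eqI[OF _ ut C_in cq(2)] by blast
  with X show thesis by (rule that)
qed

lemma tensor_at_vertical:
  assumes "q \<in> M'" "u \<in> vertical A q" "w \<in> vertical A q"
  shows "tensor_at A M' S q u w \<in> vertical A q"
proof -
  obtain X Y where "X \<in> \<Gamma>" "X q = u" "Y \<in> \<Gamma>" "Y q = w" using obtain_vertical_section assms by metis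
  then show ?thesis using tensor_at_eq[of X Y q] TM.sections_in[OF S_in] assms(1) by metis
qed

lemma tensor_at_skew:
  assumes "q \<in> M'" "u \<in> vertical A q" "w \<in> vertical A q"
  shows "tensor_at A M' S q u w = - tensor_at A M' S q w u"
proof -
  obtain X Y where "X \<in> \<Gamma>" "X q = u" "Y \<in> \<Gamma>" "Y q = w" using obtain_vertical_section assms by metis
  then show ?thesis using tensor_at_eq[of X Y q] tensor_at_eq[of Y X q] S_skew_at[of X Y q] assms(1) by metis
qed

lemma tensor_at_linear_left:
  assumes "q \<in> M'" "u \<in> vertical A q" "u' \<in> vertical A q" "w \<in> vertical A q"
  shows "tensor_at A M' S q (a *\<^sub>R u + b *\<^sub>R u') w = a *\<^sub>R tensor_at A M' S q u w + b *\<^sub>R tensor_at A M' S q u' w"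
proof -
  obtain X X' Y where X: "X \<in> \<Gamma>" "X q = u" "X' \<in> \<Gamma>" "X' q = u'" "Y \<in> \<Gamma>" "Y q = w"
    using obtain_vertical_section assms by metis
  note const = TM.smooth_function_const[OF openM]
  let ?Z = "sec_add M' (sec_scale M' (\<lambda>p. a) X) (sec_scale M' (\<lambda>p. b) X')"
  have Z: "sec_scale M' (\<lambda>p. a) X \<in> \<Gamma>" "sec_scale M' (\<lambda>p. b) X' \<in> \<Gamma>"
    using \<Gamma>_scale X const by blast+
  have "?Z q = a *\<^sub>R u + b *\<^sub>R u'" using X assms(1) by (simp add: sec_add_def sec_scale_def)
  then have "tensor_at A M' S q (a *\<^sub>R u + b *\<^sub>R u') w = S ?Z Y q"
    using tensor_at_eq[OF \<Gamma>_add[OF Z] X(5) assms(1)] X(6) by simp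
  also have "\<dots> = a *\<^sub>R S X Y q + b *\<^sub>R S X' Y q"
    unfolding S_add[OF Z X(5)] S_scale[OF X(1,5) const] S_scale[OF X(3,5) const]
    using assms(1) by (simp add: sec_add_def sec_scale_def)
  also have "\<dots> = a *\<^sub>R tensor_at A M' S q u w + b *\<^sub>R tensor_at A M' S q u' w"
    using tensor_at_eq[OF X(1,5) assms(1)] tensor_at_eq[OF X(3,5) assms(1)] X by simp
  finally show ?thesis .
qed

lemma tensor_at_linear_right:
  assumes "q \<in> M'" "u \<in> vertical A q" "u' \<in> vertical A q" "w \<in> vertical A q"
  shows "tensor_at A M' S q w (a *\<^sub>R u + b *\<^sub>R u') = a *\<^sub>R tensor_at A M' S q w u + b *\<^sub>R tensor_at A M' S q w u'"
proof -
  have "a *\<^sub>R u + b *\<^sub>R u' \<in> vertical A q"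
    using subspace_vertical[OF assms(1)] assms by (intro subspace_add subspace_scale) auto
  then have "tensor_at A M' S q w (a *\<^sub>R u + b *\<^sub>R u') = - tensor_at A M' S q (a *\<^sub>R u + b *\<^sub>R u') w"
    using tensor_at_skew assms by blast
  then show ?thesis
    using tensor_at_linear_left[OF assms] tensor_at_skew[OF assms(1,2,4)] tensor_at_skew[OF assms(1,3,4)] by simp
qed

text \<open>On a ball the coordinate fields are cut-off global sections divided by the bump. Hence
  the tensor on them is S of two global sections, which is smooth, divided by the square of the
  bump.\<close>

lemma smooth_tensor_at:
  assumes c: "c \<in> A"
  defines "C \<equiv> tangent_chart A c"
  shows "smooth_on (snd C ` (M' \<inter> fst C)) (\<lambda>z. tensor_at A M' S (chart_inv C z)
    (coord_vector (tangent_atlas A) C (0, a) (chart_inv C z))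
    (coord_vector (tangent_atlas A) C (0, b) (chart_inv C z)) C)"
proof (rule smooth_on_local)
  fix z0 assume "z0 \<in> snd C ` (M' \<inter> fst C)"
  then obtain p where p: "p \<in> M'" "p \<in> fst C" "z0 = snd C p" by auto
  obtain r where "cutoff A M' c z0 r"
    using obtain_cutoff[OF c p(1)] p(2,3) unfolding C_def by blast
  then interpret cutoff A M' c z0 r .
  have Cdef: "tangent_chart A c = C" by (simp add: C_def)
  note C = C_in[unfolded Cdef]
  let ?O = "ball z0 r" and ?E = "\<lambda>a. extend_vertical (\<lambda>z. a)"
  let ?v = "\<lambda>a q. coord_vector (tangent_atlas A) C (0, a) q"
  have sub: "?O \<subseteq> snd C ` (M' \<inter> fst C)" using cball ball_subset_cball unfolding Cdef by blast
  have E: "?E a \<in> \<Gamma>" for a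
    by (rule extend_vertical_section[OF smooth_on_const[OF open_M_chart[OF c]]])
  have "smooth_on ?O (\<lambda>z. (1 / (bump z0 r z * bump z0 r z)) *\<^sub>R S (?E a) (?E b) (chart_inv C z) C)"
  proof (intro smooth_on_scaleR smooth_on_divide smooth_on_const smooth_on_mult open_ball)
    show "smooth_on ?O (bump z0 r)" "smooth_on ?O (bump z0 r)" using smooth_on_bump smooth_on_subset by blast+
    show "bump z0 r z * bump z0 r z \<noteq> 0" if "z \<in> ?O" for z
      using that bump_pos_iff[OF r, of z0 z] by auto
    show "smooth_on ?O (\<lambda>z. S (?E a) (?E b) (chart_inv C z) C)"
      by (rule smooth_on_subset[OF TM.sections_smooth[OF S_in[OF E E] C] sub])
  qed
  then have "smooth_on ?O (\<lambda>z. tensor_at A M' S (chart_inv C z) (?v a (chart_inv C z)) (?v b (chart_inv C z)) C)"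
  proof (rule smooth_on_cong[OF open_ball, rotated])
    fix z assume z: "z \<in> ?O"
    then obtain q where q: "q \<in> M'" "q \<in> fst C" "z = snd C q" using sub by blast
    have inv: "chart_inv C z = q" using q TM.chart_inv_chart[OF C] by simp
    have v: "?v a q \<in> tangent_space (tangent_atlas A) q" for a
      by (rule TM.coord_vector_tangent[OF C q(2)])
    have vv: "?v a q \<in> vertical A q" for a
      using vertical_iff[OF c _ v] q(2) TM.coord_vector_apply[OF C q(2)] unfolding Cdef by simp
    let ?\<beta> = "bump z0 r z"
    have Eq: "?E a q = ?\<beta> *\<^sub>R ?v a q" for a
      using q by (simp add: extend_vertical_def cutoff_fun_def Cdef)
    \<comment> \<open>The summands with coefficient 0 bring the arguments into the two-term shape of
      the linearity lemmas.\<close>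
    have "S (?E a) (?E b) q = tensor_at A M' S q (?\<beta> *\<^sub>R ?v a q + 0 *\<^sub>R ?v a q) (?\<beta> *\<^sub>R ?v b q + 0 *\<^sub>R ?v b q)"
      using tensor_at_eq[OF E E q(1), of a b] Eq by simp
    also have "\<dots> = (?\<beta> * ?\<beta>) *\<^sub>R tensor_at A M' S q (?v a q) (?v b q)"
      by (subst tensor_at_linear_left[OF q(1) vv vv], use subspace_vertical[OF q(1)] vv in \<open>simp add: subspace_scale\<close>)
        (subst tensor_at_linear_right[OF q(1) vv vv vv], simp)
    finally have "S (?E a) (?E b) q C = (?\<beta> * ?\<beta>) *\<^sub>R tensor_at A M' S q (?v a q) (?v b q) C"
      by (simp add: scaleR_fun_def)
    then show "(1 / (?\<beta> * ?\<beta>)) *\<^sub>R S (?E a) (?E b) (chart_inv C z) C =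
        tensor_at A M' S (chart_inv C z) (?v a (chart_inv C z)) (?v b (chart_inv C z)) C"
      unfolding inv using z bump_pos_iff[OF r, of z0 z] by simp
  qed
  then show "\<exists>O'. open O' \<and> z0 \<in> O' \<and> smooth_on O' (\<lambda>z. tensor_at A M' S (chart_inv C z)
      (?v a (chart_inv C z)) (?v b (chart_inv C z)) C)"
    using r by (intro exI[of _ ?O]) simp
qed

end

section \<open>Nondegenerate symmetric matrices\<close>

lemma symmetric_matrix_inner:
  fixes G :: "real^'m^'m"
  assumes "transpose G = G"
  shows "(G *v v) \<bullet> w = v \<bullet> (G *v w)"
  using dot_lmul_matrix[of v G w] assms by (metis transpose_matrix_vector)

text \<open>Eigenspaces of a symmetric matrix for distinct eigenvalues are orthogonal, so
  orthonormal bases of them unite to an independent set.\<close>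

lemma sum_dim_eigenspaces_le:
  fixes G :: "real^'m^'m"
  assumes "transpose G = G" "finite L"
  shows "(\<Sum>l\<in>L. dim {v. G *v v = l *\<^sub>R v}) \<le> CARD('m)"
proof -
  let ?V = "\<lambda>l. {v. G *v v = l *\<^sub>R v}"
  have sub: "subspace (?V l)" for l
    by (auto simp: subspace_def matrix_vector_right_distrib scaleR_add_right matrix_vector_mult_scaleR)
  have orth: "orthogonal v w" if "v \<in> ?V l" "w \<in> ?V k" "l \<noteq> k" for v w l k
  proof -
    have "l * (v \<bullet> w) = k * (v \<bullet> w)"
      using symmetric_matrix_inner[OF assms(1), of v w] that(1,2) by simp
    then show ?thesis using that(3) by (simp add: orthogonal_def)
  qed
  let ?P = "\<lambda>l B. B \<subseteq> ?V l \<and> pairwise orthogonal B \<and> (\<forall>x\<in>B. norm x = 1) \<and> finite B \<and> card B = dim (?V l)"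
  have "\<forall>l. \<exists>B. ?P l B"
  proof
    fix l
    obtain B where B: "B \<subseteq> ?V l" "pairwise orthogonal B" "\<And>x. x \<in> B \<Longrightarrow> norm x = 1" "independent B"
      "card B = dim (?V l)" "span B = ?V l"
      by (rule orthonormal_basis_subspace[OF sub[of l]], rule that)
    then have "?P l B" using independent_imp_finite by blast
    then show "\<exists>B. ?P l B" by (rule exI)
  qed
  from choice[OF this] obtain B where "\<forall>l. ?P l (B l)" ..
  then have P: "?P l (B l)" for l by (rule spec)
  note B = P[THEN conjunct1] P[THEN conjunct2, THEN conjunct1] P[THEN conjunct2, THEN conjunct2, THEN conjunct1, THEN bspec]
    P[THEN conjunct2, THEN conjunct2, THEN conjunct2, THEN conjunct1] P[THEN conjunct2, THEN conjunct2, THEN conjunct2, THEN conjunct2]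
  have z: "x \<noteq> 0" if "x \<in> B l" for x l using B(3)[OF that] by auto
  have o2: "orthogonal v w" if "v \<in> B l" "w \<in> B k" "l \<noteq> k" for v w l k
    using orth that B(1) by blast
  have disj: "B l \<inter> B k = {}" if "l \<noteq> k" for l k
  proof -
    have "v \<noteq> w" if "v \<in> B l" "w \<in> B k" for v w
      using o2[OF that \<open>l \<noteq> k\<close>] z[OF that(1)] by (auto simp: orthogonal_def)
    then show ?thesis by blast
  qed
  have "pairwise orthogonal (\<Union>l\<in>L. B l)"
    unfolding pairwise_def
  proof (intro ballI impI)
    fix v w assume "v \<in> (\<Union>l\<in>L. B l)" "w \<in> (\<Union>l\<in>L. B l)" "v \<noteq> w"
    then obtain l k where "v \<in> B l" "w \<in> B k" by blast
    then show "orthogonal v w"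
      using o2 B(2)[of l] \<open>v \<noteq> w\<close> by (cases "l = k") (auto simp: pairwise_def)
  qed
  then have "independent (\<Union>l\<in>L. B l)"
    by (rule pairwise_orthogonal_independent) (use z in blast)
  then have "card (\<Union>l\<in>L. B l) \<le> CARD('m)"
    using independent_bound by fastforce
  moreover have "card (\<Union>l\<in>L. B l) = (\<Sum>l\<in>L. card (B l))"
    by (rule card_UN_disjoint[OF assms(2)]) (use B(4) disj in auto)
  ultimately show ?thesis by (simp add: B(5))
qed

text \<open>A nonzero kernel would be an eigenspace for 0, whose dimension would come on top of q +
  (CARD('m) - q) = CARD('m).\<close>

lemma invertible_if_eigenvalue_counts:
  fixes G :: "real^'m^'m"
  assumes "transpose G = G" "eigenvalue_count G {..<0} = q" "eigenvalue_count G {0<..} = CARD('m) - q"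
    and "0 < q" "q < CARD('m)"
  shows "invertible G"
proof (rule ccontr)
  assume "\<not> invertible G"
  then obtain v where v: "v \<noteq> 0" "G *v v = 0"
    using matrix_left_invertible_ker[of G] invertible_left_inverse by blast
  let ?E = "\<lambda>L. {l\<in>L. \<exists>v. v \<noteq> 0 \<and> G *v v = l *\<^sub>R v}"
  let ?d = "\<lambda>l. dim {v. G *v v = l *\<^sub>R v}"
  \<comment> \<open>A sum over an infinite set is 0 by convention, whereas both counts are
    positive.\<close>
  have fin: "finite (?E {..<0})" "finite (?E {0<..})"
    using assms(2-5) unfolding eigenvalue_count_def by (auto intro: ccontr)
  have "?d 0 \<noteq> 0"
    using v by (auto simp: dim_eq_0)
  moreover have "(\<Sum>l\<in>insert 0 (?E {..<0} \<union> ?E {0<..}). ?d l) \<le> CARD('m)"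
    by (rule sum_dim_eigenspaces_le[OF assms(1)]) (use fin in simp)
  moreover have "(\<Sum>l\<in>insert 0 (?E {..<0} \<union> ?E {0<..}). ?d l) = ?d 0 + (sum ?d (?E {..<0}) + sum ?d (?E {0<..}))"
  proof -
    have "0 \<notin> ?E {..<0} \<union> ?E {0<..}" "?E {..<0} \<inter> ?E {0<..} = {}" by auto
    then show ?thesis
      using sum.insert[of "?E {..<0} \<union> ?E {0<..}" 0 ?d] sum.union_disjoint[of "?E {..<0}" "?E {0<..}" ?d] fin by simp
  qed
  moreover have "sum ?d (?E {..<0}) + sum ?d (?E {0<..}) = CARD('m)"
    using assms(2-5) unfolding eigenvalue_count_def by simp
  ultimately show False by linarith
qed

lemma matrix_inv_mult:
  fixes G :: "real^'m^'m"
  assumes "invertible G"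
  shows "G *v (matrix_inv G *v w) = w"
proof -
  have "G ** matrix_inv G = mat 1"
    using assms unfolding invertible_def matrix_inv_def by (rule someI2_ex) blast
  then show ?thesis by (simp add: matrix_vector_mul_assoc)
qed

lemma nondegenerate_matrix:
  fixes G :: "real^'m^'m"
  assumes "invertible G" "\<And>c. x \<bullet> (G *v c) = 0"
  shows "x = 0"
  using assms(2)[of "matrix_inv G *v x"] matrix_inv_mult[OF assms(1)] by simp

text \<open>The solution of the Koszul formula: \<open>D a\<close> stands for the derivative of the metric along \<open>a\<close>
  and \<open>S\<close> for the prescribed torsion.\<close>

definition koszul_form ::
    "real^'m^'m \<Rightarrow> (real^'m \<Rightarrow> real^'m \<Rightarrow> real^'m \<Rightarrow> real) \<Rightarrow> (real^'m \<Rightarrow> real^'m \<Rightarrow> real^'m) \<Rightarrow>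
      real^'m \<Rightarrow> real^'m \<Rightarrow> real^'m \<Rightarrow> real"
  where "koszul_form G D S a b c = (D a b c + D b c a - D c a b +
    S a b \<bullet> (G *v c) - S b c \<bullet> (G *v a) + S c a \<bullet> (G *v b)) / 2"

definition koszul ::
    "real^'m^'m \<Rightarrow> (real^'m \<Rightarrow> real^'m \<Rightarrow> real^'m \<Rightarrow> real) \<Rightarrow> (real^'m \<Rightarrow> real^'m \<Rightarrow> real^'m) \<Rightarrow>
      real^'m \<Rightarrow> real^'m \<Rightarrow> real^'m"
  where "koszul G D S a b = matrix_inv G *v (\<chi> k. koszul_form G D S a b (axis k 1))"

text \<open>Linear algebra at one point, detached from the chart, so that it applies both to
  vertical directions and to horizontal ones parametrised by vertical vectors.\<close>

locale koszul_data =
  fixes G :: "real^'m^'m" and D :: "real^'m \<Rightarrow> real^'m \<Rightarrow> real^'m \<Rightarrow> real" and S :: "real^'m \<Rightarrow> real^'m \<Rightarrow> real^'m"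
  assumes G_sym: "transpose G = G" and G_inv: "invertible G"
    and D_lin1: "linear (\<lambda>a. D a b c)" and D_lin2: "linear (\<lambda>b. D a b c)" and D_lin3: "linear (\<lambda>c. D a b c)"
    and D_sym: "D a b c = D a c b"
    and S_lin1: "linear (\<lambda>a. S a b)" and S_lin2: "linear (\<lambda>b. S a b)" and S_skew: "S a b = - S b a"
begin

lemma linear_inner_comp: "linear f \<Longrightarrow> linear (\<lambda>a. f a \<bullet> (w::real^'m))"
  by (auto simp: linear_iff inner_add_left)

lemma linear_inner_matrix: "linear (\<lambda>a. (w::real^'m) \<bullet> (G *v a))"
  by (auto simp: linear_iff matrix_vector_right_distrib inner_add_right matrix_vector_mult_scaleR)

lemmas linear_intros = linear_compose_add linear_compose_sub linear_inner_comp linear_inner_matrix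
  D_lin1 D_lin2 D_lin3 S_lin1 S_lin2

lemma linear_half: "linear f \<Longrightarrow> linear (\<lambda>a. f a / (2::real))"
  by (auto simp: linear_iff add_divide_distrib)

lemma koszul_form_linear:
  "linear (\<lambda>a. koszul_form G D S a b c)" "linear (\<lambda>b. koszul_form G D S a b c)" "linear (\<lambda>c. koszul_form G D S a b c)"
  unfolding koszul_form_def by (intro linear_half linear_intros)+

text \<open>\<open>koszul\<close> is built from the values of the form on the standard basis;
  linearity in the third argument recovers the form on all vectors, and G undoes the inverse
  matrix.\<close>

lemma koszul_inner: "koszul G D S a b \<bullet> (G *v c) = koszul_form G D S a b c"
proof -
  have "koszul G D S a b \<bullet> (G *v c) = (G *v koszul G D S a b) \<bullet> c"
    by (rule symmetric_matrix_inner[OF G_sym, symmetric])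
  also have "G *v koszul G D S a b = (\<chi> k. koszul_form G D S a b (axis k 1))"
    unfolding koszul_def by (rule matrix_inv_mult[OF G_inv])
  also have "\<dots> \<bullet> c = (\<Sum>k\<in>UNIV. c $ k * koszul_form G D S a b (axis k 1))"
    by (simp add: inner_vec_def mult.commute)
  also have "\<dots> = koszul_form G D S a b (\<Sum>k\<in>UNIV. c $ k *\<^sub>R axis k 1)"
    by (simp add: linear_sum[OF koszul_form_linear(3)] linear_scale[OF koszul_form_linear(3)])
  also have "(\<Sum>k\<in>UNIV. c $ k *\<^sub>R axis k 1) = c"
    using basis_expansion[of c] by (simp add: scalar_mult_eq_scaleR)
  finally show ?thesis .
qed

text \<open>Adding the forms for (a, b, c) and (a, c, b) cancels the other D terms by
  \<open>D_sym\<close> and all torsion terms by \<open>S_skew\<close>; twice D a b c, halved,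
  remains.\<close>

lemma koszul_metric: "koszul G D S a b \<bullet> (G *v c) + b \<bullet> (G *v koszul G D S a c) = D a b c"
proof -
  have "b \<bullet> (G *v koszul G D S a c) = koszul G D S a c \<bullet> (G *v b)"
    by (rule trans[OF symmetric_matrix_inner[OF G_sym, symmetric] inner_commute])
  also have "\<dots> = koszul_form G D S a c b" by (rule koszul_inner)
  finally show ?thesis
    using D_sym[of a b c] D_sym[of b c a] D_sym[of c a b] S_skew[of a b] S_skew[of b c] S_skew[of c a]
    by (simp add: koszul_inner koszul_form_def field_simps)
qed

text \<open>Exchanging a and b in the form changes, up to the symmetries of D and S, only the sign
  of the first torsion term; nondegeneracy of G turns the scalar identity into one of
  vectors.\<close>

lemma koszul_torsion: "koszul G D S a b - koszul G D S b a = S a b"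
proof -
  have "(koszul G D S a b - koszul G D S b a - S a b) \<bullet> (G *v c) = 0" for c
    unfolding inner_diff_left koszul_inner koszul_form_def
    using D_sym[of a b c] D_sym[of b c a] D_sym[of c a b] S_skew[of a b] S_skew[of b c] S_skew[of c a]
    by (simp add: field_simps)
  from nondegenerate_matrix[OF G_inv this] show ?thesis by simp
qed

lemma koszul_linear:
  "linear (\<lambda>a. koszul G D S a b)" "linear (\<lambda>b. koszul G D S a b)"
proof -
  have vec: "linear (\<lambda>a. matrix_inv G *v (\<chi> k. f a k))" if "\<And>k. linear (\<lambda>a. f a k)" for f :: "real^'m \<Rightarrow> 'm \<Rightarrow> real"
  proof (rule linearI)
    fix x y r
    have "(\<chi> k. f (x + y) k) = (\<chi> k. f x k) + (\<chi> k. f y k)" "(\<chi> k. f (r *\<^sub>R x) k) = r *\<^sub>R (\<chi> k. f x k)"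
      by (simp_all add: vec_eq_iff linear_add[OF that] linear_scale[OF that])
    then show "matrix_inv G *v (\<chi> k. f (x + y) k) = matrix_inv G *v (\<chi> k. f x k) + matrix_inv G *v (\<chi> k. f y k)"
      "matrix_inv G *v (\<chi> k. f (r *\<^sub>R x) k) = r *\<^sub>R (matrix_inv G *v (\<chi> k. f x k))"
      by (simp_all add: matrix_vector_right_distrib matrix_vector_mult_scaleR)
  qed
  show "linear (\<lambda>a. koszul G D S a b)" "linear (\<lambda>b. koszul G D S a b)"
    unfolding koszul_def by (intro vec koszul_form_linear)+
qed

end

lemma smooth_on_koszul:
  assumes "open O'" "smooth_on O' G" "\<And>z. z \<in> O' \<Longrightarrow> invertible (G z)"
    and "\<And>a b c. smooth_on O' (\<lambda>z. D z a b c)" "\<And>a b. smooth_on O' (\<lambda>z. S z a b)"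
  shows "smooth_on O' (\<lambda>z. koszul (G z) (D z) (S z) a b)"
proof -
  have form: "smooth_on O' (\<lambda>z. koszul_form (G z) (D z) (S z) a b c)" for c
    unfolding koszul_form_def
    by (intro smooth_on_divide smooth_on_add smooth_on_diff smooth_on_inner smooth_on_matrix_vector_mult
        smooth_on_const assms) simp
  show ?thesis
    unfolding koszul_def
    by (intro smooth_on_matrix_vector_mult smooth_on_matrix_inv smooth_on_vec_lambda form assms)
qed

section \<open>Fields over a single induced chart\<close>

locale chart_domain = tangent_open A M' for A :: "('a, 'e::euclidean_space) chart set" and M' +
  fixes c U'
  assumes c: "c \<in> A" and openU: "openin (manifold_topology (tangent_atlas A)) U'"
    and U_sub: "U' \<subseteq> M' \<inter> fst (tangent_chart A c)"
begin

abbreviation "C \<equiv> tangent_chart A c"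
abbreviation "TA \<equiv> tangent_atlas A"
abbreviation "\<Omega> \<equiv> snd C ` U'"
abbreviation "VF \<equiv> vector_fields TA U'"
abbreviation "VS \<equiv> sections TA U' (vertical A)"

definition comp :: "(('a, 'e) tpoint \<Rightarrow> ('a, 'e) ttvec) \<Rightarrow> 'e \<times> 'e \<Rightarrow> 'e \<times> 'e"
  where "comp X z = X (chart_inv C z) C"

text \<open>Inverse to \<open>comp\<close>: together they identify vector fields over
  \<open>U'\<close> with smooth functions on \<open>\<Omega>\<close>. The restriction to
  \<open>U'\<close> follows the convention for sections.\<close>

definition field :: "('e \<times> 'e \<Rightarrow> 'e \<times> 'e) \<Rightarrow> ('a, 'e) tpoint \<Rightarrow> ('a, 'e) ttvec"
  where "field w = (\<lambda>q\<in>U'. coord_vector TA C (w (snd C q)) q)"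

lemma C: "C \<in> TA"
  by (rule tangent_chart_in_atlas[OF c])

lemma UM: "q \<in> U' \<Longrightarrow> q \<in> M'" and UC: "q \<in> U' \<Longrightarrow> q \<in> fst C"
  using U_sub by auto

lemma U_Int_C: "U' \<inter> fst C = U'"
  using U_sub by auto

lemma open_\<Omega>: "open \<Omega>"
  using TM.open_chart_image[OF openU C] by (simp add: U_Int_C)

lemma inv_C: "q \<in> U' \<Longrightarrow> chart_inv C (snd C q) = q"
  by (rule TM.chart_inv_chart[OF C UC])

lemma inv_C_in: "z \<in> \<Omega> \<Longrightarrow> chart_inv C z \<in> U'" and C_inv: "z \<in> \<Omega> \<Longrightarrow> snd C (chart_inv C z) = z"
  using inv_C by auto

lemma \<Omega>I: "q \<in> U' \<Longrightarrow> snd C q \<in> \<Omega>"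
  by (rule imageI)

lemma comp_apply: "q \<in> U' \<Longrightarrow> comp X (snd C q) = X q C"
  by (simp add: comp_def inv_C)

lemma smooth_comp: "X \<in> sections TA U' V \<Longrightarrow> smooth_on \<Omega> (comp X)"
  by (drule TM.sections_smooth[OF _ C]) (simp only: U_Int_C comp_def[abs_def])

lemma field_tangent: "q \<in> U' \<Longrightarrow> field w q \<in> tangent_space TA q"
  by (simp add: field_def TM.coord_vector_tangent[OF C UC])

lemma field_apply: "q \<in> U' \<Longrightarrow> field w q C = w (snd C q)"
  by (simp add: field_def TM.coord_vector_apply[OF C UC])

lemma VF_tangent: "X \<in> VF \<Longrightarrow> q \<in> U' \<Longrightarrow> X q \<in> tangent_space TA q"
  by (rule TM.sections_in)

lemma VS_vertical: "X \<in> VS \<Longrightarrow> q \<in> U' \<Longrightarrow> X q \<in> vertical A q"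
  by (rule TM.sections_in)

lemma VS_VF: "X \<in> VS \<Longrightarrow> X \<in> VF"
  using vertical_subset unfolding sections_def by blast

lemma VS_iff: "X \<in> VF \<Longrightarrow> X \<in> VS \<longleftrightarrow> (\<forall>q\<in>U'. fst (X q C) = 0)"
  using vertical_iff[OF c UC VF_tangent] unfolding sections_def by blast

lemma VS_fst: "X \<in> VS \<Longrightarrow> q \<in> U' \<Longrightarrow> fst (X q C) = 0"
  using VS_iff VS_VF by blast

lemma VS_pair: "X \<in> VS \<Longrightarrow> q \<in> U' \<Longrightarrow> X q C = (0, snd (X q C))"
  using VS_fst by (simp add: prod_eq_iff)

lemma field_VF:
  assumes "smooth_on \<Omega> w"
  shows "field w \<in> VF"
proof (rule TM.sectionsI)
  show "field w \<in> extensional U'" by (simp add: field_def)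
  fix q assume q: "q \<in> U'"
  have "smooth_on \<Omega> (\<lambda>z. field w (chart_inv C z) C)"
    by (rule smooth_on_cong[OF open_\<Omega> _ assms]) (simp add: field_apply[OF inv_C_in] C_inv)
  then show "\<exists>D\<in>TA. q \<in> fst D \<and> (\<exists>S. open S \<and> snd D q \<in> S \<and> S \<subseteq> snd D ` (U' \<inter> fst D) \<and>
      smooth_on S (\<lambda>x. field w (chart_inv D x) D))"
    by (intro bexI[OF _ C] conjI exI[of _ \<Omega>] open_\<Omega> UC q imageI image_mono) (simp_all add: U_Int_C)
qed (simp_all add: field_tangent)

lemma field_VS: "smooth_on \<Omega> w \<Longrightarrow> (\<And>z. z \<in> \<Omega> \<Longrightarrow> fst (w z) = 0) \<Longrightarrow> field w \<in> VS"
  using VS_iff[OF field_VF] by (simp add: field_apply)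

text \<open>Off \<open>U'\<close> the two agree by extensionality, and on it the transformation law
  lets the one chart decide.\<close>

lemma VF_eqI:
  assumes "X \<in> VF" "Y \<in> VF" "\<And>q. q \<in> U' \<Longrightarrow> X q C = Y q C"
  shows "X = Y"
proof (rule extensionalityI)
  show "X \<in> extensional U'" "Y \<in> extensional U'" using assms TM.sections_extensional by blast+
  show "X q = Y q" if "q \<in> U'" for q
    by (rule TM.tangent_space_eqI[OF VF_tangent VF_tangent C UC]) (use assms that in auto)
qed

lemma sec_add_apply: "q \<in> U' \<Longrightarrow> sec_add U' X Y q C = X q C + Y q C"
  by (simp add: sec_add_def)

lemma sec_scale_apply: "q \<in> U' \<Longrightarrow> sec_scale U' f X q C = f q *\<^sub>R X q C"
  by (simp add: sec_scale_def scaleR_fun_def)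

lemma sec_add_VF: "X \<in> VF \<Longrightarrow> Y \<in> VF \<Longrightarrow> sec_add U' X Y \<in> VF"
  by (intro TM.sections_add openU TM.subspace_tangent_space)

lemma sec_add_VS: "X \<in> VS \<Longrightarrow> Y \<in> VS \<Longrightarrow> sec_add U' X Y \<in> VS"
  by (intro TM.sections_add openU subspace_vertical UM)

lemma sec_scale_VF: "smooth_function TA U' f \<Longrightarrow> X \<in> VF \<Longrightarrow> sec_scale U' f X \<in> VF"
  by (intro TM.sections_scale openU TM.subspace_tangent_space)

lemma sec_scale_VS: "smooth_function TA U' f \<Longrightarrow> X \<in> VS \<Longrightarrow> sec_scale U' f X \<in> VS"
  by (intro TM.sections_scale openU subspace_vertical UM)

lemma smooth_function_chart: "smooth_function TA U' f \<Longrightarrow> smooth_on \<Omega> (f \<circ> chart_inv C)"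
  using C unfolding smooth_function_def by (metis U_Int_C)

lemma has_derivative_comp:
  "X \<in> sections TA U' V \<Longrightarrow> q \<in> U' \<Longrightarrow> (comp X has_derivative frechet_derivative (comp X) (at (snd C q))) (at (snd C q))"
  by (rule smooth_on_has_derivative[OF smooth_comp \<Omega>I])

lemma lie_bracket_comp:
  assumes "X \<in> VF" "Y \<in> VF" "q \<in> U'"
  shows "lie_bracket TA X Y q C =
    frechet_derivative (comp Y) (at (snd C q)) (X q C) - frechet_derivative (comp X) (at (snd C q)) (Y q C)"
  using TM.lie_bracket_apply[OF openU assms C UC[OF assms(3)]] by (simp add: comp_def[abs_def])

lemma torsion_tangent:
  assumes "X \<in> VF" "Y \<in> VF" "q \<in> U'" "D X Y q \<in> tangent_space TA q" "D Y X q \<in> tangent_space TA q"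
  shows "torsion TA D X Y q \<in> tangent_space TA q"
  unfolding torsion_def
  by (intro subspace_diff TM.subspace_tangent_space assms TM.lie_bracket_tangent[OF openU])

end

section \<open>Nonlinear connections in an induced chart\<close>

lemma linear_tvec_apply: "linear (\<lambda>w :: ('a, 'e::euclidean_space) tvec. w c)"
  by (rule linearI) (simp_all add: scaleR_fun_def)

lemma tvec_sum_apply: "(\<Sum>i\<in>I. w i :: ('a, 'e::euclidean_space) tvec) c = (\<Sum>i\<in>I. w i c)"
  by (rule linear_sum[OF linear_tvec_apply])

locale horizontal_domain = chart_domain A M' c U'
  for A :: "('a, real^'m::finite) chart set" and M' and c and U' +
  fixes H
  assumes nlc: "nonlinear_connection A M' H"
begin

lemma H_Int: "q \<in> M' \<Longrightarrow> H q \<inter> vertical A q = {0}"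
  and H_sum: "q \<in> M' \<Longrightarrow> {u + w | u w. u \<in> H q \<and> w \<in> vertical A q} = tangent_space TA q"
  and distr: "distribution TA M' H"
  using nlc by (simp_all add: nonlinear_connection_def)

lemma subspace_H: "q \<in> M' \<Longrightarrow> subspace (H q)"
  using distr subspace_span unfolding distribution_def by fastforce

lemma H_tangent:
  assumes "q \<in> M'" "u \<in> H q"
  shows "u \<in> tangent_space TA q"
proof -
  have "\<exists>u' w. u = u' + w \<and> u' \<in> H q \<and> w \<in> vertical A q"
    by (intro exI[of _ u] exI[of _ 0] conjI assms zero_vertical) simp
  then show ?thesis unfolding H_sum[OF assms(1), symmetric] by blast
qed

lemma hproj_eqI:
  assumes "q \<in> M'" "u \<in> H q" "w - u \<in> vertical A q"
  shows "hproj A H q w = u"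
  unfolding hproj_def
proof (rule the_equality)
  fix u' assume u': "u' \<in> H q \<and> w - u' \<in> vertical A q"
  then have "u - u' \<in> H q" using subspace_diff[OF subspace_H[OF assms(1)]] assms by blast
  moreover have "u - u' \<in> vertical A q"
    using subspace_diff[OF subspace_vertical[OF assms(1)], of "w - u'" "w - u"] assms u' by simp
  ultimately have "u - u' \<in> H q \<inter> vertical A q" by (rule IntI)
  then show "u' = u" unfolding H_Int[OF assms(1)] by simp
qed (use assms in simp)

lemma hproj_in:
  assumes "q \<in> M'" "w \<in> tangent_space TA q"
  shows "hproj A H q w \<in> H q" "w - hproj A H q w \<in> vertical A q"
proof -
  have "w \<in> {u + w | u w. u \<in> H q \<and> w \<in> vertical A q}"
    unfolding H_sum[OF assms(1)] by (rule assms(2))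
  then obtain u v where "u \<in> H q" "v \<in> vertical A q" "w = u + v" by blast
  then have u: "u \<in> H q" "w - u \<in> vertical A q" by simp_all
  have eq: "hproj A H q w = u" by (rule hproj_eqI[OF assms(1) u])
  show "hproj A H q w \<in> H q" "w - hproj A H q w \<in> vertical A q"
    unfolding eq by (rule u)+
qed

lemma vproj_eq:
  assumes "q \<in> M'" "w \<in> tangent_space TA q"
  shows "vproj A H q w = w - hproj A H q w"
  unfolding vproj_def
proof (rule the_equality)
  fix u assume "u \<in> vertical A q \<and> w - u \<in> H q"
  then have "hproj A H q w = w - u" by (intro hproj_eqI[OF assms(1)]) simp_all
  then show "u = w - hproj A H q w" by simp
qed (use hproj_in[OF assms] in simp)

text \<open>The linear map with matrix N_i^j: with this sign the horizontal space consists of the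
  vectors (\<xi>, - N \<xi>), in accordance with the frame \<open>delta\<close>. It is read off from
  the horizontal lift, so that it is available before \<open>nlc_coeff\<close> is known to be
  determined.\<close>

definition nfun :: "(real^'m) \<times> (real^'m) \<Rightarrow> real^'m \<Rightarrow> real^'m"
  where "nfun z \<xi> = - snd (hproj A H (chart_inv C z) (coord_vector TA C (\<xi>, 0) (chart_inv C z)) C)"

lemma hproj_coord:
  assumes "q \<in> U'"
  shows "hproj A H q (coord_vector TA C (\<xi>, 0) q) \<in> H q"
    "hproj A H q (coord_vector TA C (\<xi>, 0) q) C = (\<xi>, - nfun (snd C q) \<xi>)"
proof -
  let ?v = "coord_vector TA C (\<xi>, 0) q" and ?h = "hproj A H q (coord_vector TA C (\<xi>, 0) q)"
  have v: "?v \<in> tangent_space TA q" by (rule TM.coord_vector_tangent[OF C UC[OF assms]])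
  note h = hproj_in[OF UM[OF assms] v]
  show "?h \<in> H q" by (rule h(1))
  have "fst ((?v - ?h) C) = 0"
    using vertical_iff[OF c UC[OF assms]] h(2) vertical_subset by blast
  then have "fst (?h C) = \<xi>" by (simp add: TM.coord_vector_apply[OF C UC[OF assms]])
  then show "?h C = (\<xi>, - nfun (snd C q) \<xi>)"
    by (simp add: nfun_def inv_C[OF assms] prod_eq_iff)
qed

text \<open>\<open>w\<close> and the horizontal lift of its base component project to the same
  vector; if both are horizontal, their difference is also vertical, hence 0.\<close>

lemma H_iff:
  assumes "q \<in> U'" "w \<in> tangent_space TA q"
  shows "w \<in> H q \<longleftrightarrow> snd (w C) = - nfun (snd C q) (fst (w C))"
proof -
  let ?h = "hproj A H q (coord_vector TA C (fst (w C), 0) q)"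
  note h = hproj_coord[OF assms(1), of "fst (w C)"]
  note ht = H_tangent[OF UM[OF assms(1)] h(1)]
  show ?thesis
  proof
    assume "w \<in> H q"
    then have d: "w - ?h \<in> H q" using subspace_diff[OF subspace_H[OF UM[OF assms(1)]]] h(1) by blast
    have "w - ?h \<in> vertical A q"
      by (subst vertical_iff[OF c UC[OF assms(1)] H_tangent[OF UM[OF assms(1)] d]]) (simp add: h(2))
    with d have "w - ?h \<in> H q \<inter> vertical A q" by (rule IntI)
    then have "w = ?h" unfolding H_Int[OF UM[OF assms(1)]] by simp
    then show "snd (w C) = - nfun (snd C q) (fst (w C))" using h(2) by (metis snd_conv)
  next
    assume "snd (w C) = - nfun (snd C q) (fst (w C))"
    then have "w C = ?h C" by (simp add: h(2) prod_eq_iff)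
    then have "w = ?h" by (rule TM.tangent_space_eqI[OF assms(2) ht C UC[OF assms(1)]])
    then show "w \<in> H q" using h(1) by simp
  qed
qed

lemma linear_nfun:
  assumes "z \<in> \<Omega>"
  shows "linear (nfun z)"
proof -
  let ?q = "chart_inv C z"
  let ?h = "\<lambda>\<xi>. hproj A H ?q (coord_vector TA C (\<xi>, 0) ?q)"
  have q: "?q \<in> U'" "snd C ?q = z" using inv_C_in C_inv assms by auto
  note h = hproj_coord[OF q(1), unfolded q(2)]
  have iff: "w \<in> H ?q \<Longrightarrow> snd (w C) = - nfun z (fst (w C))" for w
    using H_iff[OF q(1) H_tangent[OF UM[OF q(1)]]] q(2) by auto
  note sub = subspace_H[OF UM[OF q(1)]]
  show ?thesis
  proof (rule linearI)
    show "nfun z (\<xi> + \<xi>') = nfun z \<xi> + nfun z \<xi>'" for \<xi> \<xi>'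
      using iff[OF subspace_add[OF sub h(1) h(1)], of \<xi> \<xi>'] by (simp add: h(2) algebra_simps)
    show "nfun z (r *\<^sub>R \<xi>) = r *\<^sub>R nfun z \<xi>" for r \<xi>
      using iff[OF subspace_scale[OF sub h(1)], of r \<xi>] by (simp add: h(2) scaleR_fun_def)
  qed
qed

lemma hproj_tangent: "q \<in> U' \<Longrightarrow> w \<in> tangent_space TA q \<Longrightarrow> hproj A H q w \<in> tangent_space TA q"
  using hproj_in H_tangent UM by blast

lemma hproj_comp:
  assumes "q \<in> U'" "w \<in> tangent_space TA q"
  shows "hproj A H q w C = (fst (w C), - nfun (snd C q) (fst (w C)))"
proof -
  note h = hproj_in[OF UM[OF assms(1)] assms(2)]
  have "fst ((w - hproj A H q w) C) = 0"
    using vertical_iff[OF c UC[OF assms(1)]] h(2) vertical_subset by blast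
  then have "fst (hproj A H q w C) = fst (w C)" by simp
  then show ?thesis
    using H_iff[OF assms(1) hproj_tangent[OF assms]] h(1) by (simp add: prod_eq_iff)
qed

lemma vproj_vertical: "q \<in> U' \<Longrightarrow> w \<in> tangent_space TA q \<Longrightarrow> vproj A H q w \<in> vertical A q"
  using hproj_in(2) vproj_eq UM by metis

lemma vproj_tangent: "q \<in> U' \<Longrightarrow> w \<in> tangent_space TA q \<Longrightarrow> vproj A H q w \<in> tangent_space TA q"
  using vproj_vertical vertical_subset by blast

lemma vproj_comp:
  assumes "q \<in> U'" "w \<in> tangent_space TA q"
  shows "vproj A H q w C = (0, snd (w C) + nfun (snd C q) (fst (w C)))"
  unfolding vproj_eq[OF UM[OF assms(1)] assms(2)] using hproj_comp[OF assms]
  by (simp add: prod_eq_iff)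

text \<open>The distribution is given by local frames, not by N. The base components of a frame form
  an invertible matrix P; solving P t = \<xi> gives the combination of the frame that lies over
  \<xi>, and its fibre component is - N \<xi>.\<close>

lemma smooth_nfun: "smooth_on \<Omega> (\<lambda>z. nfun z \<xi>)"
proof (rule smooth_on_local)
  fix z0 assume "z0 \<in> \<Omega>"
  then obtain p where p: "p \<in> U'" "z0 = snd C p" by blast
  have "\<exists>W B. p \<in> W \<and> W \<subseteq> M' \<and> openin (manifold_topology TA) W \<and> finite B \<and> B \<subseteq> vector_fields TA W \<and>
    (\<forall>q\<in>W. inj_on (\<lambda>X. X q) B \<and> independent ((\<lambda>X. X q) ` B) \<and> H q = span ((\<lambda>X. X q) ` B))"
    using distr UM[OF p(1)] unfolding distribution_def by blast
  then obtain W B where W: "p \<in> W" "W \<subseteq> M'" "openin (manifold_topology TA) W" "finite B" "B \<subseteq> vector_fields TA W"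
    and B: "\<And>q. q \<in> W \<Longrightarrow> inj_on (\<lambda>X. X q) B" "\<And>q. q \<in> W \<Longrightarrow> independent ((\<lambda>X. X q) ` B)"
      "\<And>q. q \<in> W \<Longrightarrow> H q = span ((\<lambda>X. X q) ` B)"
    by (elim exE conjE) metis
  let ?O = "snd C ` ((W \<inter> U') \<inter> fst C)"
  have oO: "open ?O" by (rule TM.open_chart_image[OF openin_Int[OF W(3) openU] C])
  let ?\<alpha> = "\<lambda>q X. fst (X q C)"
  \<comment> \<open>The kernel of the base projection is vertical, so the projection is injective on
    H; every \<xi> has a horizontal lift, so it is onto. A frame of H therefore projects to a
    basis.\<close>
  have \<alpha>: "inj_on (?\<alpha> q) B \<and> independent (?\<alpha> q ` B) \<and> span (?\<alpha> q ` B) = UNIV" if q: "q \<in> W" "q \<in> U'" for q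
  proof -
    let ?L = "\<lambda>w :: ('a, real^'m) ttvec. fst (w C)" and ?X = "(\<lambda>X. X q) ` B"
    have L: "linear ?L" by (rule linearI) (simp_all add: scaleR_fun_def)
    have inj: "inj_on ?L (H q)"
      unfolding linear_inj_on_iff_eq_0[OF L subspace_H[OF UM[OF q(2)]]]
    proof (intro ballI impI)
      fix w assume w: "w \<in> H q" "fst (w C) = 0"
      then have "w \<in> vertical A q"
        using vertical_iff[OF c UC[OF q(2)] H_tangent[OF UM[OF q(2)]]] by blast
      with w(1) have "w \<in> H q \<inter> vertical A q" by (rule IntI)
      then show "w = 0" unfolding H_Int[OF UM[OF q(2)]] by simp
    qed
    have img: "?\<alpha> q ` B = ?L ` ?X" by (simp add: image_image)
    have "independent (?L ` ?X)"
      by (rule linear_independent_injective_image[OF L B(2)[OF q(1)]]) (use inj B(3)[OF q(1)] in simp)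
    moreover have "inj_on (?\<alpha> q) B"
    proof -
      have "inj_on ?L ?X" using inj_on_subset[OF inj, of ?X] B(3)[OF q(1)] span_superset[of ?X] by simp
      from comp_inj_on[OF B(1)[OF q(1)] this] show ?thesis by (simp add: o_def)
    qed
    moreover have "span (?L ` ?X) = UNIV"
    proof -
      have *: "\<xi> \<in> ?L ` H q" for \<xi>
        by (rule image_eqI[OF _ hproj_coord(1)[OF q(2), of \<xi>]]) (simp add: hproj_coord(2)[OF q(2)])
      show ?thesis
        unfolding linear_span_image[OF L] B(3)[OF q(1), symmetric]
        by (rule UNIV_eq_I[symmetric], rule *)
    qed
    ultimately show ?thesis using img by simp
  qed
  \<comment> \<open>Counting lets the frame be indexed by the coordinate indices, so that P becomes
    a square matrix.\<close>
  have "card (?\<alpha> p ` B) = CARD('m)"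
    using \<alpha>[OF W(1) p(1)] basis_card_eq_dim[of "?\<alpha> p ` B" UNIV] by simp
  moreover have "card (?\<alpha> p ` B) = card B" by (rule card_image[OF conjunct1[OF \<alpha>[OF W(1) p(1)]]])
  ultimately have "card (UNIV :: 'm set) = card B" by simp
  from finite_same_card_bij[OF finite_class.finite_UNIV W(4) this]
  obtain e :: "'m \<Rightarrow> _" where e: "bij_betw e UNIV B" ..
  have eB: "e i \<in> B" for i by (rule bij_betw_apply[OF e UNIV_I])
  define P where "P z = (\<chi> k i. fst (e i (chart_inv C z) C) $ k)" for z
  have es: "smooth_on ?O (\<lambda>z. e i (chart_inv C z) C)" for i
  proof -
    have "e i \<in> vector_fields TA W" using eB W(5) by blast
    from TM.sections_smooth[OF this C] show ?thesis by (rule smooth_on_subset) blast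
  qed
  have P: "smooth_on ?O P"
    unfolding P_def[abs_def] by (intro smooth_on_vec_lambda smooth_on_vec_nth smooth_on_fst es oO)
  have Pmul: "P z *v t = (\<Sum>i\<in>UNIV. t $ i *\<^sub>R fst (e i (chart_inv C z) C))" for z t
    by (simp add: P_def matrix_vector_mult_def vec_eq_iff sum_component mult.commute)
  have O: "\<exists>q. q \<in> W \<and> q \<in> U' \<and> z = snd C q \<and> chart_inv C z = q" if "z \<in> ?O" for z
    using that inv_C by blast
  have inv: "invertible (P z)" if z: "z \<in> ?O" for z
  proof -
    obtain q where q: "q \<in> W" "q \<in> U'" "z = snd C q" "chart_inv C z = q" using O[OF z] by blast
    have "t = 0" if "P z *v t = 0" for t
    proof -
      \<comment> \<open>Independence is stated for sets of vectors, so the coefficients are carried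
        from indices to vectors through the two injections.\<close>
      let ?t = "\<lambda>v. t $ inv_into UNIV e (inv_into B (?\<alpha> q) v)"
      have t: "?t (?\<alpha> q (e i)) = t $ i" for i
        using inv_into_f_f[OF conjunct1[OF \<alpha>[OF q(1,2)]] eB[of i]]
          inv_into_f_f[OF bij_betw_imp_inj_on[OF e] UNIV_I, of i] by simp
      have "(\<Sum>v\<in>?\<alpha> q ` B. ?t v *\<^sub>R v) = (\<Sum>X\<in>B. ?t (?\<alpha> q X) *\<^sub>R ?\<alpha> q X)"
        by (rule sum.reindex_cong[OF conjunct1[OF \<alpha>[OF q(1,2)]] refl refl])
      also have "\<dots> = (\<Sum>i\<in>UNIV. ?t (?\<alpha> q (e i)) *\<^sub>R ?\<alpha> q (e i))"
        by (rule sum.reindex_bij_betw[OF e, symmetric])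
      also have "\<dots> = 0" unfolding t using that q(4) by (simp add: Pmul)
      finally have "(\<Sum>v\<in>?\<alpha> q ` B. ?t v *\<^sub>R v) = 0" .
      then have "?t (?\<alpha> q (e i)) = 0" for i
        using independentD[OF _ finite_imageI[OF W(4)] subset_refl _ imageI[OF eB], of "?\<alpha> q" ?t i]
          \<alpha>[OF q(1,2)] by blast
      then show ?thesis unfolding t by (simp add: vec_eq_iff)
    qed
    then show ?thesis
      using matrix_left_invertible_ker[of "P z"] invertible_left_inverse by blast
  qed
  have "smooth_on ?O (\<lambda>z. - (\<Sum>i\<in>UNIV. (matrix_inv (P z) *v \<xi>) $ i *\<^sub>R snd (e i (chart_inv C z) C)))"
    by (intro smooth_on_minus smooth_on_sum smooth_on_scaleR smooth_on_vec_nth smooth_on_matrix_vector_mult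
        smooth_on_matrix_inv P inv smooth_on_const smooth_on_snd es oO)
  then have "smooth_on ?O (\<lambda>z. nfun z \<xi>)"
  proof (rule smooth_on_cong[OF oO, rotated])
    fix z assume z: "z \<in> ?O"
    obtain q where q: "q \<in> W" "q \<in> U'" "z = snd C q" "chart_inv C z = q" using O[OF z] by blast
    let ?t = "matrix_inv (P z) *v \<xi>"
    let ?w = "\<Sum>i\<in>UNIV. ?t $ i *\<^sub>R e i q"
    have "?w \<in> H q"
      unfolding B(3)[OF q(1)] using eB by (intro span_sum span_scale span_base) auto
    then have "snd (?w C) = - nfun z (fst (?w C))"
      using H_iff[OF q(2) H_tangent[OF UM[OF q(2)]]] q(3) by blast
    moreover have wC: "?w C = (\<Sum>i\<in>UNIV. ?t $ i *\<^sub>R e i q C)"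
      by (simp add: tvec_sum_apply scaleR_fun_def)
    moreover have "fst (?w C) = \<xi>"
      unfolding wC using Pmul[of z ?t] matrix_inv_mult[OF inv[OF z], of \<xi>] q(4) by (simp add: fst_sum)
    ultimately show "- (\<Sum>i\<in>UNIV. ?t $ i *\<^sub>R snd (e i (chart_inv C z) C)) = nfun z \<xi>"
      by (simp add: snd_sum q(4))
  qed
  then show "\<exists>O'. open O' \<and> z0 \<in> O' \<and> smooth_on O' (\<lambda>z. nfun z \<xi>)"
    using oO W(1) p UC by (intro exI[of _ ?O]) simp
qed

end

section \<open>Smooth families of linear and bilinear maps\<close>

lemma smooth_on_linear_family:
  fixes L :: "'d::euclidean_space \<Rightarrow> 'e::euclidean_space \<Rightarrow> 'f::real_normed_vector"
  assumes "open S" "\<And>z. z \<in> S \<Longrightarrow> linear (L z)" "\<And>b. smooth_on S (\<lambda>z. L z b)" "smooth_on S w"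
  shows "smooth_on S (\<lambda>z. L z (w z))"
proof -
  have "smooth_on S (\<lambda>z. \<Sum>b\<in>Basis. (w z \<bullet> b) *\<^sub>R L z b)"
    by (intro smooth_on_sum smooth_on_scaleR smooth_on_inner smooth_on_const assms)
  then show ?thesis
    by (rule smooth_on_cong[OF assms(1), rotated]) (rule linear_expand_Basis, rule assms(2))
qed

lemma smooth_on_bilinear_family:
  fixes B :: "'d::euclidean_space \<Rightarrow> 'e::euclidean_space \<Rightarrow> 'f::euclidean_space \<Rightarrow> 'g::real_normed_vector"
  assumes "open S" "\<And>z b. z \<in> S \<Longrightarrow> linear (\<lambda>a. B z a b)" "\<And>z a. z \<in> S \<Longrightarrow> linear (\<lambda>b. B z a b)"
    and "\<And>a b. smooth_on S (\<lambda>z. B z a b)" "smooth_on S u" "smooth_on S w"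
  shows "smooth_on S (\<lambda>z. B z (u z) (w z))"
proof -
  have "smooth_on S (\<lambda>z. B z a (w z))" for a
    by (rule smooth_on_linear_family[OF assms(1) assms(3) assms(4,6)])
  from smooth_on_linear_family[OF assms(1) _ this assms(5)] assms(2) show ?thesis .
qed

section \<open>Vertical vectors and tensor fields in the chart\<close>

context chart_domain
begin

definition vert :: "'e \<Rightarrow> ('a, 'e) tpoint \<Rightarrow> ('a, 'e) ttvec"
  where "vert a q = coord_vector TA C (0, a) q"

text \<open>The components S^k_ij a^i b^j in the chart; the values are vertical, so only the second
  component is kept.\<close>

definition tens where "tens S z a b = snd (tensor_at A M' S (chart_inv C z) (vert a (chart_inv C z)) (vert b (chart_inv C z)) C)"

lemma vert_tangent: "q \<in> U' \<Longrightarrow> vert a q \<in> tangent_space TA q"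
  unfolding vert_def by (rule TM.coord_vector_tangent[OF C UC])

lemma vert_apply: "q \<in> U' \<Longrightarrow> vert a q C = (0, a)"
  unfolding vert_def by (rule TM.coord_vector_apply[OF C UC])

lemma vert_vertical: "q \<in> U' \<Longrightarrow> vert a q \<in> vertical A q"
  using vertical_iff[OF c UC vert_tangent] vert_apply by simp

lemma vertical_eq_vert:
  assumes "q \<in> U'" "u \<in> vertical A q"
  shows "u = vert (snd (u C)) q" "u C = (0, snd (u C))"
proof -
  have u: "u \<in> tangent_space TA q" using vertical_subset assms(2) by blast
  show uC: "u C = (0, snd (u C))" using vertical_iff[OF c UC u] assms by (simp add: prod_eq_iff)
  show "u = vert (snd (u C)) q"
    by (rule TM.tangent_space_eqI[OF u vert_tangent C UC]) (use assms uC vert_apply in simp_all)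
qed

lemma vert_linear:
  assumes "q \<in> U'"
  shows "vert (r *\<^sub>R a + s *\<^sub>R b) q = r *\<^sub>R vert a q + s *\<^sub>R vert b q"
proof (rule TM.tangent_space_eqI[OF vert_tangent[OF assms] _ C UC[OF assms]])
  show "r *\<^sub>R vert a q + s *\<^sub>R vert b q \<in> tangent_space TA q"
    by (intro subspace_add subspace_scale TM.subspace_tangent_space vert_tangent assms)
  show "vert (r *\<^sub>R a + s *\<^sub>R b) q C = (r *\<^sub>R vert a q + s *\<^sub>R vert b q) C"
    by (simp add: vert_apply[OF assms] scaleR_fun_def)
qed

context
  fixes S assumes S: "skew_tensor A M' S"
begin

interpretation S: skew_tensor A M' S by (rule S)

lemma tens_comp:
  assumes "q \<in> U'" "u \<in> vertical A q" "w \<in> vertical A q"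
  shows "tensor_at A M' S q u w C = (0, tens S (snd C q) (snd (u C)) (snd (w C)))"
  unfolding tens_def inv_C[OF assms(1)] vertical_eq_vert(1)[OF assms(1,2), symmetric]
    vertical_eq_vert(1)[OF assms(1,3), symmetric]
  by (rule vertical_eq_vert(2)[OF assms(1) S.tensor_at_vertical[OF UM[OF assms(1)] assms(2,3)]])

lemma tens_linear_left:
  assumes "z \<in> \<Omega>"
  shows "linear (\<lambda>a. tens S z a b)"
proof -
  let ?q = "chart_inv C z"
  note q = inv_C_in[OF assms]
  have *: "tens S z (r *\<^sub>R x + s *\<^sub>R y) b = r *\<^sub>R tens S z x b + s *\<^sub>R tens S z y b" for r s x y
    unfolding tens_def vert_linear[OF q]
    using S.tensor_at_linear_left[OF UM[OF q] vert_vertical[OF q] vert_vertical[OF q] vert_vertical[OF q], of r x s y b]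
    by (simp add: scaleR_fun_def)
  show ?thesis
    by (rule linearI) (use *[of 1 _ 1] *[of _ _ 0 0] in simp_all)
qed

lemma tens_skew:
  assumes "z \<in> \<Omega>"
  shows "tens S z a b = - tens S z b a"
  unfolding tens_def
  using S.tensor_at_skew[OF UM[OF inv_C_in[OF assms]] vert_vertical[OF inv_C_in[OF assms]] vert_vertical[OF inv_C_in[OF assms]], of a b]
  by simp

lemma tens_linear_right:
  assumes "z \<in> \<Omega>"
  shows "linear (\<lambda>b. tens S z a b)"
  unfolding tens_skew[OF assms, of a] by (rule linear_compose_neg[OF tens_linear_left[OF assms]])

lemma tens_smooth: "smooth_on \<Omega> (\<lambda>z. tens S z a b)"
  unfolding tens_def vert_def
  by (rule smooth_on_snd[OF open_\<Omega> smooth_on_subset[OF S.smooth_tensor_at[OF c]]])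
    (use U_sub in blast)

end

lemma fst_frechet_comp:
  assumes "X \<in> VF" "q \<in> U'"
  shows "((\<lambda>z. fst (comp X z)) has_derivative (\<lambda>w. fst (frechet_derivative (comp X) (at (snd C q)) w))) (at (snd C q))"
    "((\<lambda>z. snd (comp X z)) has_derivative (\<lambda>w. snd (frechet_derivative (comp X) (at (snd C q)) w))) (at (snd C q))"
  using has_derivative_fst[OF has_derivative_comp[OF assms]] has_derivative_snd[OF has_derivative_comp[OF assms]]
  by simp_all

end

text \<open>In the induced chart the endomorphism \<open>J\<close> exchanges the horizontal and the vertical space
  through a constant involution \<open>K\<close>.\<close>

locale local_geometry = horizontal_domain A M' c U' H
  for A :: "('a, real^'m::finite) chart set" and M' and c and U' and H +
  fixes J :: "('a, real^'m) tpoint \<Rightarrow> ('a, real^'m) ttvec \<Rightarrow> ('a, real^'m) ttvec"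
    and K :: "real^'m \<Rightarrow> real^'m"
    and G :: "(real^'m) \<times> (real^'m) \<Rightarrow> real^'m^'m"
    and g and S T
  assumes J_tangent: "q \<in> U' \<Longrightarrow> w \<in> tangent_space TA q \<Longrightarrow> J q w \<in> tangent_space TA q"
    and J_comp: "q \<in> U' \<Longrightarrow> w \<in> tangent_space TA q \<Longrightarrow>
      J q w C = (- K (snd (w C) + nfun (snd C q) (fst (w C))),
        K (fst (w C)) + nfun (snd C q) (K (snd (w C) + nfun (snd C q) (fst (w C)))))"
    and linear_K: "linear K" and K_K: "K (K x) = x"
    and smooth_G: "smooth_on \<Omega> G"
    and G_sym: "z \<in> \<Omega> \<Longrightarrow> transpose (G z) = G z" and G_inv: "z \<in> \<Omega> \<Longrightarrow> invertible (G z)"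
    and g_comp: "q \<in> U' \<Longrightarrow> u \<in> vertical A q \<Longrightarrow> w \<in> vertical A q \<Longrightarrow>
      g q u w = snd (u C) \<bullet> (G (snd C q) *v snd (w C))"
    and S: "skew_tensor A M' S" and T: "skew_tensor A M' T"
begin

abbreviation "vf \<equiv> sec_map U' (vproj A H)"
abbreviation "hf \<equiv> sec_map U' (hproj A H)"
abbreviation "jf \<equiv> sec_map U' J"
abbreviation "zero_field \<equiv> field (\<lambda>z. (0, 0))"

lemma nfun_0: "q \<in> U' \<Longrightarrow> nfun (snd C q) 0 = 0"
  by (rule linear_0[OF linear_nfun[OF \<Omega>I]])

lemma K_0: "K 0 = 0" and K_minus: "K (- x) = - K x" and K_add: "K (x + y) = K x + K y" and K_diff: "K (x - y) = K x - K y"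
  using linear_K by (simp_all add: linear_0 linear_neg linear_add linear_diff)

lemma smooth_nfun_along: "smooth_on \<Omega> \<xi> \<Longrightarrow> smooth_on \<Omega> (\<lambda>z. nfun z (\<xi> z))"
  by (rule smooth_on_linear_family[OF open_\<Omega> linear_nfun smooth_nfun])

lemma smooth_K: "smooth_on \<Omega> \<xi> \<Longrightarrow> smooth_on \<Omega> (\<lambda>z. K (\<xi> z))"
  by (rule smooth_on_bounded_linear[OF open_\<Omega> linear_conv_bounded_linear[THEN iffD1, OF linear_K]])

lemma field_eqI:
  assumes "X \<in> extensional U'" "\<And>q. q \<in> U' \<Longrightarrow> X q \<in> tangent_space TA q" "\<And>q. q \<in> U' \<Longrightarrow> X q C = w (snd C q)"
  shows "X = field w"
proof (rule extensionalityI[OF assms(1)])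
  show "field w \<in> extensional U'" by (simp add: field_def)
  show "X q = field w q" if "q \<in> U'" for q
    by (rule TM.tangent_space_eqI[OF assms(2) field_tangent C UC]) (use that assms(3) field_apply in simp_all)
qed

lemma sec_map_apply: "q \<in> U' \<Longrightarrow> sec_map U' L X q = L q (X q)"
  by (simp add: sec_map_def)

lemma sec_map_extensional: "sec_map U' L X \<in> extensional U'"
  by (simp add: sec_map_def)

lemma hf_field:
  assumes "X \<in> VF"
  shows "hf X = field (\<lambda>z. (fst (comp X z), - nfun z (fst (comp X z))))"
  by (rule field_eqI[OF sec_map_extensional])
    (simp_all add: sec_map_apply hproj_tangent hproj_comp VF_tangent[OF assms] comp_apply)

lemma vf_field:
  assumes "X \<in> VF"
  shows "vf X = field (\<lambda>z. (0, snd (comp X z) + nfun z (fst (comp X z))))"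
  by (rule field_eqI[OF sec_map_extensional])
    (simp_all add: sec_map_apply vproj_tangent vproj_comp VF_tangent[OF assms] comp_apply)

lemma hf_VF: "X \<in> VF \<Longrightarrow> hf X \<in> VF"
  unfolding hf_field
  by (intro field_VF smooth_on_Pair smooth_on_minus smooth_nfun_along smooth_on_fst open_\<Omega> smooth_comp)

lemma vf_VS: "X \<in> VF \<Longrightarrow> vf X \<in> VS"
  unfolding vf_field
  by (intro field_VS smooth_on_Pair smooth_on_const smooth_on_add smooth_nfun_along smooth_on_fst smooth_on_snd
      open_\<Omega> smooth_comp) simp_all

lemma hf_apply: "X \<in> VF \<Longrightarrow> q \<in> U' \<Longrightarrow> hf X q C = (fst (X q C), - nfun (snd C q) (fst (X q C)))"
  by (simp add: sec_map_apply hproj_comp VF_tangent)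

lemma vf_apply: "X \<in> VF \<Longrightarrow> q \<in> U' \<Longrightarrow> vf X q C = (0, snd (X q C) + nfun (snd C q) (fst (X q C)))"
  by (simp add: sec_map_apply vproj_comp VF_tangent)

lemma J_horizontal_apply:
  assumes "q \<in> U'" "w \<in> tangent_space TA q"
  shows "J q (hproj A H q w) C = (0, K (fst (w C)))"
  using J_comp[OF assms(1) hproj_tangent[OF assms]] hproj_comp[OF assms] by (simp add: K_0 nfun_0 assms(1))

lemma J_horizontal_vertical:
  assumes "q \<in> U'" "w \<in> tangent_space TA q"
  shows "J q (hproj A H q w) \<in> vertical A q"
  using vertical_iff[OF c UC[OF assms(1)] J_tangent[OF assms(1) hproj_tangent[OF assms]]]
    J_horizontal_apply[OF assms] by simp

lemma J_vertical_apply: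
  assumes "q \<in> U'" "u \<in> vertical A q"
  shows "J q u C = (- K (snd (u C)), nfun (snd C q) (K (snd (u C))))"
proof -
  have u: "u \<in> tangent_space TA q" using vertical_subset assms(2) by blast
  have "fst (u C) = 0" using vertical_iff[OF c UC u] assms by simp
  then show ?thesis using J_comp[OF assms(1) u] by (simp add: nfun_0 assms(1) K_0)
qed

lemma jhf_field:
  assumes "X \<in> VF"
  shows "jf (hf X) = field (\<lambda>z. (0, K (fst (comp X z))))"
  by (rule field_eqI[OF sec_map_extensional])
    (simp_all add: sec_map_apply J_tangent hproj_tangent J_horizontal_apply VF_tangent[OF assms] comp_apply)

lemma jhf_VS: "X \<in> VF \<Longrightarrow> jf (hf X) \<in> VS"
  unfolding jhf_field
  by (intro field_VS smooth_on_Pair smooth_on_const smooth_K smooth_on_fst open_\<Omega> smooth_comp) simp_all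

lemma jhf_apply: "X \<in> VF \<Longrightarrow> q \<in> U' \<Longrightarrow> jf (hf X) q C = (0, K (fst (X q C)))"
  unfolding jhf_field by (simp add: field_apply comp_apply)

lemma zero_field_VS: "zero_field \<in> VS"
  by (intro field_VS smooth_on_const open_\<Omega>) simp

lemma zero_field_VF: "zero_field \<in> VF"
  by (rule VS_VF[OF zero_field_VS])

text \<open>By this and the following identities, D on two purely vertical or two purely horizontal
  fields collapses to one of its two terms.\<close>

lemma vf_hf: "X \<in> VF \<Longrightarrow> vf (hf X) = zero_field"
  by (rule VF_eqI[OF VS_VF[OF vf_VS] zero_field_VF]) (simp_all add: hf_VF vf_apply hf_apply field_apply)

lemma vf_VS_eq: "X \<in> VS \<Longrightarrow> vf X = X"
  by (rule VF_eqI[OF VS_VF[OF vf_VS[OF VS_VF]] VS_VF])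
    (simp_all add: VS_VF vf_apply VS_fst nfun_0 prod_eq_iff)

lemma jhf_VS_eq: "X \<in> VS \<Longrightarrow> jf (hf X) = zero_field"
  by (rule VF_eqI[OF VS_VF[OF jhf_VS[OF VS_VF]] zero_field_VF])
    (simp_all add: VS_VF jhf_apply VS_fst field_apply K_0)

lemma hf_hf: "X \<in> VF \<Longrightarrow> hf (hf X) = hf X"
  by (rule VF_eqI[OF hf_VF[OF hf_VF] hf_VF]) (simp_all add: hf_VF hf_apply)

lemma J_zero: "q \<in> U' \<Longrightarrow> J q 0 = 0"
  by (rule TM.tangent_space_eqI[OF J_tangent subspace_0[OF TM.subspace_tangent_space] C UC])
    (simp_all add: subspace_0[OF TM.subspace_tangent_space] J_comp nfun_0 K_0 zero_prod_def)

end

section \<open>Existence\<close>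

context local_geometry
begin

text \<open>The derivative along w of the metric coefficients, contracted with two fixed vectors:
  the \<open>D\<close> of the Koszul formula.\<close>

definition dG where "dG z w b d = b \<bullet> (frechet_derivative G (at z) w *v d)"

definition \<Gamma>v where "\<Gamma>v z = koszul (G z) (\<lambda>a. dG z (0, a)) (tens S z)"

text \<open>The argument a stands for the horizontal direction - J a, that is (K a, - N (K a)); the
  metric is differentiated in that direction.\<close>

definition \<Gamma>h where "\<Gamma>h z = koszul (G z) (\<lambda>a. dG z (K a, - nfun z (K a))) (tens T z)"

text \<open>The horizontal vector with first component \<open>\<xi>\<close> is \<open>- J\<close> of the vertical vector \<open>K \<xi>\<close>; in this
  parametrisation condition (ii) also has the form of a torsion condition.\<close>

definition chr where "chr z w u = \<Gamma>v z (snd w + nfun z (fst w)) u + \<Gamma>h z (K (fst w)) u"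

definition cov where "cov w u z = frechet_derivative u (at z) (w z) + chr z (w z) (u z)"

definition conn where "conn = (\<lambda>X\<in>VF. \<lambda>U\<in>VS. field (\<lambda>z. (0, cov (comp X) (\<lambda>z. snd (comp U z)) z)))"

lemma bounded_linear_inner_matrix: "bounded_linear (\<lambda>P :: real^'m^'m. b \<bullet> (P *v d))"
proof -
  have "linear (\<lambda>P :: real^'m^'m. b \<bullet> (P *v d))"
  proof (rule linearI)
    fix P Q :: "real^'m^'m" and r :: real
    show "b \<bullet> ((P + Q) *v d) = b \<bullet> (P *v d) + b \<bullet> (Q *v d)"
      by (simp add: matrix_vector_mult_add_rdistrib inner_add_right)
    have "(r *\<^sub>R P) *v d = r *\<^sub>R (P *v d)"
      by (simp add: scaleR_matrix_vector_assoc)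
    then show "b \<bullet> ((r *\<^sub>R P) *v d) = r *\<^sub>R (b \<bullet> (P *v d))" by simp
  qed
  then show ?thesis by (rule linear_conv_bounded_linear[THEN iffD1])
qed

lemma dG_has_derivative: "z \<in> \<Omega> \<Longrightarrow> ((\<lambda>z. b \<bullet> (G z *v d)) has_derivative (\<lambda>w. dG z w b d)) (at z)"
  unfolding dG_def by (rule bounded_linear.has_derivative[OF bounded_linear_inner_matrix smooth_on_has_derivative[OF smooth_G]])

lemma dG_sym:
  assumes "z \<in> \<Omega>"
  shows "dG z w b d = dG z w d b"
proof -
  have "((\<lambda>z. d \<bullet> (G z *v b)) has_derivative (\<lambda>w. dG z w b d)) (at z)"
  proof (rule has_derivative_transform_within_open[OF dG_has_derivative[OF assms] open_\<Omega> assms])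
    fix y assume "y \<in> \<Omega>"
    from symmetric_matrix_inner[OF G_sym[OF this], of b d] show "b \<bullet> (G y *v d) = d \<bullet> (G y *v b)"
      by (simp add: inner_commute)
  qed
  from has_derivative_unique[OF this dG_has_derivative[OF assms]] show ?thesis by (rule fun_cong)
qed

lemma dG_linear:
  assumes "z \<in> \<Omega>"
  shows "linear (\<lambda>w. dG z w b d)" "linear (\<lambda>b. dG z w b d)" "linear (\<lambda>d. dG z w b d)"
proof -
  show "linear (\<lambda>w. dG z w b d)" by (rule has_derivative_linear[OF dG_has_derivative[OF assms]])
  show "linear (\<lambda>b. dG z w b d)" unfolding dG_def by (simp add: linear_iff inner_add_left)
  then show "linear (\<lambda>d. dG z w b d)" unfolding dG_sym[OF assms, of w b]
    unfolding dG_def by (simp add: linear_iff inner_add_left)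
qed

lemma smooth_dG: "smooth_on \<Omega> w \<Longrightarrow> smooth_on \<Omega> (\<lambda>z. dG z (w z) b d)"
  unfolding dG_def
  by (intro smooth_on_inner smooth_on_matrix_vector_mult smooth_on_const smooth_on_frechet_along smooth_G open_\<Omega>)

lemma koszul_v:
  assumes z: "z \<in> \<Omega>"
  shows "koszul_data (G z) (\<lambda>a. dG z (0, a)) (tens S z)"
proof (rule koszul_data.intro)
  have "linear (\<lambda>a::real^'m. (0::real^'m, a))" by (simp add: linear_iff)
  from linear_compose[OF this dG_linear(1)[OF z]] show "linear (\<lambda>a. dG z (0, a) b d)" for b d
    by (simp add: o_def)
qed (rule G_sym[OF z] G_inv[OF z] dG_linear(2,3)[OF z] dG_sym[OF z] tens_linear_left[OF S z]
    tens_linear_right[OF S z] tens_skew[OF S z])+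

lemma koszul_h:
  assumes z: "z \<in> \<Omega>"
  shows "koszul_data (G z) (\<lambda>a. dG z (K a, - nfun z (K a))) (tens T z)"
proof (rule koszul_data.intro)
  have "linear (\<lambda>a. (K a, - nfun z (K a)))"
    using linear_K linear_nfun[OF z] by (simp add: linear_iff)
  from linear_compose[OF this dG_linear(1)[OF z]] show "linear (\<lambda>a. dG z (K a, - nfun z (K a)) b d)" for b d
    by (simp add: o_def)
qed (rule G_sym[OF z] G_inv[OF z] dG_linear(2,3)[OF z] dG_sym[OF z] tens_linear_left[OF T z]
    tens_linear_right[OF T z] tens_skew[OF T z])+

lemmas \<Gamma>v_linear = koszul_data.koszul_linear[OF koszul_v, folded \<Gamma>v_def]
lemmas \<Gamma>h_linear = koszul_data.koszul_linear[OF koszul_h, folded \<Gamma>h_def]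

lemma smooth_\<Gamma>v: "smooth_on \<Omega> u \<Longrightarrow> smooth_on \<Omega> w \<Longrightarrow> smooth_on \<Omega> (\<lambda>z. \<Gamma>v z (u z) (w z))"
proof (rule smooth_on_bilinear_family[OF open_\<Omega> \<Gamma>v_linear])
  show "smooth_on \<Omega> (\<lambda>z. \<Gamma>v z a b)" for a b
    unfolding \<Gamma>v_def
    by (intro smooth_on_koszul open_\<Omega> smooth_G G_inv smooth_dG smooth_on_const tens_smooth S)
qed

lemma smooth_\<Gamma>h: "smooth_on \<Omega> u \<Longrightarrow> smooth_on \<Omega> w \<Longrightarrow> smooth_on \<Omega> (\<lambda>z. \<Gamma>h z (u z) (w z))"
proof (rule smooth_on_bilinear_family[OF open_\<Omega> \<Gamma>h_linear])
  show "smooth_on \<Omega> (\<lambda>z. \<Gamma>h z a b)" for a b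
    unfolding \<Gamma>h_def
    by (intro smooth_on_koszul open_\<Omega> smooth_G G_inv smooth_dG smooth_on_Pair smooth_on_minus smooth_nfun_along
        smooth_on_const tens_smooth T)
qed

lemma chr_linear_left:
  assumes "z \<in> \<Omega>"
  shows "linear (\<lambda>w. chr z w u)"
  using linear_nfun[OF assms] linear_K \<Gamma>v_linear(1)[OF assms, of u] \<Gamma>h_linear(1)[OF assms, of u]
  unfolding chr_def by (simp add: linear_iff algebra_simps)

lemma chr_linear_right: "z \<in> \<Omega> \<Longrightarrow> linear (\<lambda>u. chr z w u)"
  unfolding chr_def by (intro linear_compose_add \<Gamma>v_linear(2) \<Gamma>h_linear(2))

lemma chr_vertical: "q \<in> U' \<Longrightarrow> chr (snd C q) (0, x) u = \<Gamma>v (snd C q) x u"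
  using linear_0[OF \<Gamma>h_linear(1)[OF \<Omega>I]] by (simp add: chr_def nfun_0 K_0)

lemma chr_horizontal: "q \<in> U' \<Longrightarrow> chr (snd C q) (\<xi>, - nfun (snd C q) \<xi>) u = \<Gamma>h (snd C q) (K \<xi>) u"
  using linear_0[OF \<Gamma>v_linear(1)[OF \<Omega>I]] by (simp add: chr_def)

lemma chr_metric:
  assumes "z \<in> \<Omega>"
  shows "chr z w u \<bullet> (G z *v v) + u \<bullet> (G z *v chr z w v) = dG z w u v"
proof -
  let ?x = "snd w + nfun z (fst w)" and ?y = "K (fst w)"
  have v: "\<Gamma>v z ?x u \<bullet> (G z *v v) + u \<bullet> (G z *v \<Gamma>v z ?x v) = dG z (0, ?x) u v"
    using koszul_data.koszul_metric[OF koszul_v[OF assms]] unfolding \<Gamma>v_def .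
  have h: "\<Gamma>h z ?y u \<bullet> (G z *v v) + u \<bullet> (G z *v \<Gamma>h z ?y v) = dG z (K ?y, - nfun z (K ?y)) u v"
    using koszul_data.koszul_metric[OF koszul_h[OF assms]] unfolding \<Gamma>h_def .
  \<comment> \<open>Vertical plus horizontal part; since K is an involution, the latter has the form
    that occurs in \<open>\<Gamma>h\<close>.\<close>
  have "w = (0, ?x) + (K ?y, - nfun z (K ?y))" by (simp add: K_K prod_eq_iff)
  then have "dG z w u v = dG z (0, ?x) u v + dG z (K ?y, - nfun z (K ?y)) u v"
    using linear_add[OF dG_linear(1)[OF assms]] by metis
  then show ?thesis
    unfolding v[symmetric] h[symmetric] chr_def
    by (simp add: inner_add_left inner_add_right matrix_vector_right_distrib)
qed

lemma smooth_cov: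
  assumes "smooth_on \<Omega> w" "smooth_on \<Omega> u"
  shows "smooth_on \<Omega> (cov w u)"
  unfolding cov_def[abs_def] chr_def
  by (intro smooth_on_add smooth_on_frechet_along smooth_\<Gamma>v smooth_\<Gamma>h smooth_nfun_along smooth_K smooth_on_fst
      smooth_on_snd open_\<Omega> assms)

lemma cov_eqI: "(u has_derivative u') (at z) \<Longrightarrow> cov w u z = u' (w z) + chr z (w z) (u z)"
  unfolding cov_def by (simp add: frechet_derivative_eqI)

lemma conn_eq: "X \<in> VF \<Longrightarrow> U \<in> VS \<Longrightarrow> conn X U = field (\<lambda>z. (0, cov (comp X) (\<lambda>z. snd (comp U z)) z))"
  by (simp add: conn_def)

lemma conn_VS: "X \<in> VF \<Longrightarrow> U \<in> VS \<Longrightarrow> conn X U \<in> VS"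
  unfolding conn_eq
  by (intro field_VS smooth_on_Pair smooth_on_const smooth_cov smooth_on_snd smooth_comp open_\<Omega>) simp_all

lemma conn_apply:
  assumes "X \<in> VF" "U \<in> VS" "q \<in> U'" "((\<lambda>z. snd (comp U z)) has_derivative u') (at (snd C q))"
  shows "conn X U q C = (0, u' (X q C) + chr (snd C q) (X q C) (snd (U q C)))"
  using cov_eqI[OF assms(4), of "comp X"] by (simp add: conn_eq assms field_apply comp_apply)

lemma snd_derivative:
  assumes "X \<in> VS" "q \<in> U'"
  shows "((\<lambda>z. snd (comp X z)) has_derivative frechet_derivative (\<lambda>z. snd (comp X z)) (at (snd C q))) (at (snd C q))"
  by (rule smooth_on_has_derivative[OF smooth_on_snd[OF open_\<Omega> smooth_comp[OF assms(1)]] \<Omega>I[OF assms(2)]])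

lemma linear_connection_conn: "linear_connection TA U' (vertical A) conn"
  unfolding linear_connection_def
proof (intro conjI ballI allI impI)
  show "conn \<in> VF \<rightarrow>\<^sub>E VS \<rightarrow>\<^sub>E VS"
    using conn_VS by (auto simp: PiE_def extensional_def conn_def)
next
  fix X X' U assume X: "X \<in> VF" "X' \<in> VF" and U: "U \<in> VS"
  show "conn (sec_add U' X X') U = sec_add U' (conn X U) (conn X' U)"
  proof (rule VF_eqI)
    fix q assume q: "q \<in> U'"
    note d = snd_derivative[OF U q]
    show "conn (sec_add U' X X') U q C = sec_add U' (conn X U) (conn X' U) q C"
      using linear_add[OF chr_linear_left[OF \<Omega>I[OF q]]] linear_add[OF has_derivative_linear[OF d]]
      by (simp add: sec_add_apply[OF q] conn_apply[OF _ U q d] X sec_add_VF)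
  qed (intro VS_VF sec_add_VS conn_VS sec_add_VF X U)+
next
  fix f X U assume X: "X \<in> VF" and U: "U \<in> VS" and f: "smooth_function TA U' f"
  show "conn (sec_scale U' f X) U = sec_scale U' f (conn X U)"
  proof (rule VF_eqI)
    fix q assume q: "q \<in> U'"
    note d = snd_derivative[OF U q]
    show "conn (sec_scale U' f X) U q C = sec_scale U' f (conn X U) q C"
      using linear_scale[OF chr_linear_left[OF \<Omega>I[OF q]]] linear_scale[OF has_derivative_linear[OF d]]
      by (simp add: sec_scale_apply[OF q] conn_apply[OF _ U q d] X f sec_scale_VF scaleR_add_right)
  qed (intro VS_VF sec_scale_VS conn_VS sec_scale_VF X U f)+
next
  fix X U U2 assume X: "X \<in> VF" and U: "U \<in> VS" "U2 \<in> VS"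
  show "conn X (sec_add U' U U2) = sec_add U' (conn X U) (conn X U2)"
  proof (rule VF_eqI)
    fix q assume q: "q \<in> U'"
    note d = snd_derivative[OF U(1) q] snd_derivative[OF U(2) q]
    have d3: "((\<lambda>z. snd (comp (sec_add U' U U2) z)) has_derivative (\<lambda>w.
        frechet_derivative (\<lambda>z. snd (comp U z)) (at (snd C q)) w +
        frechet_derivative (\<lambda>z. snd (comp U2 z)) (at (snd C q)) w)) (at (snd C q))"
      by (rule has_derivative_transform_within_open[OF has_derivative_add[OF d] open_\<Omega> \<Omega>I[OF q]])
        (simp add: comp_def sec_add_apply inv_C_in)
    show "conn X (sec_add U' U U2) q C = sec_add U' (conn X U) (conn X U2) q C"
      using linear_add[OF chr_linear_right[OF \<Omega>I[OF q]]]
      by (simp add: sec_add_apply[OF q] conn_apply[OF X U(1) q d(1)] conn_apply[OF X U(2) q d(2)]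
          conn_apply[OF X sec_add_VS[OF U] q d3])
  qed (intro VS_VF sec_add_VS conn_VS X U)+
next
  fix f X U assume X: "X \<in> VF" and U: "U \<in> VS" and f: "smooth_function TA U' f"
  have d: "((f \<circ> chart_inv C) has_derivative frechet_derivative (f \<circ> chart_inv C) (at (snd C q))) (at (snd C q))"
    if "q \<in> U'" for q
    by (rule smooth_on_has_derivative[OF smooth_function_chart[OF f] \<Omega>I[OF that]])
  have t: "tderiv TA q (X q) f = frechet_derivative (f \<circ> chart_inv C) (at (snd C q)) (X q C)" if "q \<in> U'" for q
    by (rule TM.tderiv_chart[OF C UC[OF that] VF_tangent[OF X that] d[OF that]])
  \<comment> \<open>Smoothness of the derivative of f makes the right-hand side of the Leibniz rule
    a section, as the comparison through \<open>VF_eqI\<close> demands.\<close>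
  have sf: "smooth_function TA U' (\<lambda>p. tderiv TA p (X p) f)"
  proof (rule TM.smooth_functionI)
    fix q assume q: "q \<in> U'"
    have "smooth_on \<Omega> (\<lambda>z. frechet_derivative (f \<circ> chart_inv C) (at z) (comp X z))"
      by (rule smooth_on_frechet_along[OF open_\<Omega> smooth_function_chart[OF f] smooth_comp[OF X]])
    then have "smooth_on \<Omega> ((\<lambda>p. tderiv TA p (X p) f) \<circ> chart_inv C)"
      by (rule smooth_on_cong[OF open_\<Omega>, rotated]) (simp add: t inv_C_in C_inv comp_def)
    then show "\<exists>D\<in>TA. q \<in> fst D \<and> (\<exists>S. open S \<and> snd D q \<in> S \<and> smooth_on S ((\<lambda>p. tderiv TA p (X p) f) \<circ> chart_inv D))"
      by (intro bexI[OF _ C] conjI UC q exI[of _ \<Omega>] open_\<Omega> \<Omega>I)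
  qed
  show "conn X (sec_scale U' f U) = sec_add U' (sec_scale U' f (conn X U)) (sec_scale U' (\<lambda>p. tderiv TA p (X p) f) U)"
  proof (rule VF_eqI)
    fix q assume q: "q \<in> U'"
    note du = snd_derivative[OF U q]
    have d3: "((\<lambda>z. snd (comp (sec_scale U' f U) z)) has_derivative (\<lambda>w.
        (f \<circ> chart_inv C) (snd C q) *\<^sub>R frechet_derivative (\<lambda>z. snd (comp U z)) (at (snd C q)) w +
        frechet_derivative (f \<circ> chart_inv C) (at (snd C q)) w *\<^sub>R snd (comp U (snd C q)))) (at (snd C q))"
      by (rule has_derivative_transform_within_open[OF has_derivative_scaleR[OF d[OF q] du] open_\<Omega> \<Omega>I[OF q]])
        (simp add: comp_def sec_scale_apply inv_C_in)
    show "conn X (sec_scale U' f U) q C =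
        sec_add U' (sec_scale U' f (conn X U)) (sec_scale U' (\<lambda>p. tderiv TA p (X p) f) U) q C"
      using linear_scale[OF chr_linear_right[OF \<Omega>I[OF q]]] VS_fst[OF U q]
      by (simp add: sec_add_apply[OF q] sec_scale_apply[OF q] conn_apply[OF X U q du]
          conn_apply[OF X sec_scale_VS[OF f U] q d3] t[OF q] inv_C[OF q] comp_apply[OF q] prod_eq_iff scaleR_add_right)
  qed (intro VS_VF sec_add_VS sec_scale_VS conn_VS X U f sf)+
qed

text \<open>The product rule for u . (G w) has three terms; \<open>chr_metric\<close> distributes
  the one with the derivative of G over the other two, turning flat derivatives into covariant
  ones.\<close>

lemma conn_metric:
  assumes X: "X \<in> VF" and U: "U \<in> VS" and W: "W \<in> VS" and q: "q \<in> U'"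
  shows "tderiv TA q (X q) (\<lambda>p. g p (U p) (W p)) = g q (conn X U q) (W q) + g q (U q) (conn X W q)"
proof -
  let ?u = "\<lambda>z. snd (comp U z)" and ?w = "\<lambda>z. snd (comp W z)" and ?z = "snd C q"
  let ?u' = "frechet_derivative ?u (at ?z)" and ?w' = "frechet_derivative ?w (at ?z)" and ?G' = "frechet_derivative G (at ?z)"
  note du = snd_derivative[OF U q] and dw = snd_derivative[OF W q]
  have dG: "(G has_derivative ?G') (at ?z)" by (rule smooth_on_has_derivative[OF smooth_G \<Omega>I[OF q]])
  have bb: "bounded_bilinear (\<lambda>(P::real^'m^'m) (x::real^'m). P *v x)"
    unfolding bilinear_conv_bounded_bilinear[symmetric] bilinear_def
    by (auto intro!: linearI simp: matrix_vector_mult_add_rdistrib matrix_vector_right_distrib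
        matrix_vector_mult_scaleR scaleR_matrix_vector_assoc)
  have "((\<lambda>z. ?u z \<bullet> (G z *v ?w z)) has_derivative
      (\<lambda>v. ?u ?z \<bullet> (G ?z *v ?w' v + ?G' v *v ?w ?z) + ?u' v \<bullet> (G ?z *v ?w ?z))) (at ?z)"
    by (rule has_derivative_inner[OF du bounded_bilinear.FDERIV[OF bb dG dw]])
  then have "(((\<lambda>p. g p (U p) (W p)) \<circ> chart_inv C) has_derivative
      (\<lambda>v. ?u ?z \<bullet> (G ?z *v ?w' v + ?G' v *v ?w ?z) + ?u' v \<bullet> (G ?z *v ?w ?z))) (at ?z)"
    by (rule has_derivative_transform_within_open[OF _ open_\<Omega> \<Omega>I[OF q]])
      (simp add: g_comp inv_C_in VS_vertical[OF U] VS_vertical[OF W] comp_def C_inv)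
  from TM.tderiv_chart[OF C UC[OF q] VF_tangent[OF X q] this]
  have "tderiv TA q (X q) (\<lambda>p. g p (U p) (W p)) =
      ?u ?z \<bullet> (G ?z *v ?w' (X q C)) + dG ?z (X q C) (?u ?z) (?w ?z) + ?u' (X q C) \<bullet> (G ?z *v ?w ?z)"
    by (simp add: dG_def inner_add_right)
  also have "\<dots> = g q (conn X U q) (W q) + g q (U q) (conn X W q)"
    unfolding chr_metric[OF \<Omega>I[OF q], symmetric]
    using g_comp[OF q VS_vertical[OF conn_VS[OF X U] q] VS_vertical[OF W q]]
      g_comp[OF q VS_vertical[OF U q] VS_vertical[OF conn_VS[OF X W] q]]
    by (simp add: conn_apply[OF X U q du] conn_apply[OF X W q dw] comp_apply[OF q] inner_add_left inner_add_right
        matrix_vector_right_distrib)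
  finally show ?thesis .
qed

end

section \<open>The torsion conditions and uniqueness\<close>

context local_geometry
begin

abbreviation "lc \<equiv> linear_connection TA U' (vertical A)"
abbreviation "ind \<equiv> induced_connection A H U' J"

lemma lc_PiE: "lc nabla \<Longrightarrow> nabla \<in> VF \<rightarrow>\<^sub>E VS \<rightarrow>\<^sub>E VS"
  unfolding linear_connection_def by (rule conjunct1)

lemma lc_VS: "lc nabla \<Longrightarrow> X \<in> VF \<Longrightarrow> U \<in> VS \<Longrightarrow> nabla X U \<in> VS"
  by (rule PiE_mem[OF PiE_mem[OF lc_PiE]])

lemma lc_add_left: "lc nabla \<Longrightarrow> X \<in> VF \<Longrightarrow> X' \<in> VF \<Longrightarrow> U \<in> VS \<Longrightarrow>
    nabla (sec_add U' X X') U = sec_add U' (nabla X U) (nabla X' U)"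
  and lc_add_right: "lc nabla \<Longrightarrow> X \<in> VF \<Longrightarrow> U \<in> VS \<Longrightarrow> U2 \<in> VS \<Longrightarrow>
    nabla X (sec_add U' U U2) = sec_add U' (nabla X U) (nabla X U2)"
  unfolding linear_connection_def by blast+

text \<open>The zero section is its own double, so additivity gives x = x + x.\<close>

lemma lc_zero:
  assumes "lc nabla" "X \<in> VF" "q \<in> U'"
  shows "nabla X zero_field q = 0"
proof -
  have "sec_add U' zero_field zero_field = zero_field"
    by (rule VF_eqI[OF sec_add_VF[OF zero_field_VF zero_field_VF] zero_field_VF])
      (simp add: sec_add_apply field_apply)
  then have "nabla X zero_field q = sec_add U' (nabla X zero_field) (nabla X zero_field) q"
    using lc_add_right[OF assms(1,2) zero_field_VS zero_field_VS] by simp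
  then show ?thesis using assms(3) by (simp add: sec_add_def)
qed

lemma ind_apply: "q \<in> U' \<Longrightarrow> ind nabla X Y q = nabla X (vf Y) q - J q (nabla X (jf (hf Y)) q)"
  by (simp add: induced_connection_def)

lemma ind_vf:
  assumes "lc nabla" "X \<in> VF" "Y \<in> VF" "q \<in> U'"
  shows "ind nabla (vf X) (vf Y) q = nabla (vf X) (vf Y) q"
  using lc_zero[OF assms(1) VS_VF[OF vf_VS[OF assms(2)]] assms(4)]
  by (simp add: ind_apply assms vf_VS_eq vf_VS jhf_VS_eq J_zero)

lemma ind_hf:
  assumes "lc nabla" "X \<in> VF" "Y \<in> VF" "q \<in> U'"
  shows "ind nabla (hf X) (hf Y) q = - J q (nabla (hf X) (jf (hf Y)) q)"
  using lc_zero[OF assms(1) hf_VF[OF assms(2)] assms(4)]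
  by (simp add: ind_apply assms vf_hf hf_hf)

lemma lc_tangent: "lc nabla \<Longrightarrow> X \<in> VF \<Longrightarrow> U \<in> VS \<Longrightarrow> q \<in> U' \<Longrightarrow> nabla X U q \<in> tangent_space TA q"
  by (rule VF_tangent[OF VS_VF[OF lc_VS]])

lemma torsion_vf:
  assumes "lc nabla" "X \<in> VF" "Y \<in> VF" "q \<in> U'"
  shows "torsion TA (ind nabla) (vf X) (vf Y) q \<in> tangent_space TA q"
    "torsion TA (ind nabla) (vf X) (vf Y) q =
      nabla (vf X) (vf Y) q - nabla (vf Y) (vf X) q - lie_bracket TA (vf X) (vf Y) q"
proof -
  note V = vf_VS[OF assms(2)] vf_VS[OF assms(3)]
  note i = ind_vf[OF assms(1,2,3,4)] ind_vf[OF assms(1,3,2,4)]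
  show "torsion TA (ind nabla) (vf X) (vf Y) q \<in> tangent_space TA q"
    by (rule torsion_tangent[OF VS_VF[OF V(1)] VS_VF[OF V(2)] assms(4)])
      (simp_all add: i lc_tangent[OF assms(1) VS_VF[OF V(1)] V(2) assms(4)] lc_tangent[OF assms(1) VS_VF[OF V(2)] V(1) assms(4)])
  show "torsion TA (ind nabla) (vf X) (vf Y) q =
      nabla (vf X) (vf Y) q - nabla (vf Y) (vf X) q - lie_bracket TA (vf X) (vf Y) q"
    by (simp add: torsion_def i)
qed

lemma J_VS_fst: "V \<in> VS \<Longrightarrow> q \<in> U' \<Longrightarrow> fst (J q (V q) C) = - K (snd (V q C))"
  using J_vertical_apply[OF _ VS_vertical] by simp

text \<open>Only the base component is recorded: it determines the horizontal part, and the
  curvature of H, which sits in the vertical part of the bracket, does not enter it.\<close>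

lemma torsion_hf:
  assumes "lc nabla" "X \<in> VF" "Y \<in> VF" "q \<in> U'"
  shows "torsion TA (ind nabla) (hf X) (hf Y) q \<in> tangent_space TA q"
    "fst (torsion TA (ind nabla) (hf X) (hf Y) q C) =
      K (snd (nabla (hf X) (jf (hf Y)) q C)) - K (snd (nabla (hf Y) (jf (hf X)) q C)) -
      fst (lie_bracket TA (hf X) (hf Y) q C)"
proof -
  note V = hf_VF[OF assms(2)] hf_VF[OF assms(3)]
  note N = lc_VS[OF assms(1) V(1) jhf_VS[OF assms(3)]] lc_VS[OF assms(1) V(2) jhf_VS[OF assms(2)]]
  note i = ind_hf[OF assms(1,2,3,4)] ind_hf[OF assms(1,3,2,4)]
  show "torsion TA (ind nabla) (hf X) (hf Y) q \<in> tangent_space TA q"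
    by (rule torsion_tangent[OF V assms(4)], unfold i)
      (intro subspace_neg TM.subspace_tangent_space J_tangent VF_tangent[OF VS_VF] N assms(4))+
  show "fst (torsion TA (ind nabla) (hf X) (hf Y) q C) =
      K (snd (nabla (hf X) (jf (hf Y)) q C)) - K (snd (nabla (hf Y) (jf (hf X)) q C)) -
      fst (lie_bracket TA (hf X) (hf Y) q C)"
    using J_VS_fst[OF N(1) assms(4)] J_VS_fst[OF N(2) assms(4)] by (simp add: torsion_def i)
qed

text \<open>The flat derivatives inside the two covariant ones are those of the bracket and cancel;
  what remains is the skew part of \<open>\<Gamma>v\<close>, evaluated by
  \<open>koszul_torsion\<close>.\<close>

lemma conn_torsion_v:
  assumes "X \<in> VF" "Y \<in> VF" "q \<in> U'"
  shows "torsion TA (ind conn) (vf X) (vf Y) q = tensor_at A M' S q (vproj A H q (X q)) (vproj A H q (Y q))"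
proof -
  let ?x = "snd (vf X q C)" and ?y = "snd (vf Y q C)" and ?z = "snd C q"
  note t = torsion_vf[OF linear_connection_conn assms]
  note V = vf_VS[OF assms(1)] vf_VS[OF assms(2)]
  note P = VS_pair[OF V(1) assms(3)] VS_pair[OF V(2) assms(3)]
  note dx = fst_frechet_comp[OF VS_VF[OF V(1)] assms(3)] and dy = fst_frechet_comp[OF VS_VF[OF V(2)] assms(3)]
  have v: "vproj A H q (X q) \<in> vertical A q" "vproj A H q (Y q) \<in> vertical A q"
    by (intro vproj_vertical assms(3) VF_tangent assms)+
  have S_apply: "tensor_at A M' S q (vproj A H q (X q)) (vproj A H q (Y q)) C = (0, tens S ?z ?x ?y)"
    using tens_comp[OF S assms(3) v] by (simp add: sec_map_apply assms(3))
  have S_tan: "tensor_at A M' S q (vproj A H q (X q)) (vproj A H q (Y q)) \<in> tangent_space TA q"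
    using skew_tensor.tensor_at_vertical[OF S UM[OF assms(3)] v] vertical_subset by blast
  have "torsion TA (ind conn) (vf X) (vf Y) q C = (0, tens S ?z ?x ?y)"
  proof (rule prod_eqI)
    \<comment> \<open>Vertical fields have constant base component 0, so their bracket is
      vertical.\<close>
    have z: "fst (frechet_derivative (comp Z) (at ?z) w) = 0" if "Z \<in> VS" for Z w
    proof -
      have "((\<lambda>z. fst (comp Z z)) has_derivative (\<lambda>w. 0)) (at ?z)"
        by (rule has_derivative_transform_within_open[OF _ open_\<Omega> \<Omega>I[OF assms(3)], where f="\<lambda>z. 0"])
          (simp_all add: comp_def VS_fst[OF that] inv_C_in)
      from fun_cong[OF has_derivative_unique[OF fst_frechet_comp(1)[OF VS_VF[OF that] assms(3)] this]]
      show ?thesis .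
    qed
    show "fst (torsion TA (ind conn) (vf X) (vf Y) q C) = fst (0, tens S ?z ?x ?y)"
      unfolding t(2) using lie_bracket_comp[OF VS_VF[OF V(1)] VS_VF[OF V(2)] assms(3)]
      by (simp add: z[OF V(1)] z[OF V(2)] VS_fst[OF conn_VS[OF VS_VF[OF V(1)] V(2)] assms(3)]
          VS_fst[OF conn_VS[OF VS_VF[OF V(2)] V(1)] assms(3)])
    have "snd (torsion TA (ind conn) (vf X) (vf Y) q C) = chr ?z (vf X q C) ?y - chr ?z (vf Y q C) ?x"
      unfolding t(2) using lie_bracket_comp[OF VS_VF[OF V(1)] VS_VF[OF V(2)] assms(3)]
      by (simp add: conn_apply[OF VS_VF[OF V(1)] V(2) assms(3) dy(2)] conn_apply[OF VS_VF[OF V(2)] V(1) assms(3) dx(2)])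
    also have "\<dots> = \<Gamma>v ?z ?x ?y - \<Gamma>v ?z ?y ?x"
      using chr_vertical[OF assms(3), of ?x ?y] chr_vertical[OF assms(3), of ?y ?x] P by simp
    also have "\<dots> = tens S ?z ?x ?y"
      unfolding \<Gamma>v_def by (rule koszul_data.koszul_torsion[OF koszul_v[OF \<Omega>I[OF assms(3)]]])
    finally show "snd (torsion TA (ind conn) (vf X) (vf Y) q C) = snd (0, tens S ?z ?x ?y)" by simp
  qed
  with S_apply have "torsion TA (ind conn) (vf X) (vf Y) q C = tensor_at A M' S q (vproj A H q (X q)) (vproj A H q (Y q)) C"
    by simp
  then show ?thesis by (rule TM.tangent_space_eqI[OF t(1) S_tan C UC[OF assms(3)]])
qed

text \<open>As for vertical fields, once K is removed: K is constant, hence commutes with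
  differentiation, and the K contributed by the outer J cancels the one in \<open>jf (hf Y)\<close>.
  The remaining skew part of \<open>\<Gamma>h\<close> is T.\<close>

lemma conn_torsion_h:
  assumes "X \<in> VF" "Y \<in> VF" "q \<in> U'"
  shows "hproj A H q (torsion TA (ind conn) (hf X) (hf Y) q) =
    J q (tensor_at A M' T q (J q (hproj A H q (Y q))) (J q (hproj A H q (X q))))"
proof -
  let ?z = "snd C q" and ?\<xi> = "fst (X q C)" and ?\<eta> = "fst (Y q C)"
  note t = torsion_hf[OF linear_connection_conn assms]
  note tanX = VF_tangent[OF assms(1,3)] and tanY = VF_tangent[OF assms(2,3)]
  let ?T = "tensor_at A M' T q (J q (hproj A H q (Y q))) (J q (hproj A H q (X q)))"
  have v: "J q (hproj A H q (X q)) \<in> vertical A q" "J q (hproj A H q (Y q)) \<in> vertical A q"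
    by (intro J_horizontal_vertical assms(3) tanX tanY)+
  have Tv: "?T \<in> vertical A q"
    by (rule skew_tensor.tensor_at_vertical[OF T UM[OF assms(3)] v(2,1)])
  have "?T C = (0, tens T ?z (K ?\<eta>) (K ?\<xi>))"
    using tens_comp[OF T assms(3) v(2,1)]
    by (simp add: J_horizontal_apply[OF assms(3) tanX] J_horizontal_apply[OF assms(3) tanY])
  then have JT: "J q ?T C = (- K (tens T ?z (K ?\<eta>) (K ?\<xi>)), nfun ?z (K (tens T ?z (K ?\<eta>) (K ?\<xi>))))"
    using J_vertical_apply[OF assms(3) Tv] by simp
  have JT_tan: "J q ?T \<in> tangent_space TA q"
    using J_tangent[OF assms(3)] Tv vertical_subset by blast
  have conn: "snd (conn (hf X') (jf (hf Y')) q C) =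
      K (fst (frechet_derivative (comp (hf Y')) (at ?z) (hf X' q C))) + \<Gamma>h ?z (K (fst (X' q C))) (K (fst (Y' q C)))"
    if "X' \<in> VF" "Y' \<in> VF" for X' Y'
  proof -
    have "((\<lambda>z. K (fst (comp (hf Y') z))) has_derivative
        (\<lambda>w. K (fst (frechet_derivative (comp (hf Y')) (at ?z) w)))) (at ?z)"
      by (rule bounded_linear.has_derivative[OF linear_conv_bounded_linear[THEN iffD1, OF linear_K]
            fst_frechet_comp(1)[OF hf_VF[OF that(2)] assms(3)]])
    then have "((\<lambda>z. snd (comp (jf (hf Y')) z)) has_derivative
        (\<lambda>w. K (fst (frechet_derivative (comp (hf Y')) (at ?z) w)))) (at ?z)"
      by (rule has_derivative_transform_within_open[OF _ open_\<Omega> \<Omega>I[OF assms(3)]])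
        (simp add: comp_def hf_apply[OF that(2)] jhf_apply[OF that(2)] inv_C_in)
    from conn_apply[OF hf_VF[OF that(1)] jhf_VS[OF that(2)] assms(3) this]
    show ?thesis
      using chr_horizontal[OF assms(3), of "fst (X' q C)"]
      by (simp add: hf_apply[OF that(1) assms(3)] jhf_apply[OF that(2) assms(3)])
  qed
  have "fst (torsion TA (ind conn) (hf X) (hf Y) q C) = K (\<Gamma>h ?z (K ?\<xi>) (K ?\<eta>) - \<Gamma>h ?z (K ?\<eta>) (K ?\<xi>))"
    unfolding t(2) conn[OF assms(1,2)] conn[OF assms(2,1)] lie_bracket_comp[OF hf_VF[OF assms(1)] hf_VF[OF assms(2)] assms(3)]
    by (simp add: K_add K_diff K_K)
  also have "\<Gamma>h ?z (K ?\<xi>) (K ?\<eta>) - \<Gamma>h ?z (K ?\<eta>) (K ?\<xi>) = tens T ?z (K ?\<xi>) (K ?\<eta>)"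
    unfolding \<Gamma>h_def by (rule koszul_data.koszul_torsion[OF koszul_h[OF \<Omega>I[OF assms(3)]]])
  \<comment> \<open>J contributes - K on vertical vectors; the reversed arguments of T in condition
    (ii) supply the matching sign.\<close>
  also have "\<dots> = - tens T ?z (K ?\<eta>) (K ?\<xi>)" by (rule tens_skew[OF T \<Omega>I[OF assms(3)]])
  finally have "fst (torsion TA (ind conn) (hf X) (hf Y) q C) = - K (tens T ?z (K ?\<eta>) (K ?\<xi>))"
    by (simp add: K_minus)
  then have "hproj A H q (torsion TA (ind conn) (hf X) (hf Y) q) C = J q ?T C"
    unfolding hproj_comp[OF assms(3) t(1)] JT by (simp add: linear_neg[OF linear_nfun[OF \<Omega>I[OF assms(3)]]])
  then show ?thesis by (rule TM.tangent_space_eqI[OF hproj_tangent[OF assms(3) t(1)] JT_tan C UC[OF assms(3)]])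
qed

text \<open>Shaped exactly like the conditions of the theorem, so that unfolding it at the end
  yields the statement.\<close>

definition is_solution where
  "is_solution nabla \<longleftrightarrow> lc nabla \<and>
    (\<forall>X\<in>VF. \<forall>U\<in>VS. \<forall>W\<in>VS. \<forall>p\<in>U'. tderiv TA p (X p) (\<lambda>p. g p (U p) (W p)) =
      g p (nabla X U p) (W p) + g p (U p) (nabla X W p)) \<and>
    (\<forall>X\<in>VF. \<forall>Y\<in>VF. \<forall>p\<in>U'.
      torsion TA (ind nabla) (vf X) (vf Y) p = tensor_at A M' S p (vproj A H p (X p)) (vproj A H p (Y p)) \<and>
      hproj A H p (torsion TA (ind nabla) (hf X) (hf Y) p) =
        J p (tensor_at A M' T p (J p (hproj A H p (Y p))) (J p (hproj A H p (X p)))))"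

lemma is_solution_conn: "is_solution conn"
  unfolding is_solution_def
  by (intro conjI ballI linear_connection_conn conn_metric conn_torsion_v conn_torsion_h)

text \<open>Alternating the two transpositions, three of each, leads back to the start with three
  sign changes, so f = - f. The arguments range over a set \<open>X\<close> because they will be
  sections.\<close>

lemma braid_zero:
  fixes f :: "'b \<Rightarrow> 'b \<Rightarrow> 'b \<Rightarrow> real"
  assumes "\<And>U V W. U \<in> X \<Longrightarrow> V \<in> X \<Longrightarrow> W \<in> X \<Longrightarrow> f U V W = f V U W"
    and "\<And>U V W. U \<in> X \<Longrightarrow> V \<in> X \<Longrightarrow> W \<in> X \<Longrightarrow> f U V W = - f U W V"
    and "U \<in> X" "V \<in> X" "W \<in> X"
  shows "f U V W = 0"
  using assms(1)[of U V W] assms(2)[of V U W] assms(1)[of V W U] assms(2)[of W V U] assms(1)[of W U V]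
    assms(2)[of U W V] assms(3-5) by simp

lemma is_solution_lc: "is_solution nabla \<Longrightarrow> lc nabla"
  unfolding is_solution_def by (rule conjunct1)

lemma is_solution_metric:
  assumes "is_solution nabla" "X \<in> VF" "U \<in> VS" "W \<in> VS" "q \<in> U'"
  shows "tderiv TA q (X q) (\<lambda>p. g p (U p) (W p)) = g q (nabla X U q) (W q) + g q (U q) (nabla X W q)"
  using assms(1)[unfolded is_solution_def, THEN conjunct2, THEN conjunct1, THEN bspec, OF assms(2),
      THEN bspec, OF assms(3), THEN bspec, OF assms(4), THEN bspec, OF assms(5)] .

lemma is_solution_torsion:
  assumes "is_solution nabla" "X \<in> VF" "Y \<in> VF" "q \<in> U'"
  shows "torsion TA (ind nabla) (vf X) (vf Y) q = tensor_at A M' S q (vproj A H q (X q)) (vproj A H q (Y q))"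
    "hproj A H q (torsion TA (ind nabla) (hf X) (hf Y) q) =
      J q (tensor_at A M' T q (J q (hproj A H q (Y q))) (J q (hproj A H q (X q))))"
  using assms(1)[unfolded is_solution_def, THEN conjunct2, THEN conjunct2, THEN bspec, OF assms(2),
      THEN bspec, OF assms(3), THEN bspec, OF assms(4)]
  by (rule conjunct1, rule conjunct2)

text \<open>A connection is known on sections only, so the form f takes sections and is evaluated at
  q. To have three arguments of the same kind, horizontal directions are replaced by the vertical
  sections they come from through \<open>lift\<close>.\<close>

lemma solution_unique_at:
  assumes sol: "is_solution n1" "is_solution n2" and X: "X \<in> VF" and U: "U \<in> VS" and q: "q \<in> U'"
  shows "n1 X U q = n2 X U q"
proof -
  let ?z = "snd C q"
  note lc = is_solution_lc[OF sol(1)] is_solution_lc[OF sol(2)]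
  define b where "b X U = snd (n1 X U q C) - snd (n2 X U q C)" for X U
  define f where "f X U W = b X U \<bullet> (G ?z *v snd (W q C))" for X U
    and W :: "('a, real^'m) tpoint \<Rightarrow> ('a, real^'m) ttvec"
  have skew: "f X U W = - f X W U" if "X \<in> VF" "U \<in> VS" "W \<in> VS" for X U W
  proof -
    have m: "g q (n1 X U q) (W q) + g q (U q) (n1 X W q) = g q (n2 X U q) (W q) + g q (U q) (n2 X W q)"
      using is_solution_metric[OF sol(1) that q] is_solution_metric[OF sol(2) that q] by (rule trans[OF sym])
    have e: "g q (n X U q) (W q) + g q (U q) (n X W q) =
        snd (n X U q C) \<bullet> (G ?z *v snd (W q C)) + snd (n X W q C) \<bullet> (G ?z *v snd (U q C))" if "lc n" for n
    proof -
      have "snd (U q C) \<bullet> (G ?z *v snd (n X W q C)) = snd (n X W q C) \<bullet> (G ?z *v snd (U q C))"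
        using symmetric_matrix_inner[OF G_sym[OF \<Omega>I[OF q]], of "snd (U q C)" "snd (n X W q C)"]
        by (simp add: inner_commute)
      then show ?thesis
        using g_comp[OF q VS_vertical[OF lc_VS[OF that \<open>X \<in> VF\<close> \<open>U \<in> VS\<close>] q] VS_vertical[OF \<open>W \<in> VS\<close> q]]
          g_comp[OF q VS_vertical[OF \<open>U \<in> VS\<close> q] VS_vertical[OF lc_VS[OF that \<open>X \<in> VF\<close> \<open>W \<in> VS\<close>] q]] by simp
    qed
    show ?thesis
      using m[unfolded e[OF lc(1)] e[OF lc(2)]] by (simp add: f_def b_def inner_diff_left)
  qed
  have sym_v: "b U V = b V U" if "U \<in> VS" "V \<in> VS" for U V
  proof -
    note UV = VS_VF[OF that(1)] VS_VF[OF that(2)]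
    have "torsion TA (ind n1) (vf U) (vf V) q = torsion TA (ind n2) (vf U) (vf V) q"
      unfolding is_solution_torsion(1)[OF sol(1) UV q] is_solution_torsion(1)[OF sol(2) UV q] ..
    then have "n1 U V q - n1 V U q = n2 U V q - n2 V U q"
      unfolding torsion_vf(2)[OF lc(1) UV q] torsion_vf(2)[OF lc(2) UV q]
      unfolding vf_VS_eq[OF that(1)] vf_VS_eq[OF that(2)] by simp
    then have "(n1 U V q - n1 V U q) C = (n2 U V q - n2 V U q) C" by (rule fun_cong)
    then show ?thesis by (simp add: b_def prod_eq_iff algebra_simps)
  qed
  have sym_h: "b (hf X) (jf (hf Y)) = b (hf Y) (jf (hf X))" if "X \<in> VF" "Y \<in> VF" for X Y
  proof -
    have "hproj A H q (torsion TA (ind n1) (hf X) (hf Y) q) = hproj A H q (torsion TA (ind n2) (hf X) (hf Y) q)"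
      unfolding is_solution_torsion(2)[OF sol(1) that q] is_solution_torsion(2)[OF sol(2) that q] ..
    then have "fst (torsion TA (ind n1) (hf X) (hf Y) q C) = fst (torsion TA (ind n2) (hf X) (hf Y) q C)"
      using arg_cong[of _ _ "\<lambda>w. fst (w C)"] hproj_comp[OF q torsion_hf(1)[OF lc(1) that q]]
        hproj_comp[OF q torsion_hf(1)[OF lc(2) that q]]
      by fastforce
    then have "K (b (hf X) (jf (hf Y)) - b (hf Y) (jf (hf X))) = 0"
      unfolding torsion_hf(2)[OF lc(1) that q] torsion_hf(2)[OF lc(2) that q]
      by (simp add: b_def K_diff K_add algebra_simps)
    then have "K (K (b (hf X) (jf (hf Y)) - b (hf Y) (jf (hf X)))) = 0" by (simp add: K_0)
    then show ?thesis by (simp add: K_K)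
  qed
  \<comment> \<open>The inverse of \<open>jf\<close> on horizontal fields, that is, - J on vertical
    sections; K reappears because it is its own inverse.\<close>
  define lift where "lift U = field (\<lambda>z. (K (snd (comp U z)), - nfun z (K (snd (comp U z)))))" for U
  have lift_VF: "lift U \<in> VF" if "U \<in> VS" for U
    unfolding lift_def
    by (intro field_VF smooth_on_Pair smooth_on_minus smooth_nfun_along smooth_K smooth_on_snd open_\<Omega> smooth_comp[OF that])
  have lift_apply: "lift U q C = (K (snd (U q C)), - nfun (snd C q) (K (snd (U q C))))" if "q \<in> U'" for U q
    unfolding lift_def by (simp add: field_apply[OF that] comp_apply[OF that])
  have hf_lift: "hf (lift U) = lift U" if "U \<in> VS" for U
    by (rule VF_eqI[OF hf_VF[OF lift_VF[OF that]] lift_VF[OF that]])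
      (simp add: hf_apply[OF lift_VF[OF that]] lift_apply)
  have jhf_lift: "jf (hf (lift U)) = U" if "U \<in> VS" for U
    by (rule VF_eqI[OF VS_VF[OF jhf_VS[OF lift_VF[OF that]]] VS_VF[OF that]])
      (simp add: jhf_apply[OF lift_VF[OF that]] lift_apply K_K VS_fst[OF that] prod_eq_iff)
  have sym_l: "b (lift U) V = b (lift V) U" if "U \<in> VS" "V \<in> VS" for U V
    using sym_h[OF lift_VF[OF that(1)] lift_VF[OF that(2)]]
    unfolding jhf_lift[OF that(1)] jhf_lift[OF that(2)] unfolding hf_lift[OF that(1)] hf_lift[OF that(2)] .
  have hf_eq: "hf X = lift (jf (hf X))"
    by (rule VF_eqI[OF hf_VF[OF X] lift_VF[OF jhf_VS[OF X]]])
      (simp add: hf_apply[OF X] lift_apply jhf_apply[OF X] K_K)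
  have X_eq: "X = sec_add U' (vf X) (hf X)"
    by (rule VF_eqI[OF X sec_add_VF[OF VS_VF[OF vf_VS[OF X]] hf_VF[OF X]]])
      (simp add: sec_add_apply vf_apply[OF X] hf_apply[OF X] prod_eq_iff)
  have b_add: "b X U = b (vf X) U + b (hf X) U"
  proof -
    have "n X U q C = n (vf X) U q C + n (hf X) U q C" if "lc n" for n
      using arg_cong[OF X_eq, of "\<lambda>X. n X U q C"]
      unfolding lc_add_left[OF that VS_VF[OF vf_VS[OF X]] hf_VF[OF X] U] sec_add_apply[OF q] .
    from this[OF lc(1)] this[OF lc(2)] show ?thesis by (simp add: b_def)
  qed
  have f0: "f X U W = 0" if W: "W \<in> VS" for W
  proof -
    have fv: "f U V W = f V U W" if "U \<in> VS" "V \<in> VS" for U V W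
      unfolding f_def sym_v[OF that] ..
    have fl: "f (lift U) V W = f (lift V) U W" if "U \<in> VS" "V \<in> VS" for U V W
      unfolding f_def sym_l[OF that] ..
    have "f (vf X) U W = 0"
    proof (rule braid_zero[where f=f and X=VS, OF _ _ vf_VS[OF X] U W])
      show "f U V W = f V U W" if "U \<in> VS" "V \<in> VS" for U V W by (rule fv[OF that])
      show "f U V W = - f U W V" if "U \<in> VS" "V \<in> VS" "W \<in> VS" for U V W
        by (rule skew[OF VS_VF[OF that(1)] that(2,3)])
    qed
    moreover have "f (lift (jf (hf X))) U W = 0"
    proof (rule braid_zero[where f="\<lambda>U. f (lift U)" and X=VS, OF _ _ jhf_VS[OF X] U W])
      show "f (lift U) V W = f (lift V) U W" if "U \<in> VS" "V \<in> VS" for U V W by (rule fl[OF that])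
      show "f (lift U) V W = - f (lift U) W V" if "U \<in> VS" "V \<in> VS" "W \<in> VS" for U V W
        by (rule skew[OF lift_VF[OF that(1)] that(2,3)])
    qed
    ultimately show ?thesis unfolding hf_eq[symmetric] by (simp add: f_def b_add inner_add_left)
  qed
  \<comment> \<open>Vertical fields with constant components realise every vector a at q, so
    nondegeneracy applies.\<close>
  have "b X U \<bullet> (G ?z *v a) = 0" for a
  proof -
    have "field (\<lambda>z. (0, a)) \<in> VS" by (rule field_VS[OF smooth_on_const[OF open_\<Omega>]]) simp
    from f0[OF this] show ?thesis by (simp add: f_def field_apply[OF q])
  qed
  then have "b X U = 0" by (rule nondegenerate_matrix[OF G_inv[OF \<Omega>I[OF q]]])
  then have "n1 X U q C = n2 X U q C"
    using VS_fst[OF lc_VS[OF lc(1) X U] q] VS_fst[OF lc_VS[OF lc(2) X U] q] by (simp add: b_def prod_eq_iff)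
  then show ?thesis
    by (rule TM.tangent_space_eqI[OF lc_tangent[OF lc(1) X U q] lc_tangent[OF lc(2) X U q] C UC[OF q]])
qed

text \<open>Connections are extensional in both arguments and their values are extensional sections,
  so agreement at the points of \<open>U'\<close> is equality of functions, as
  \<open>\<exists>!\<close> requires.\<close>

lemma solution_unique:
  assumes "is_solution n1" "is_solution n2"
  shows "n1 = n2"
proof -
  note lc = is_solution_lc[OF assms(1)] is_solution_lc[OF assms(2)]
  note PiE = lc_PiE[OF lc(1)] lc_PiE[OF lc(2)]
  show ?thesis
  proof (rule PiE_ext[OF PiE])
    fix X assume X: "X \<in> VF"
    show "n1 X = n2 X"
    proof (rule PiE_ext[OF PiE_mem[OF PiE(1) X] PiE_mem[OF PiE(2) X]])
      fix U assume U: "U \<in> VS"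
      show "n1 X U = n2 X U"
      proof (rule extensionalityI)
        show "n1 X U \<in> extensional U'" "n2 X U \<in> extensional U'"
          by (rule TM.sections_extensional[OF lc_VS[OF lc(1) X U]], rule TM.sections_extensional[OF lc_VS[OF lc(2) X U]])
      qed (rule solution_unique_at[OF assms X U])
    qed
  qed
qed

end

section \<open>The pseudo-Finsler situation\<close>

text \<open>\<open>J\<close> and \<open>g\<close> are known to be linear only on the tangent or
  vertical space of a point, not on all families of components, so the facts about
  \<open>linear\<close> do not apply to them.\<close>

lemma linear_on_sum:
  fixes \<phi> :: "'v::real_vector \<Rightarrow> 'w::real_vector"
  assumes "subspace V" "\<And>u u' a b. u \<in> V \<Longrightarrow> u' \<in> V \<Longrightarrow> \<phi> (a *\<^sub>R u + b *\<^sub>R u') = a *\<^sub>R \<phi> u + b *\<^sub>R \<phi> u'"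
    and "finite I" "\<And>i. i \<in> I \<Longrightarrow> w i \<in> V"
  shows "\<phi> (\<Sum>i\<in>I. r i *\<^sub>R w i) = (\<Sum>i\<in>I. r i *\<^sub>R \<phi> (w i))"
  using assms(3,4)
proof (induction I rule: finite_induct)
  case empty
  have "\<phi> (0 *\<^sub>R 0 + 0 *\<^sub>R 0) = 0 *\<^sub>R \<phi> 0 + 0 *\<^sub>R \<phi> 0"
    using assms(2)[OF subspace_0[OF assms(1)] subspace_0[OF assms(1)]] .
  then show ?case by simp
next
  case (insert i I)
  have "(\<Sum>i\<in>I. r i *\<^sub>R w i) \<in> V"
    by (intro subspace_sum subspace_scale assms(1)) (use insert.prems in blast)
  then have "\<phi> (r i *\<^sub>R w i + 1 *\<^sub>R (\<Sum>i\<in>I. r i *\<^sub>R w i)) = r i *\<^sub>R \<phi> (w i) + 1 *\<^sub>R \<phi> (\<Sum>i\<in>I. r i *\<^sub>R w i)"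
    by (intro assms(2) insert.prems) simp_all
  then show ?case using insert by simp
qed

lemma vec_sum_axis: "(\<Sum>i\<in>UNIV. x $ i *\<^sub>R axis i 1) = (x :: real^'m)"
  using basis_expansion[of x] by (simp add: scalar_mult_eq_scaleR)

lemma linear_vec_sum:
  fixes L :: "real^'m \<Rightarrow> 'v::real_vector"
  assumes "linear L"
  shows "(\<Sum>i\<in>UNIV. x $ i *\<^sub>R L (axis i 1)) = L x"
proof -
  have "(\<Sum>i\<in>UNIV. x $ i *\<^sub>R L (axis i 1)) = L (\<Sum>i\<in>UNIV. x $ i *\<^sub>R axis i 1)"
    by (simp add: linear_sum[OF assms] linear_scale[OF assms])
  then show ?thesis by (simp only: vec_sum_axis)
qed

context horizontal_domain
begin

lemma dy_eq: "dy A c i q = vert (axis i 1) q"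
  by (simp add: dy_def vert_def)

lemma dx_sub_dy:
  assumes "q \<in> U'"
  shows "dx A c i q - (\<Sum>j\<in>UNIV. n j *\<^sub>R dy A c j q) \<in> tangent_space TA q"
    "(dx A c i q - (\<Sum>j\<in>UNIV. n j *\<^sub>R dy A c j q)) C = (axis i 1, - (\<chi> j. n j))"
proof -
  have dx: "dx A c i q \<in> tangent_space TA q" "dx A c i q C = (axis i 1, 0)"
    unfolding dx_def by (rule TM.coord_vector_tangent[OF C UC[OF assms]], rule TM.coord_vector_apply[OF C UC[OF assms]])
  show "dx A c i q - (\<Sum>j\<in>UNIV. n j *\<^sub>R dy A c j q) \<in> tangent_space TA q"
    unfolding dy_eq
    by (intro subspace_diff subspace_sum subspace_scale TM.subspace_tangent_space dx vert_tangent assms)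
  have "(\<Sum>j\<in>UNIV. n j *\<^sub>R dy A c j q) C = (\<Sum>j\<in>UNIV. (0, n j *\<^sub>R axis j 1))"
    by (simp add: tvec_sum_apply scaleR_fun_def dy_eq vert_apply[OF assms])
  also have "\<dots> = (0, \<chi> j. n j)"
    using vec_sum_axis[of "\<chi> j. n j"] by (simp add: sum_prod)
  finally show "(dx A c i q - (\<Sum>j\<in>UNIV. n j *\<^sub>R dy A c j q)) C = (axis i 1, - (\<chi> j. n j))"
    by (simp add: dx(2))
qed

text \<open>By \<open>H_iff\<close> the condition under \<open>THE\<close> is an equation for the
  rows of N, hence has exactly one solution.\<close>

lemma nlc_coeff_eq:
  assumes "q \<in> U'"
  shows "nlc_coeff A H c q = (\<lambda>i j. nfun (snd C q) (axis i 1) $ j)"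
proof -
  have iff: "dx A c i q - (\<Sum>j\<in>UNIV. n j *\<^sub>R dy A c j q) \<in> H q \<longleftrightarrow> (\<chi> j. n j) = nfun (snd C q) (axis i 1)" for i n
    unfolding H_iff[OF assms dx_sub_dy(1)[OF assms]] dx_sub_dy(2)[OF assms] by simp
  show ?thesis
    unfolding nlc_coeff_def iff
  proof (rule the_equality)
    fix n :: "'m \<Rightarrow> 'm \<Rightarrow> real" assume n: "\<forall>i. (\<chi> j. n i j) = nfun (snd C q) (axis i 1)"
    show "n = (\<lambda>i j. nfun (snd C q) (axis i 1) $ j)"
    proof (intro ext)
      fix i j
      show "n i j = nfun (snd C q) (axis i 1) $ j" using spec[OF n, of i, symmetric] by simp
    qed
  qed simp
qed

lemma delta_tangent: "q \<in> U' \<Longrightarrow> delta A H c i q \<in> tangent_space TA q"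
  and delta_apply: "q \<in> U' \<Longrightarrow> delta A H c i q C = (axis i 1, - nfun (snd C q) (axis i 1))"
  unfolding delta_def by (rule dx_sub_dy(1), assumption) (subst dx_sub_dy(2), assumption, simp add: nlc_coeff_eq)

text \<open>With \<xi> = fst (w C) and u = snd (w C) + N \<xi>, the vector splits into (\<xi>, - N
  \<xi>) and (0, u). The values on the frames send the first part to (0, K \<xi>) and the second to
  (- K u, N (K u)).\<close>

lemma endomorphism_from_frame:
  assumes "q \<in> U'"
    and J: "\<And>u. u \<in> tangent_space TA q \<Longrightarrow> J u \<in> tangent_space TA q"
    and lin: "\<And>u w a b. u \<in> tangent_space TA q \<Longrightarrow> w \<in> tangent_space TA q \<Longrightarrow>
      J (a *\<^sub>R u + b *\<^sub>R w) = a *\<^sub>R J u + b *\<^sub>R J w"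
    and K: "linear K"
    and delta: "\<And>i. J (delta A H c i q) C = (0, K (axis i 1))"
    and dy: "\<And>i. J (dy A c i q) C = (- K (axis i 1), nfun (snd C q) (K (axis i 1)))"
    and w: "w \<in> tangent_space TA q"
  shows "J w C = (- K (snd (w C) + nfun (snd C q) (fst (w C))),
    K (fst (w C)) + nfun (snd C q) (K (snd (w C) + nfun (snd C q) (fst (w C)))))"
proof -
  let ?N = "nfun (snd C q)" and ?x = "fst (w C)"
  define u where "u = snd (w C) + ?N ?x"
  note N = linear_nfun[OF \<Omega>I[OF assms(1)]]
  note sub = TM.subspace_tangent_space[of q]
  let ?X = "\<Sum>i\<in>UNIV. ?x $ i *\<^sub>R delta A H c i q" and ?Y = "\<Sum>i\<in>UNIV. u $ i *\<^sub>R dy A c i q"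
  have d: "delta A H c i q \<in> tangent_space TA q" "dy A c i q \<in> tangent_space TA q" for i
    unfolding dy_eq by (rule delta_tangent[OF assms(1)], rule vert_tangent[OF assms(1)])
  have XY: "?X \<in> tangent_space TA q" "?Y \<in> tangent_space TA q"
    by (intro subspace_sum subspace_scale sub d)+
  have X: "?X C = (?x, - ?N ?x)"
  proof -
    have "?X C = (\<Sum>i\<in>UNIV. (?x $ i *\<^sub>R axis i 1, ?x $ i *\<^sub>R (- ?N (axis i 1))))"
      by (simp add: tvec_sum_apply scaleR_fun_def delta_apply[OF assms(1)])
    then show ?thesis
      using linear_vec_sum[OF linear_compose_neg[OF N], of ?x] vec_sum_axis[of ?x] by (simp add: sum_prod)
  qed
  have Y: "?Y C = (0, u)"
  proof -
    have "?Y C = (\<Sum>i\<in>UNIV. (0, u $ i *\<^sub>R axis i 1))"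
      by (simp add: tvec_sum_apply scaleR_fun_def dy_eq vert_apply[OF assms(1)])
    then show ?thesis using vec_sum_axis[of u] by (simp add: sum_prod)
  qed
  have "w = ?X + ?Y"
    by (rule TM.tangent_space_eqI[OF w subspace_add[OF sub XY] C UC[OF assms(1)]], unfold plus_fun_apply X Y)
      (simp add: u_def prod_eq_iff)
  then have "J w = J ?X + J ?Y" using lin[OF XY, of 1 1] by simp
  also have "J ?X = (\<Sum>i\<in>UNIV. ?x $ i *\<^sub>R J (delta A H c i q))"
    by (rule linear_on_sum[where \<phi>=J, OF sub]) (simp_all add: lin d)
  also have "J ?Y = (\<Sum>i\<in>UNIV. u $ i *\<^sub>R J (dy A c i q))"
    by (rule linear_on_sum[where \<phi>=J, OF sub]) (simp_all add: lin d)
  finally have "J w C = (\<Sum>i\<in>UNIV. (0, ?x $ i *\<^sub>R K (axis i 1))) +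
      (\<Sum>i\<in>UNIV. (u $ i *\<^sub>R (- K (axis i 1)), u $ i *\<^sub>R ?N (K (axis i 1))))"
    by (simp add: tvec_sum_apply scaleR_fun_def delta dy)
  also have "\<dots> = (- K u, K ?x + ?N (K u))"
    using linear_vec_sum[OF K, of ?x] linear_vec_sum[OF linear_compose_neg[OF K], of u]
      linear_vec_sum[OF linear_compose[OF K N], of u] by (simp add: sum_prod o_def)
  finally show ?thesis unfolding u_def .
qed

lemma metric_from_frame:
  assumes "finsler_metric A M' F g" "q \<in> U'" "u \<in> vertical A q" "w \<in> vertical A q"
  shows "g q u w = snd (u C) \<bullet> (finsler_matrix A F c q *v snd (w C))"
proof -
  let ?V = "vertical A q" and ?u = "snd (u C)" and ?w = "snd (w C)"
  have q: "q \<in> M'" "fst q \<in> fst c" using UM UC assms(2) by (auto simp: fst_tangent_chart)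
  have bil: "g q (a *\<^sub>R u + b *\<^sub>R u') w = a * g q u w + b * g q u' w"
    "g q w (a *\<^sub>R u + b *\<^sub>R u') = a * g q w u + b * g q w u'"
    if "u \<in> ?V" "u' \<in> ?V" "w \<in> ?V" for u u' w a b
    using assms(1) q(1) that unfolding finsler_metric_def by blast+
  have mat: "g q (dy A c i q) (dy A c j q) = finsler_matrix A F c q $ i $ j" for i j
    using assms(1) q c unfolding finsler_metric_def by blast
  note sub = subspace_vertical[OF q(1)]
  have d: "dy A c i q \<in> ?V" for i unfolding dy_eq by (rule vert_vertical[OF assms(2)])
  have exp: "v = (\<Sum>i\<in>UNIV. snd (v C) $ i *\<^sub>R dy A c i q)" if v: "v \<in> ?V" for v
  proof (rule TM.tangent_space_eqI[OF _ _ C UC[OF assms(2)]])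
    show "v \<in> tangent_space TA q" using vertical_subset v by blast
    show "(\<Sum>i\<in>UNIV. snd (v C) $ i *\<^sub>R dy A c i q) \<in> tangent_space TA q"
      unfolding dy_eq by (intro subspace_sum subspace_scale TM.subspace_tangent_space vert_tangent assms(2))
    have "(\<Sum>i\<in>UNIV. snd (v C) $ i *\<^sub>R dy A c i q) C = (\<Sum>i\<in>UNIV. (0, snd (v C) $ i *\<^sub>R axis i 1))"
      by (simp add: tvec_sum_apply scaleR_fun_def dy_eq vert_apply[OF assms(2)])
    also have "\<dots> = (0, snd (v C))" using vec_sum_axis[of "snd (v C)"] by (simp add: sum_prod)
    finally show "v C = (\<Sum>i\<in>UNIV. snd (v C) $ i *\<^sub>R dy A c i q) C"
      using vertical_eq_vert(2)[OF assms(2) v] by simp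
  qed
  have "g q (\<Sum>i\<in>UNIV. ?u $ i *\<^sub>R dy A c i q) w = (\<Sum>i\<in>UNIV. ?u $ i *\<^sub>R g q (dy A c i q) w)"
    by (rule linear_on_sum[where \<phi>="\<lambda>x. g q x w", OF sub]) (simp_all add: bil assms(4) d)
  moreover have "g q (dy A c i q) (\<Sum>j\<in>UNIV. ?w $ j *\<^sub>R dy A c j q) = (\<Sum>j\<in>UNIV. ?w $ j *\<^sub>R g q (dy A c i q) (dy A c j q))" for i
    by (rule linear_on_sum[where \<phi>="\<lambda>x. g q (dy A c i q) x", OF sub]) (simp_all add: bil d)
  ultimately have "g q u w = (\<Sum>i\<in>UNIV. ?u $ i * (\<Sum>j\<in>UNIV. ?w $ j * finsler_matrix A F c q $ i $ j))"
    unfolding exp[OF assms(3), symmetric] exp[OF assms(4), symmetric] mat by simp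
  then show ?thesis by (simp add: inner_vec_def matrix_vector_mult_def mult.commute)
qed

text \<open>Symmetry of the matrix is the equality of the mixed second derivatives of F in the fibre
  directions.\<close>

lemma smooth_finsler_matrix:
  assumes "smooth_function TA M' F"
  shows "smooth_on \<Omega> (\<lambda>z. finsler_matrix A F c (chart_inv C z))"
    "z \<in> \<Omega> \<Longrightarrow> transpose (finsler_matrix A F c (chart_inv C z)) = finsler_matrix A F c (chart_inv C z)"
proof -
  let ?f = "F \<circ> chart_inv C"
  have "smooth_on (snd C ` (M' \<inter> fst C)) ?f" using assms C by (simp add: smooth_function_def)
  then have f: "smooth_on \<Omega> ?f" by (rule smooth_on_subset) (use U_sub in blast)
  let ?g = "\<lambda>z i j. 1/2 * frechet_derivative (\<lambda>z. frechet_derivative ?f (at z) (0, axis j 1)) (at z) (0, axis i 1)"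
  have eq: "(\<chi> i j. ?g z i j) = finsler_matrix A F c (chart_inv C z)" if "z \<in> \<Omega>" for z
    unfolding finsler_matrix_def Let_def C_inv[OF that] ..
  have "smooth_on \<Omega> (\<lambda>z. \<chi> i j. ?g z i j)"
    by (intro smooth_on_vec_lambda smooth_on_mult smooth_on_const smooth_on_frechet f open_\<Omega>)
  then show "smooth_on \<Omega> (\<lambda>z. finsler_matrix A F c (chart_inv C z))"
    by (rule smooth_on_cong[OF open_\<Omega>, rotated]) (rule eq)
  show "transpose (finsler_matrix A F c (chart_inv C z)) = finsler_matrix A F c (chart_inv C z)" if "z \<in> \<Omega>"
  proof -
    have "?g z j i = ?g z i j" for i j
      unfolding smooth_on_second_derivative_symmetric_real[OF open_\<Omega> f that, of "(0, axis i 1)"] ..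
    then show ?thesis
      unfolding eq[OF that, symmetric] transpose_def by (simp add: vec_eq_iff)
  qed
qed

end

text \<open>The involution by which \<open>J\<^sub>1\<close> and \<open>J\<^sub>3\<close> identify the components along the frames \<open>\<delta>\<^sub>i\<close> and \<open>\<partial>\<^sub>i\<close>.\<close>

definition frame_involution :: "nat \<Rightarrow> real^('n::finite + 'n) \<Rightarrow> real^('n + 'n)"
  where "frame_involution a \<xi> = (\<chi> i. case i of
    Inl \<alpha> \<Rightarrow> if a = 1 then \<xi> $ Inl \<alpha> else - \<xi> $ Inr \<alpha> |
    Inr \<alpha> \<Rightarrow> if a = 1 then - \<xi> $ Inr \<alpha> else - \<xi> $ Inl \<alpha>)"

lemma linear_frame_involution: "linear (frame_involution a)"
  by (rule linearI) (auto simp: frame_involution_def vec_eq_iff split: sum.split)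

lemma frame_involution_involution: "frame_involution a (frame_involution a x) = x"
  by (auto simp: frame_involution_def vec_eq_iff split: sum.split)

lemma frame_involution_axis:
  "frame_involution 1 (axis (Inl \<alpha>) 1) = axis (Inl \<alpha>) 1"
  "frame_involution 1 (axis (Inr \<alpha>) 1) = - axis (Inr \<alpha>) 1"
  "frame_involution 3 (axis (Inl \<alpha>) 1) = - axis (Inr \<alpha>) 1"
  "frame_involution 3 (axis (Inr \<alpha>) 1) = - axis (Inl \<alpha>) 1"
  by (auto simp: frame_involution_def vec_eq_iff axis_def split: sum.split)

text \<open>For a = 1 and a = 3 the prescribed values follow one pattern: J sends the i-th
  \<open>delta\<close> to the vertical vector K e_i, and the i-th \<open>dy\<close> to minus the
  horizontal vector over K e_i, with the same K = \<open>frame_involution a\<close> both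
  times.\<close>

lemma hypercomplex_comp:
  fixes A :: "('a, real^('n::finite + 'n)) chart set"
  assumes "horizontal_domain A M' c U' H" "almost_hypercomplex A H c U' J" "a \<in> {1, 3}"
    and "q \<in> U'" "w \<in> tangent_space (tangent_atlas A) q"
  defines "C \<equiv> tangent_chart A c" and "N \<equiv> horizontal_domain.nfun A c H (snd (tangent_chart A c) q)"
    and "K \<equiv> frame_involution a"
  shows "J a q w \<in> tangent_space (tangent_atlas A) q"
    "J a q w C = (- K (snd (w C) + N (fst (w C))), K (fst (w C)) + N (K (snd (w C) + N (fst (w C)))))"
proof -
  interpret horizontal_domain A M' c U' H by (rule assms(1))
  note J = bspec[OF assms(2)[unfolded almost_hypercomplex_def] assms(4)]
  have a: "a \<in> {1, 2, 3}" using assms(3) by blast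
  note tan = conjunct1[OF bspec[OF conjunct1[OF J] a]] and lin = conjunct2[OF bspec[OF conjunct1[OF J] a]]
  show "J a q w \<in> tangent_space (tangent_atlas A) q" by (rule bspec[OF tan assms(5)])
  note frame = spec[OF conjunct2[OF J]]
  have neg: "N (- x) = - N x" for x
    unfolding N_def by (rule linear_neg[OF linear_nfun[OF \<Omega>I[OF assms(4)]]])
  note apply_simps = delta_apply[OF assms(4), folded N_def, folded C_def]
    vert_apply[OF assms(4), folded C_def] frame_involution_axis neg K_def
  have comps: "J a q (delta A H c i q) C = (0, K (axis i 1)) \<and> J a q (dy A c i q) C = (- K (axis i 1), N (K (axis i 1)))" for i
  proof (cases "a = 1")
    case True
    show ?thesis
    proof (cases i)
      case (Inl \<alpha>)
      show ?thesis unfolding Inl True using frame[of \<alpha>] by (simp add: apply_simps True dy_eq del: One_nat_def)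
    next
      case (Inr \<alpha>)
      show ?thesis unfolding Inr True using frame[of \<alpha>] by (simp add: apply_simps True dy_eq del: One_nat_def)
    qed
  next
    case False
    then have a3: "a = 3" using assms(3) by simp
    show ?thesis
    proof (cases i)
      case (Inl \<alpha>)
      show ?thesis unfolding Inl a3 using frame[of \<alpha>] by (simp add: apply_simps a3 dy_eq)
    next
      case (Inr \<alpha>)
      show ?thesis unfolding Inr a3 using frame[of \<alpha>] by (simp add: apply_simps a3 dy_eq)
    qed
  qed
  show "J a q w C = (- K (snd (w C) + N (fst (w C))), K (fst (w C)) + N (K (snd (w C) + N (fst (w C)))))"
    unfolding C_def N_def K_def
  proof (rule endomorphism_from_frame[OF assms(4) _ _ linear_frame_involution _ _ assms(5)])
    show "J a q u \<in> tangent_space TA q" if "u \<in> tangent_space TA q" for u by (rule bspec[OF tan that])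
    show "J a q (k *\<^sub>R u + l *\<^sub>R v) = k *\<^sub>R J a q u + l *\<^sub>R J a q v"
      if "u \<in> tangent_space TA q" "v \<in> tangent_space TA q" for u v k l
      using bspec[OF bspec[OF lin that(1)] that(2)] by blast
  qed (use comps[unfolded C_def N_def K_def] in blast)+
qed

theorem theorem3p2:
  fixes A :: "('a, real^('n::finite + 'n)) chart set"
    and M' U' :: "('a, real^('n + 'n)) tpoint set"
    and F :: "('a, real^('n + 'n)) tpoint \<Rightarrow> real"
    and q a :: nat
  assumes "pseudo_finsler A M' F q"
    and "finsler_metric A M' F g"
    and "nonlinear_connection A M' H"
    and "skew_finsler_tensor A M' S"
    and "skew_finsler_tensor A M' T"
    and "c \<in> A"
    and "openin (manifold_topology (tangent_atlas A)) U'"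
    and "U' \<subseteq> M' \<inter> fst (tangent_chart A c)"
    and "almost_hypercomplex A H c U' J"
    and "a \<in> {1, 3}"
  shows "\<exists>!nabla.
    linear_connection (tangent_atlas A) U' (vertical A) nabla \<and>
    (\<forall>X\<in>vector_fields (tangent_atlas A) U'.
      \<forall>U\<in>sections (tangent_atlas A) U' (vertical A).
      \<forall>W\<in>sections (tangent_atlas A) U' (vertical A). \<forall>p\<in>U'.
        tderiv (tangent_atlas A) p (X p) (\<lambda>p. g p (U p) (W p)) =
          g p (nabla X U p) (W p) + g p (U p) (nabla X W p)) \<and>
    (let D = induced_connection A H U' (J a) nabla;
         h = hproj A H; v = vproj A H in
      \<forall>X\<in>vector_fields (tangent_atlas A) U'.
      \<forall>Y\<in>vector_fields (tangent_atlas A) U'. \<forall>p\<in>U'.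
        torsion (tangent_atlas A) D (sec_map U' v X) (sec_map U' v Y) p =
          tensor_at A M' S p (v p (X p)) (v p (Y p)) \<and>
        h p (torsion (tangent_atlas A) D (sec_map U' h X) (sec_map U' h Y) p) =
          J a p (tensor_at A M' T p (J a p (h p (Y p))) (J a p (h p (X p)))))"
proof -
  have smooth: "smooth_manifold A"
    and M: "openin (manifold_topology (tangent_atlas A)) M'"
    and F: "smooth_function (tangent_atlas A) M' F" and q: "0 < q" "q < CARD('n + 'n)"
    and count: "\<forall>c\<in>A. \<forall>p\<in>M'. fst p \<in> fst c \<longrightarrow>
      eigenvalue_count (finsler_matrix A F c p) {..<0} = q \<and>
      eigenvalue_count (finsler_matrix A F c p) {0<..} = CARD('n + 'n) - q"
    using assms(1) unfolding pseudo_finsler_def by blast+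
  have "tangent_open A M'"
    by unfold_locales (use smooth M in \<open>simp_all add: smooth_manifold_def maximal_atlas_def\<close>)
  then interpret tangent_open A M' .
  have HD: "horizontal_domain A M' c U' H"
    by unfold_locales (rule assms)+
  interpret horizontal_domain A M' c U' H by (rule HD)
  let ?G = "\<lambda>z. finsler_matrix A F c (chart_inv (tangent_chart A c) z)"
  have S: "skew_tensor A M' S" by unfold_locales (rule assms)
  have T: "skew_tensor A M' T" by unfold_locales (rule assms)
  have inv: "invertible (?G z)" if z: "z \<in> \<Omega>" for z
  proof (rule invertible_if_eigenvalue_counts[OF smooth_finsler_matrix(2)[OF F z] _ _ q])
    have "chart_inv C z \<in> M'" "fst (chart_inv C z) \<in> fst c"
      using UM[OF inv_C_in[OF z]] UC[OF inv_C_in[OF z]] by (simp_all add: fst_tangent_chart)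
    then show "eigenvalue_count (?G z) {..<0} = q" "eigenvalue_count (?G z) {0<..} = CARD('n + 'n) - q"
      using count c by blast+
  qed
  have g: "g p u w = snd (u C) \<bullet> (?G (snd C p) *v snd (w C))"
    if "p \<in> U'" "u \<in> vertical A p" "w \<in> vertical A p" for p u w
    unfolding inv_C[OF that(1)] by (rule metric_from_frame[OF assms(2) that])
  have LG: "local_geometry A M' c U' H (J a) (frame_involution a) ?G g S T"
  proof (rule local_geometry.intro[OF HD], rule local_geometry_axioms.intro)
    fix p w assume p: "p \<in> U'" "w \<in> tangent_space TA p"
    show "J a p w \<in> tangent_space TA p" by (rule hypercomplex_comp(1)[OF HD assms(9,10) p])
    show "J a p w C = (- frame_involution a (snd (w C) + nfun (snd C p) (fst (w C))),
        frame_involution a (fst (w C)) +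
        nfun (snd C p) (frame_involution a (snd (w C) + nfun (snd C p) (fst (w C)))))"
      by (rule hypercomplex_comp(2)[OF HD assms(9,10) p])
  next
    show "linear (frame_involution a)" by (rule linear_frame_involution)
    show "frame_involution a (frame_involution a x) = x" for x by (rule frame_involution_involution)
    show "smooth_on \<Omega> ?G" by (rule smooth_finsler_matrix(1)[OF F])
    show "transpose (?G z) = ?G z" "invertible (?G z)" if "z \<in> \<Omega>" for z
      by (rule smooth_finsler_matrix(2)[OF F that], rule inv[OF that])
    show "g p u w = snd (u C) \<bullet> (?G (snd C p) *v snd (w C))"
      if "p \<in> U'" "u \<in> vertical A p" "w \<in> vertical A p" for p u w
      by (rule g[OF that])
    show "skew_tensor A M' S" "skew_tensor A M' T" by (rule S, rule T)
  qed
  note solution = local_geometry.is_solution_def[OF LG]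
  show ?thesis
    unfolding Let_def
    \<comment> \<open>\<open>is_solution\<close> unfolds to the stated conditions:
      \<open>conn\<close> is the witness, and any other solution is compared with it.\<close>
    by (rule ex1I, rule local_geometry.is_solution_conn[OF LG, unfolded solution],
        rule local_geometry.solution_unique[OF LG _ local_geometry.is_solution_conn[OF LG]], unfold solution)
qed

end
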